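(* If $Z=(X,Y)\in\Omega_{nn}$, then $Z$ is locally $\Sigma$-equivalent near the origin to $Z_{nn}=(X_{nn},Y_{nn})\in\Omega_{nn}$, where $$X_{nn}(x,y)=(2\gamma x+y,\ x+2\gamma y),\qquad Y_{nn}(x,y)=(2\eta x+y,\ x+2\eta y),$$ and $$\begin{cases}\gamma=\eta=\mathrm{sign}(\lambda_1^++\lambda_2^+)&\text{when }(\lambda_1^++\lambda_2^+)(\lambda_1^-+\lambda_2^-)>0,\\ \gamma=-\eta=1&\text{when }(\lambda_1^++\lambda_2^+)(\lambda_1^-+\lambda_2^-)<0.\end{cases}$$
   Context: Let $\mathcal U\subset\mathbb R^2$ be a bounded open set containing the origin $O$, and let $\mathfrak X$ be the set of $\mathcal C^1$ vector fields on $\mathcal U$. Put $\Sigma^+=\{(x,y)\in\mathcal U:y>0\}$, $\Sigma^-=\{(x,y)\in\mathcal U:y<0\}$, $\Sigma=\{(x,y)\in\mathcal U:y=0\}$ (the switching line). $\Omega$ is the set of piecewise smooth vector fields $Z=(X,Y)$, with $X=(X_1,X_2)$, $Y=(Y_1,Y_2)\in\mathfrak X$, given by $Z=X$ on $\Sigma^+$ and $Z=Y$ on $\Sigma^-$. On $\Sigma$, $Z$ is defined to be $Z_\Sigma$ by the Filippov convention. If $X\equiv Y$ on $\Sigma$, then $Z_\Sigma=X=Y$. Otherwise: on the crossing set $\Sigma^c=\{p\in\Sigma:X_2(p)Y_2(p)>0\}$, $Z_\Sigma=X$ if $X_2>0$ and $Z_\Sigma=Y$ if $X_2<0$ (orbits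 cross $\Sigma$ there); on the sliding set $\Sigma^s=\{p\in\Sigma:X_2(p)Y_2(p)\le0\}$, $Z_\Sigma=\left(\frac{Y_2X_1-X_2Y_1}{Y_2-X_2},0\right)$ if $X_2\ne Y_2$, and $Z_\Sigma=(0,0)$ if $X_2=Y_2=0$. Orbits of $Z$ are obtained by concatenating orbits of $X$ in $\Sigma^+$, $Y$ in $\Sigma^-$ and $Z_\Sigma$ in $\Sigma$. $\Omega_0\subset\Omega$ is the set of $Z=(X,Y)$ with $X(0,0)=Y(0,0)=(0,0)$, $\det A^+\det A^-\neq0$ and $X_{2x}(0,0)\,Y_{2x}(0,0)>0$, where $A^+$ (resp. $A^-$) is the Jacobian matrix of $X$ (resp. $Y$) at $O$ and the subscript $x$ denotes the partial derivative in $x$. Let $\lambda_1^\pm,\lambda_2^\pm$ be the eigenvalues of $A^\pm$. Then $\Omega_1=\{Z\in\Omega_0:\lambda_1^+\ne\lambda_2^+,\ \lambda_1^-\ne\lambda_2^-,\ \ell\ne0\}$, where $\ell=\frac{\mathrm{Re}\lambda_1^+}{|\mathrm{Im}\lambda_1^+|}+\frac{\mathrm{Re}\lambda_1^-}{|\mathrm{Im}\lambda_1^-|}$ if $\mathrm{Im}\lambda_1^+\,\mathrm{Im}\lambda_1^-\ne0$, and $\ell=1$ if $\mathrm{Im}\lambda_1^+\,\mathrm{Im}\lambda_1^-=0$. Further, $\Omega_{nn}=\{Z\in\Omega_1:\lambda_1^\pm,\lambda_2^\pm\in\mathbb R,\ \lambda_1^+\lambda_2^+>0,\ \lambda_1^-\lambda_2^->0\}$.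 $Z_1,Z_2\in\Omega_0$ are locally $\Sigma$-equivalent near the origin if there exist neighborhoods $U,V$ of the origin and a homeomorphism $H:U\to V$ that maps the orbits of $Z_1$ in $U$ onto the orbits of $Z_2$ in $V$, preserving the direction of time, and sends $\Sigma\cap U$ to $\Sigma\cap V$. *)

theory Defs
  imports "HOL-Analysis.Analysis"
begin

text \<open>
  Planar vector fields are total functions of which only the values on the domain \<open>W\<close>
  (the bounded open set containing the origin) are relevant. A piecewise smooth vector field
  is the pair \<open>(X, Y)\<close>; the coordinates of \<open>p\<close> are \<open>x = p $ 1\<close> and \<open>y = p $ 2\<close>.
\<close>

type_synonym vfield = "real^2 \<Rightarrow> real^2"

definition C1_vfield :: "(real^2) set \<Rightarrow> vfield \<Rightarrow> bool" where
  "C1_vfield W X \<longleftrightarrow>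
     (\<forall>p\<in>W. X differentiable (at p)) \<and> continuous_on W (\<lambda>p. jacobian X (at p))"

definition upper :: "(real^2) set \<Rightarrow> (real^2) set" where
  "upper W = {p\<in>W. p $ 2 > 0}"

definition lower :: "(real^2) set \<Rightarrow> (real^2) set" where
  "lower W = {p\<in>W. p $ 2 < 0}"

definition switching_line :: "(real^2) set \<Rightarrow> (real^2) set" where
  "switching_line W = {p\<in>W. p $ 2 = 0}"

definition Omega :: "(real^2) set \<Rightarrow> (vfield \<times> vfield) set" where
  "Omega W = {(X, Y). C1_vfield W X \<and> C1_vfield W Y}"

text \<open>
  The field on the switching line. In the last branch \<open>X\<^sub>2 = Y\<^sub>2\<close> and \<open>X\<^sub>2 Y\<^sub>2 \<le> 0\<close>,
  so both second components vanish.
\<close>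

definition Z_switch :: "(real^2) set \<Rightarrow> vfield \<times> vfield \<Rightarrow> vfield" where
  "Z_switch W Z p = (case Z of (X, Y) \<Rightarrow>
     if \<forall>q\<in>switching_line W. X q = Y q then X p
     else if X p $ 2 * Y p $ 2 > 0 then (if X p $ 2 > 0 then X p else Y p)
     else if X p $ 2 \<noteq> Y p $ 2
       then vector [(Y p $ 2 * X p $ 1 - X p $ 2 * Y p $ 1) / (Y p $ 2 - X p $ 2), 0]
     else 0)"

definition solution_arc :: "vfield \<Rightarrow> (real^2) set \<Rightarrow> real set \<Rightarrow> (real \<Rightarrow> real^2) \<Rightarrow> bool" where
  "solution_arc F R J \<phi> \<longleftrightarrow>
     \<phi> ` J \<subseteq> R \<and> (\<forall>t\<in>J. (\<phi> has_vector_derivative F (\<phi> t)) (at t))"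

text \<open>
  A trajectory staying in \<open>S\<close> is a continuous concatenation of solution arcs of \<open>X\<close> in the
  upper part, of \<open>Y\<close> in the lower part and of the field on the switching line; \<open>T\<close> is the set
  of times at which arcs are joined (together with the end points of \<open>I\<close>, if they belong
  to \<open>I\<close>). It may be infinite, but not accumulate inside \<open>I\<close>.
\<close>

definition trajectory ::
  "(real^2) set \<Rightarrow> vfield \<times> vfield \<Rightarrow> (real^2) set \<Rightarrow> real set \<Rightarrow> (real \<Rightarrow> real^2) \<Rightarrow> bool" where
  "trajectory W Z S I \<phi> \<longleftrightarrow>
     is_interval I \<and> I \<noteq> {} \<and> continuous_on I \<phi> \<and> \<phi> ` I \<subseteq> S \<and>
     (\<exists>T. (\<forall>a\<in>I. \<forall>b\<in>I. finite (T \<inter> {a..b})) \<and>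
          (\<forall>t\<in>I - T. \<exists>J. open J \<and> is_interval J \<and> t \<in> J \<and> J \<subseteq> I \<and>
             (solution_arc (fst Z) (upper W) J \<phi> \<or>
              solution_arc (snd Z) (lower W) J \<phi> \<or>
              solution_arc (Z_switch W Z) (switching_line W) J \<phi>)))"

text \<open>
  The orbits of \<open>Z\<close> in \<open>S\<close> are the trajectories that cannot be continued inside \<open>S\<close>. A map
  carries one orbit to another, preserving the direction of time, if it does so up to an
  increasing bijective change of time.
\<close>

definition orbit_in ::
  "(real^2) set \<Rightarrow> vfield \<times> vfield \<Rightarrow> (real^2) set \<Rightarrow> real set \<Rightarrow> (real \<Rightarrow> real^2) \<Rightarrow> bool" where
  "orbit_in W Z S I \<phi> \<longleftrightarrow>
     trajectory W Z S I \<phi> \<and>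
     (\<forall>I' \<phi>'. trajectory W Z S I' \<phi>' \<and> I \<subseteq> I' \<and> (\<forall>t\<in>I. \<phi>' t = \<phi> t) \<longrightarrow> I' = I)"

definition maps_orbit ::
  "(real^2 \<Rightarrow> real^2) \<Rightarrow> real set \<Rightarrow> (real \<Rightarrow> real^2) \<Rightarrow> real set \<Rightarrow> (real \<Rightarrow> real^2) \<Rightarrow> bool" where
  "maps_orbit H I \<phi> J \<psi> \<longleftrightarrow>
     (\<exists>\<tau>. strict_mono_on I \<tau> \<and> \<tau> ` I = J \<and> (\<forall>t\<in>I. H (\<phi> t) = \<psi> (\<tau> t)))"

definition locally_Sigma_equivalent ::
  "(real^2) set \<Rightarrow> vfield \<times> vfield \<Rightarrow> vfield \<times> vfield \<Rightarrow> bool" where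
  "locally_Sigma_equivalent W Z1 Z2 \<longleftrightarrow>
     (\<exists>U V H H'. open U \<and> 0 \<in> U \<and> U \<subseteq> W \<and> open V \<and> 0 \<in> V \<and> V \<subseteq> W \<and>
        homeomorphism U V H H' \<and>
        (\<forall>I \<phi>. orbit_in W Z1 U I \<phi> \<longrightarrow> (\<exists>J \<psi>. orbit_in W Z2 V J \<psi> \<and> maps_orbit H I \<phi> J \<psi>)) \<and>
        (\<forall>J \<psi>. orbit_in W Z2 V J \<psi> \<longrightarrow> (\<exists>I \<phi>. orbit_in W Z1 U I \<phi> \<and> maps_orbit H I \<phi> J \<psi>)) \<and>
        H ` (switching_line W \<inter> U) = switching_line W \<inter> V)"

text \<open>
  \<open>l1\<close> and \<open>l2\<close> are the complex eigenvalues of \<open>A\<close>, counted with algebraic multiplicity: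
  the characteristic polynomial of \<open>A\<close> is \<open>(z - l1) (z - l2)\<close>.
\<close>

definition eigenvalues :: "real^2^2 \<Rightarrow> complex \<Rightarrow> complex \<Rightarrow> bool" where
  "eigenvalues A l1 l2 \<longleftrightarrow>
     (\<forall>z. det (mat z - (\<chi> i j. complex_of_real (A $ i $ j))) = (z - l1) * (z - l2))"

text \<open>The entry \<open>(2, 1)\<close> of the Jacobian matrix is the derivative in \<open>x\<close> of the second component.\<close>

definition Omega0 :: "(real^2) set \<Rightarrow> (vfield \<times> vfield) set" where
  "Omega0 W = {(X, Y). (X, Y) \<in> Omega W \<and> X 0 = 0 \<and> Y 0 = 0 \<and>
     det (jacobian X (at 0)) * det (jacobian Y (at 0)) \<noteq> 0 \<and>
     jacobian X (at 0) $ 2 $ 1 * jacobian Y (at 0) $ 2 $ 1 > 0}"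

definition ell :: "complex \<Rightarrow> complex \<Rightarrow> real" where
  "ell lp lm = (if Im lp * Im lm \<noteq> 0 then Re lp / \<bar>Im lp\<bar> + Re lm / \<bar>Im lm\<bar> else 1)"

definition Omega1 :: "(real^2) set \<Rightarrow> (vfield \<times> vfield) set" where
  "Omega1 W = {(X, Y). (X, Y) \<in> Omega0 W \<and>
     (\<exists>lp1 lp2 lm1 lm2. eigenvalues (jacobian X (at 0)) lp1 lp2 \<and>
        eigenvalues (jacobian Y (at 0)) lm1 lm2 \<and>
        lp1 \<noteq> lp2 \<and> lm1 \<noteq> lm2 \<and> ell lp1 lm1 \<noteq> 0)}"

definition Omega_nn :: "(real^2) set \<Rightarrow> (vfield \<times> vfield) set" where
  "Omega_nn W = {(X, Y). (X, Y) \<in> Omega1 W \<and>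
     (\<exists>lp1 lp2 lm1 lm2. eigenvalues (jacobian X (at 0)) lp1 lp2 \<and>
        eigenvalues (jacobian Y (at 0)) lm1 lm2 \<and>
        lp1 \<in> \<real> \<and> lp2 \<in> \<real> \<and> lm1 \<in> \<real> \<and> lm2 \<in> \<real> \<and>
        Re (lp1 * lp2) > 0 \<and> Re (lm1 * lm2) > 0)}"

definition node_field :: "real \<Rightarrow> vfield" where
  "node_field g p = vector [2 * g * p $ 1 + p $ 2, p $ 1 + 2 * g * p $ 2]"

end

theory Submission
  imports Defs
begin

text \<open>
  Near the origin both fields are replaced by globally Lipschitz ones. A linear change of
  variables that preserves the switching line, followed if necessary by a reversal of time,
  turns the linear part at the origin into a symmetric matrix with diagonal entries \<open>-\<mu>\<close> and
  off-diagonal entries \<open>\<nu>\<close>, where \<open>0 < \<nu> < \<mu>\<close>. Then the norm decreases strictly along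
  orbits, every orbit meets the switching line at most once, and there are orbits that stay
  in the upper half plane forever. So the orbits in the closed upper half plane
  are linearly ordered by their angle: first those through \<open>(x, 0)\<close> with \<open>x > 0\<close>, then a closed
  nondegenerate interval of orbits that avoid the line, then those through \<open>(x, 0)\<close> with \<open>x < 0\<close>.
  Any two such pictures are identified by a homeomorphism of the half plane that preserves
  the norm and this order and fixes the switching line pointwise. Since all freedom on the
  switching line has been used up, the homeomorphisms of the two half planes can be
  glued, whether the nodes attract or repel. If \<open>X\<close> attracts and \<open>Y\<close> repels,
  the half planes have to be interchanged first.
\<close>

section \<open>Flows of globally Lipschitz vector fields\<close>

text \<open>The sign condition at the origin makes every other nearby point of the switching line a
  crossing point. So nothing slides except at the origin, trajectories are unique in both directions
  of time, and each is a restriction of a curve on the whole real line: the rest point, a curve that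
  avoids the line, or a curve with a single crossing. The globally Lipschitz extension is what makes
  these curves live for all times; the homeomorphism is built on the whole plane for the extended
  fields and cut down to neighbourhoods at the end. The obstacle is that the homeomorphisms of the
  two half planes must agree on the line. An equivalence need not respect time, so the norm replaces
  time as the parameter on each orbit: a point is determined by its norm and its orbit, and an orbit
  that meets the line is named by the point where it does so. In the linear model the orbits that
  avoid the line fill the closed sector between the fast and the slow eigendirection. Distinct
  eigenvalues make this sector nondegenerate; two rays strictly inside it survive small
  perturbations and show the same for the nonlinear field.\<close>

lemma antiderivative_UNIV:
  fixes f :: "real \<Rightarrow> 'a::euclidean_space"
  assumes "continuous_on UNIV f"
  shows "\<exists>G. G 0 = 0 \<and> (\<forall>t. (G has_vector_derivative f t) (at t))"
proof -
  have "isCont f x" for x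
    using assms continuous_on_eq_continuous_at open_UNIV by blast
  then obtain G where G: "\<And>x. (G has_vector_derivative f x) (at x)"
    using einterval_antiderivative[of "-\<infinity>" "\<infinity>" f] by auto
  show ?thesis
    by (rule exI[of _ "\<lambda>t. G t - G 0"]) (auto intro!: derivative_eq_intros G)
qed

lemma has_vector_derivative_uminus_arg:
  assumes "(f has_vector_derivative d) (at (- t))"
  shows "((\<lambda>s. f (- s)) has_vector_derivative - d) (at t)"
proof -
  have "(uminus has_vector_derivative (- 1 :: real)) (at t)"
    using has_vector_derivative_minus[OF has_vector_derivative_id[of "at t"]] by simp
  from vector_diff_chain_at[OF this assms] show ?thesis by (simp add: o_def)
qed

text \<open>In the sup norm with weight \<open>exp (- c * \<bar>t\<bar>)\<close>, integration from 0
  gains a factor \<open>1 / c\<close>. This gain turns the Picard operator into a contraction on the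
  whole line.\<close>

lemma exp_growth_antiderivative_bound_pos:
  fixes G :: "real \<Rightarrow> 'a::euclidean_space"
  assumes G0: "G 0 = 0" and G': "\<And>t. (G has_vector_derivative f t) (at t)"
    and c: "c > 0" and bnd: "\<And>t. norm (f t) \<le> B * exp (c * \<bar>t\<bar>)" and t: "t \<ge> 0"
  shows "norm (G t) \<le> B / c * exp (c * \<bar>t\<bar>)"
proof (cases "t = 0")
  case True
  have "0 \<le> B * exp (c * \<bar>0\<bar>)" using bnd[of 0] norm_ge_zero order_trans by blast
  then show ?thesis using G0 c True by simp
next
  case False
  have B: "0 \<le> B" using bnd[of 0] order_trans[OF norm_ge_zero[of "f 0"]] by simp
  have "norm (G t - G 0) \<le> B / c * exp (c * t) - B / c * exp (c * 0)"
  proof (rule differentiable_bound_general[where f' = f and \<phi>' = "\<lambda>s. B * exp (c * s)"])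
    show "0 < t" using False t by simp
    show "continuous_on {0..t} G"
      by (meson G' continuous_at_imp_continuous_on has_vector_derivative_continuous)
    show "continuous_on {0..t} (\<lambda>t. B / c * exp (c * t))"
      by (intro continuous_intros)
    show "(G has_vector_derivative f x) (at x)" for x by (rule G')
    show "((\<lambda>t. B / c * exp (c * t)) has_vector_derivative B * exp (c * x)) (at x)" for x
      unfolding has_real_derivative_iff_has_vector_derivative[symmetric]
      using c by (auto intro!: derivative_eq_intros)
    show "norm (f x) \<le> B * exp (c * x)" if "0 < x" for x
      using bnd[of x] that by simp
  qed
  also have "\<dots> \<le> B / c * exp (c * \<bar>t\<bar>)" using B c t by simp
  finally show ?thesis using G0 by simp
qed

lemma exp_growth_antiderivative_bound:
  fixes G :: "real \<Rightarrow> 'a::euclidean_space"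
  assumes G0: "G 0 = 0" and G': "\<And>t. (G has_vector_derivative f t) (at t)"
    and c: "c > 0" and bnd: "\<And>t. norm (f t) \<le> B * exp (c * \<bar>t\<bar>)"
  shows "norm (G t) \<le> B / c * exp (c * \<bar>t\<bar>)"
proof (cases "t \<ge> 0")
  case True
  then show ?thesis using exp_growth_antiderivative_bound_pos assms by blast
next
  case False
  have "((\<lambda>s. G (- s)) has_vector_derivative - f (- s)) (at s)" for s
    by (rule has_vector_derivative_uminus_arg) (rule G')
  from exp_growth_antiderivative_bound_pos[of "\<lambda>s. G (- s)", OF _ this c, of B "-t"]
  show ?thesis using False G0 bnd[of "- _"] by simp
qed

lemma lipschitz_ode_exists:
  fixes F :: "'a::euclidean_space \<Rightarrow> 'a"
  assumes lip: "K-lipschitz_on UNIV F" and F0: "F 0 = 0"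
  shows "\<exists>\<phi>. \<phi> 0 = p \<and> (\<forall>t. (\<phi> has_vector_derivative F (\<phi> t)) (at t))"
proof -
  \<comment> \<open>Banach's fixed point theorem for \<open>u t = exp (- c \<bar>t\<bar>) \<phi> t\<close> yields the solution on the whole
    real line at once.\<close>
  have K: "K \<ge> 0" using lip by (rule lipschitz_on_nonneg)
  \<comment> \<open>Any \<open>c > K\<close> would do: the contraction constant is going to be
    \<open>K / c\<close>.\<close>
  define c where "c = K + 1"
  have c: "c > 0" using K by (simp add: c_def)
  have Fd: "norm (F x - F y) \<le> K * norm (x - y)" for x y
    using lipschitz_onD[OF lip, of x y] by (simp add: dist_norm)
  have Fn: "norm (F x) \<le> K * norm x" for x using Fd[of x 0] F0 by simp
  have Fc: "continuous_on UNIV F" using lip by (rule lipschitz_on_continuous_on)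
  define w where "w = (\<lambda>t::real. exp (c * \<bar>t\<bar>))"
  have wpos: "w t > 0" for t by (simp add: w_def)
  have wcont: "continuous_on UNIV w" unfolding w_def by (intro continuous_intros)
  have w1: "w t \<ge> 1" for t using c by (simp add: w_def)
  define f where "f = (\<lambda>v::real \<Rightarrow>\<^sub>C 'a. \<lambda>s. F (w s *\<^sub>R v s))"
  have fcont: "continuous_on UNIV (f v)" for v
    unfolding f_def
    by (intro continuous_on_compose2[OF Fc] continuous_intros wcont) auto
  define I where "I = (\<lambda>v. SOME G. G 0 = 0 \<and> (\<forall>t. (G has_vector_derivative f v t) (at t)))"
  have "I v 0 = 0 \<and> (\<forall>t. (I v has_vector_derivative f v t) (at t))" for v
    unfolding I_def using someI_ex[OF antiderivative_UNIV[OF fcont[of v]]] .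
  then have I0: "I v 0 = 0" and I': "(I v has_vector_derivative f v t) (at t)" for v t by auto
  have Icont: "continuous_on UNIV (I v)" for v
    by (meson I' continuous_at_imp_continuous_on has_vector_derivative_continuous)
  define T where "T = (\<lambda>v t. (1 / w t) *\<^sub>R (p + I v t))"
  have Tb: "T v \<in> bcontfun" for v
  proof -
    obtain M where M: "\<And>t. norm (apply_bcontfun v t) \<le> M"
      using bounded_apply_bcontfun[of v] by (auto simp: bounded_iff)
    have M0: "M \<ge> 0" using M[of 0] norm_ge_zero order_trans by blast
    have "norm (f v t) \<le> (K * M) * exp (c * \<bar>t\<bar>)" for t
    proof -
      have "norm (f v t) \<le> K * (w t * norm (v t))"
        using Fn[of "w t *\<^sub>R v t"] wpos[of t] by (simp add: f_def)
      also have "\<dots> \<le> K * (w t * M)"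
        using M[of t] K wpos[of t] by (intro mult_left_mono) auto
      finally show ?thesis by (simp add: w_def mult_ac)
    qed
    then have Ib: "norm (I v t) \<le> K * M / c * w t" for t
      unfolding w_def using exp_growth_antiderivative_bound[OF I0 I' c] by blast
    have "norm (T v t) \<le> norm p + K * M / c" for t
    proof -
      have "norm (T v t) = norm (p + I v t) / w t" using wpos[of t] by (simp add: T_def)
      also have "\<dots> \<le> (norm p + K * M / c * w t) / w t"
        using Ib[of t] norm_triangle_ineq[of p "I v t"] wpos[of t]
        by (intro divide_right_mono) auto
      also have "\<dots> = norm p / w t + K * M / c" using wpos[of t] by (simp add: add_divide_distrib)
      also have "norm p / w t \<le> norm p / 1" using w1[of t] by (intro divide_left_mono) auto
      finally show ?thesis by simp
    qed
    moreover have "continuous_on UNIV (T v)"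
      unfolding T_def using wpos by (intro continuous_intros wcont Icont) (metis less_irrefl)
    ultimately show ?thesis by (intro bcontfun_normI)
  qed
  have app: "apply_bcontfun (Bcontfun (T v)) = T v" for v
    using Tb by (rule Bcontfun_inverse)
  have contr: "dist (Bcontfun (T u)) (Bcontfun (T v)) \<le> K / c * dist u v" for u v
  proof (rule dist_bound)
    fix t
    have "norm (f u s - f v s) \<le> (K * dist u v) * exp (c * \<bar>s\<bar>)" for s
    proof -
      have "norm (f u s - f v s) \<le> K * norm (w s *\<^sub>R u s - w s *\<^sub>R v s)"
        unfolding f_def by (rule Fd)
      also have "\<dots> = K * (w s * dist (u s) (v s))"
        using wpos[of s] by (simp add: dist_norm flip: scaleR_diff_right)
      also have "\<dots> \<le> K * (w s * dist u v)"
        using dist_bounded[of u s v] K wpos[of s] by (intro mult_left_mono) auto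
      finally show ?thesis by (simp add: w_def mult_ac)
    qed
    then have "norm (I u t - I v t) \<le> K * dist u v / c * w t"
      unfolding w_def
      by (intro exp_growth_antiderivative_bound[where G = "\<lambda>t. I u t - I v t" and f = "\<lambda>t. f u t - f v t"] c)
        (auto simp: I0 intro!: derivative_eq_intros I')
    moreover have "dist (T u t) (T v t) = norm (I u t - I v t) / w t"
      using wpos[of t] by (simp add: T_def dist_norm flip: scaleR_diff_right)
    ultimately show "dist (apply_bcontfun (Bcontfun (T u)) t) (apply_bcontfun (Bcontfun (T v)) t) \<le> K / c * dist u v"
      unfolding app using wpos[of t] by (simp add: divide_le_eq mult_ac)
  qed
  have "\<exists>!u. Bcontfun (T u) = u"
    using banach_fix_type[of "K / c" "\<lambda>u. Bcontfun (T u)"] contr K c by (auto simp: c_def)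
  then obtain u where u: "T u = apply_bcontfun u" using app by metis
  have wu: "w t *\<^sub>R u t = p + I u t" for t
  proof -
    have "w t *\<^sub>R T u t = p + I u t" using wpos[of t] by (simp add: T_def)
    then show ?thesis by (simp add: u)
  qed
  show ?thesis
  proof (intro exI[of _ "\<lambda>t. p + I u t"] conjI allI)
    show "p + I u 0 = p" by (simp add: I0)
    show "((\<lambda>t. p + I u t) has_vector_derivative F (p + I u t)) (at t)" for t
      using I'[of u t] unfolding f_def wu by (auto intro!: derivative_eq_intros)
  qed
qed

text \<open>The function \<open>norm (\<delta> t) ^ 2 * exp (- 2 * k * t)\<close> has nonpositive
  derivative. Only the inner product with the derivative is bounded, from above, so that
  \<open>k\<close> may be negative: the lemma serves uniqueness with \<open>k = K\<close> and the
  decay of the norm with \<open>k = - m\<close>.\<close>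

lemma gronwall_nonincreasing:
  fixes \<delta> :: "real \<Rightarrow> 'a::real_inner"
  assumes "a \<le> b" and cont: "continuous_on {a..b} \<delta>"
    and der: "\<And>t. a < t \<Longrightarrow> t < b \<Longrightarrow> \<exists>d. (\<delta> has_vector_derivative d) (at t) \<and> \<delta> t \<bullet> d \<le> k * norm (\<delta> t) ^ 2"
  shows "norm (\<delta> b) \<le> exp (k * (b - a)) * norm (\<delta> a)"
proof -
  define f where "f = (\<lambda>t. (\<delta> t \<bullet> \<delta> t) * exp (- 2 * k * t))"
  have "f b \<le> f a"
  proof (rule DERIV_nonpos_imp_decreasing_open[OF \<open>a \<le> b\<close>])
    fix t assume t: "a < t" "t < b"
    then obtain d where d: "(\<delta> has_vector_derivative d) (at t)" and le: "\<delta> t \<bullet> d \<le> k * norm (\<delta> t) ^ 2"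
      using der by blast
    have "((\<lambda>t. \<delta> t \<bullet> \<delta> t) has_derivative (\<lambda>h. h * (2 * (\<delta> t \<bullet> d)))) (at t)"
      using d unfolding has_vector_derivative_def
      by (auto intro!: derivative_eq_intros simp: inner_commute algebra_simps)
    then have "((\<lambda>t. \<delta> t \<bullet> \<delta> t) has_real_derivative (2 * (\<delta> t \<bullet> d))) (at t)"
      by (simp add: has_field_derivative_def mult.commute[of _ "2 * _"])
    then have "(f has_real_derivative (2 * (\<delta> t \<bullet> d) - 2 * k * (\<delta> t \<bullet> \<delta> t)) * exp (- 2 * k * t)) (at t)"
      unfolding f_def by (auto intro!: derivative_eq_intros simp: algebra_simps)
    moreover have "(2 * (\<delta> t \<bullet> d) - 2 * k * (\<delta> t \<bullet> \<delta> t)) * exp (- 2 * k * t) \<le> 0"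
      using le by (intro mult_nonpos_nonneg) (auto simp: dot_square_norm)
    ultimately show "\<exists>y. (f has_real_derivative y) (at t) \<and> y \<le> 0" by blast
  qed (auto simp: f_def intro!: continuous_intros cont)
  then have "norm (\<delta> b) ^ 2 * exp (- 2 * k * b) \<le> norm (\<delta> a) ^ 2 * exp (- 2 * k * a)"
    by (simp add: f_def dot_square_norm)
  then have "norm (\<delta> b) ^ 2 * exp (- 2 * k * b) * exp (2 * k * b) \<le> norm (\<delta> a) ^ 2 * exp (- 2 * k * a) * exp (2 * k * b)"
    by (intro mult_right_mono) auto
  also have "norm (\<delta> b) ^ 2 * exp (- 2 * k * b) * exp (2 * k * b) = norm (\<delta> b) ^ 2"
    by (simp add: mult.assoc flip: exp_add)
  also have "norm (\<delta> a) ^ 2 * exp (- 2 * k * a) * exp (2 * k * b) = (exp (k * (b - a)) * norm (\<delta> a)) ^ 2"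
    by (simp add: power_mult_distrib mult.assoc power2_eq_square[of "exp _"] flip: exp_add) (simp add: algebra_simps)
  finally show ?thesis by (rule power2_le_imp_le) auto
qed

lemma gronwall:
  fixes \<delta> :: "real \<Rightarrow> 'a::real_inner"
  assumes "a \<le> b" and cont: "continuous_on {a..b} \<delta>"
    and der: "\<And>t. a < t \<Longrightarrow> t < b \<Longrightarrow> \<exists>d. (\<delta> has_vector_derivative d) (at t) \<and> norm d \<le> k * norm (\<delta> t)"
  shows "norm (\<delta> b) \<le> exp (k * (b - a)) * norm (\<delta> a)"
    and "norm (\<delta> a) \<le> exp (k * (b - a)) * norm (\<delta> b)"
proof -
  have *: "x \<bullet> d \<le> k * norm x ^ 2" if "norm d \<le> k * norm x" for x d :: 'a
  proof -
    have "x \<bullet> d \<le> norm x * norm d" by (rule norm_cauchy_schwarz)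
    also have "\<dots> \<le> norm x * (k * norm x)" using that by (intro mult_left_mono) auto
    finally show ?thesis by (simp add: power2_eq_square mult_ac)
  qed
  show "norm (\<delta> b) \<le> exp (k * (b - a)) * norm (\<delta> a)"
    using der * by (intro gronwall_nonincreasing[OF \<open>a \<le> b\<close> cont]) blast
  have "norm (\<delta> (- (- a))) \<le> exp (k * (- a - (- b))) * norm (\<delta> (- (- b)))"
  proof (rule gronwall_nonincreasing[where \<delta> = "\<lambda>t. \<delta> (- t)"])
    show "continuous_on {- b..- a} (\<lambda>t. \<delta> (- t))"
      by (rule continuous_on_compose2[OF cont]) (auto intro!: continuous_intros)
    fix t assume "- b < t" "t < - a"
    then obtain d where "(\<delta> has_vector_derivative d) (at (- t))" "norm d \<le> k * norm (\<delta> (- t))"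
      using der[of "- t"] by auto
    then show "\<exists>d. ((\<lambda>t. \<delta> (- t)) has_vector_derivative d) (at t) \<and> \<delta> (- t) \<bullet> d \<le> k * norm (\<delta> (- t)) ^ 2"
      using * by (intro exI[of _ "- d"] conjI has_vector_derivative_uminus_arg *) auto
  qed (use \<open>a \<le> b\<close> in auto)
  then show "norm (\<delta> a) \<le> exp (k * (b - a)) * norm (\<delta> b)" by simp
qed

definition flow :: "('a::euclidean_space \<Rightarrow> 'a) \<Rightarrow> real \<Rightarrow> 'a \<Rightarrow> 'a" where
  "flow F t p = (SOME \<phi>. \<phi> 0 = p \<and> (\<forall>t. (\<phi> has_vector_derivative F (\<phi> t)) (at t))) t"

locale lipschitz_field =
  fixes F :: "'a::euclidean_space \<Rightarrow> 'a"
  assumes lipschitz: "\<exists>K. K-lipschitz_on UNIV F" and F_0 [simp]: "F 0 = 0"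
begin

lemma flow_0 [simp]: "flow F 0 p = p"
  and flow_deriv: "((\<lambda>t. flow F t p) has_vector_derivative F (flow F t p)) (at t)"
proof -
  obtain K where "K-lipschitz_on UNIV F" using lipschitz by blast
  from lipschitz_ode_exists[OF this F_0, of p, THEN someI_ex]
  show "flow F 0 p = p" "((\<lambda>t. flow F t p) has_vector_derivative F (flow F t p)) (at t)"
    unfolding flow_def by auto
qed

lemma field_continuous: "continuous_on S F"
  using lipschitz lipschitz_on_continuous_on continuous_on_subset by blast

lemma flow_continuous_time: "continuous_on S (\<lambda>t. flow F t p)"
  using continuous_at_imp_continuous_on has_vector_derivative_continuous[OF flow_deriv] by blast

lemma solutions_gronwall:
  assumes K: "K-lipschitz_on UNIV F" and "a \<le> b"
    and "continuous_on {a..b} \<phi>" "continuous_on {a..b} \<psi>"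
    and "\<And>t. a < t \<Longrightarrow> t < b \<Longrightarrow> (\<phi> has_vector_derivative F (\<phi> t)) (at t)"
    and "\<And>t. a < t \<Longrightarrow> t < b \<Longrightarrow> (\<psi> has_vector_derivative F (\<psi> t)) (at t)"
  shows "norm (\<phi> b - \<psi> b) \<le> exp (K * (b - a)) * norm (\<phi> a - \<psi> a)"
    and "norm (\<phi> a - \<psi> a) \<le> exp (K * (b - a)) * norm (\<phi> b - \<psi> b)"
proof -
  have "\<exists>d. ((\<lambda>t. \<phi> t - \<psi> t) has_vector_derivative d) (at t) \<and> norm d \<le> K * norm (\<phi> t - \<psi> t)"
    if "a < t" "t < b" for t
    using assms(5,6)[OF that] lipschitz_onD[OF K, of "\<phi> t" "\<psi> t"]
    by (intro exI[of _ "F (\<phi> t) - F (\<psi> t)"] conjI has_vector_derivative_diff) (auto simp: dist_norm)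
  from gronwall[OF \<open>a \<le> b\<close> _ this] assms(3,4)
  show "norm (\<phi> b - \<psi> b) \<le> exp (K * (b - a)) * norm (\<phi> a - \<psi> a)"
    "norm (\<phi> a - \<psi> a) \<le> exp (K * (b - a)) * norm (\<phi> b - \<psi> b)"
    by (auto intro: continuous_intros)
qed

text \<open>Differentiability is asked for in the open interval only, because a trajectory joined
  from several arcs need not be differentiable where one of them begins or ends.\<close>

lemma flow_unique:
  assumes cont: "continuous_on {a..b} \<psi>"
    and der: "\<And>t. a < t \<Longrightarrow> t < b \<Longrightarrow> (\<psi> has_vector_derivative F (\<psi> t)) (at t)"
    and st: "s \<in> {a..b}" "t \<in> {a..b}"
  shows "\<psi> t = flow F (t - s) (\<psi> s)"
proof -
  obtain K where K: "K-lipschitz_on UNIV F" using lipschitz by blast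
  define \<phi> where "\<phi> = (\<lambda>r. flow F (r - s) (\<psi> s))"
  have \<phi>': "(\<phi> has_vector_derivative F (\<phi> r)) (at r)" for r
  proof -
    have "((\<lambda>r. r - s) has_vector_derivative 1) (at r)" by (auto intro!: derivative_eq_intros)
    from vector_diff_chain_at[OF this flow_deriv[of "\<psi> s" "r - s"]]
    show ?thesis by (simp add: o_def \<phi>_def)
  qed
  have \<phi>c: "continuous_on S \<phi>" for S
    by (meson \<phi>' continuous_at_imp_continuous_on has_vector_derivative_continuous)
  have s: "\<phi> s = \<psi> s" by (simp add: \<phi>_def)
  have "\<psi> t = \<phi> t"
  proof (cases "s \<le> t")
    case True
    have "norm (\<psi> t - \<phi> t) \<le> exp (K * (t - s)) * norm (\<psi> s - \<phi> s)"
      by (rule solutions_gronwall[OF K True])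
        (use st in \<open>auto intro: \<phi>' \<phi>c der continuous_on_subset[OF cont]\<close>)
    then show ?thesis by (simp add: s)
  next
    case False
    have "norm (\<psi> t - \<phi> t) \<le> exp (K * (s - t)) * norm (\<psi> s - \<phi> s)"
      by (rule solutions_gronwall[OF K])
        (use st False in \<open>auto intro: \<phi>' \<phi>c der continuous_on_subset[OF cont]\<close>)
    then show ?thesis by (simp add: s)
  qed
  then show ?thesis by (simp add: \<phi>_def)
qed

lemma flow_unique_UNIV:
  assumes "\<And>t. (\<psi> has_vector_derivative F (\<psi> t)) (at t)"
  shows "\<psi> t = flow F (t - s) (\<psi> s)"
proof (rule flow_unique[of "min s t" "max s t"])
  show "continuous_on {min s t..max s t} \<psi>"
    by (meson assms continuous_at_imp_continuous_on has_vector_derivative_continuous)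
qed (use assms in auto)

lemma flow_flow: "flow F s (flow F t p) = flow F (s + t) p"
  using flow_unique_UNIV[of "\<lambda>t. flow F t p" "s + t" t] by (simp add: flow_deriv)

lemma flow_zero [simp]: "flow F t 0 = 0"
  using flow_unique_UNIV[of "\<lambda>t. 0" t 0] by (auto intro!: derivative_eq_intros)

lemma flow_inverse: "flow F (- t) (flow F t p) = p"
  by (simp add: flow_flow)

lemma flow_eq_0_iff [simp]: "flow F t p = 0 \<longleftrightarrow> p = 0"
  by (metis flow_inverse flow_zero)

lemma flow_lipschitz:
  assumes K: "K-lipschitz_on UNIV F"
  shows "norm (flow F t p - flow F t q) \<le> exp (K * \<bar>t\<bar>) * norm (p - q)"
proof (cases "t \<ge> 0")
  case True
  then show ?thesis
    using solutions_gronwall(1)[OF K True, of "\<lambda>t. flow F t p" "\<lambda>t. flow F t q"]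
    by (simp add: flow_deriv flow_continuous_time)
next
  case False
  then show ?thesis
    using solutions_gronwall(2)[OF K, of t 0 "\<lambda>t. flow F t p" "\<lambda>t. flow F t q"]
    by (simp add: flow_deriv flow_continuous_time)
qed

text \<open>Joint continuity splits into continuity in time at the fixed point \<open>p\<close> and
  the Lipschitz bound in the point, whose constant \<open>exp (K * \<bar>f x\<bar>)\<close> stays
  bounded along the filter.\<close>

lemma flow_tendsto:
  assumes f: "(f \<longlongrightarrow> s) A" and g: "(g \<longlongrightarrow> p) A"
  shows "((\<lambda>x. flow F (f x) (g x)) \<longlongrightarrow> flow F s p) A"
proof -
  obtain K where K: "K-lipschitz_on UNIV F" using lipschitz by blast
  have cont: "isCont (\<lambda>t. flow F t p) s"
    by (rule has_vector_derivative_continuous[OF flow_deriv])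
  have 1: "((\<lambda>x. flow F (f x) p) \<longlongrightarrow> flow F s p) A"
    using isCont_tendsto_compose[OF cont f] .
  have 2: "((\<lambda>x. flow F (f x) (g x) - flow F (f x) p) \<longlongrightarrow> 0) A"
  proof (rule Lim_null_comparison)
    show "\<forall>\<^sub>F x in A. norm (flow F (f x) (g x) - flow F (f x) p) \<le> exp (K * \<bar>f x\<bar>) * norm (g x - p)"
      using flow_lipschitz[OF K] by simp
    have "((\<lambda>x. exp (K * \<bar>f x\<bar>) * norm (g x - p)) \<longlongrightarrow> exp (K * \<bar>s\<bar>) * norm (p - p)) A"
      by (intro tendsto_intros f g)
    then show "((\<lambda>x. exp (K * \<bar>f x\<bar>) * norm (g x - p)) \<longlongrightarrow> 0) A" by simp
  qed
  from tendsto_add[OF 2 1] show ?thesis by simp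
qed

lemma flow_continuous_on [continuous_intros]:
  assumes "continuous_on S f" "continuous_on S g"
  shows "continuous_on S (\<lambda>x. flow F (f x) (g x))"
  using assms flow_tendsto unfolding continuous_on_def by blast

end

section \<open>Nodes in normal form\<close>

abbreviation pt :: "real \<Rightarrow> real \<Rightarrow> real^2" where
  "pt x y \<equiv> vector [x, y]"

lemma pt_eq_iff: "p = pt x y \<longleftrightarrow> p $ 1 = x \<and> p $ 2 = y" for p :: "real^2"
  by (auto simp: vec_eq_iff forall_2)

lemma pt_0 [simp]: "pt 0 0 = 0"
  by (auto simp: vec_eq_iff forall_2)

lemma pt_eq_0_iff [simp]: "pt x y = 0 \<longleftrightarrow> x = 0 \<and> y = 0"
  by (auto simp: vec_eq_iff forall_2)

lemma vec2_eq_0_iff: "p = 0 \<longleftrightarrow> p $ 1 = 0 \<and> p $ 2 = 0" for p :: "real^2"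
  by (auto simp: vec_eq_iff forall_2)

lemma norm_vec2: "norm p = sqrt ((p $ 1)\<^sup>2 + (p $ 2)\<^sup>2)" for p :: "real^2"
  by (simp add: norm_vec_def L2_set_def sum_2)

lemma norm_pt_axis [simp]: "norm (pt x 0) = \<bar>x\<bar>"
  by (simp add: norm_vec2)

lemma continuous_on_pt [continuous_intros]:
  assumes "continuous_on S f" "continuous_on S g"
  shows "continuous_on S (\<lambda>x. pt (f x) (g x))"
proof -
  have "continuous_on S (\<lambda>x. if i = 1 then f x else g x)" for i :: 2
    using assms by (cases "i = 1") auto
  note c = continuous_on_vec_lambda[OF this]
  have "(\<lambda>x. pt (f x) (g x)) = (\<lambda>x. \<chi> i. if i = 1 then f x else g x)"
    by (auto simp: vec_eq_iff forall_2)
  with c show ?thesis by (simp only:)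
qed

text \<open>At a first time when \<open>f\<close> or \<open>g\<close> vanishes the other one is
  still nonnegative, so the vanishing one has positive derivative. It would then have been negative
  just before, against the choice of that time. In the applications \<open>f\<close> and
  \<open>g\<close> are linear functions that cut out a sector.\<close>

lemma barrier:
  fixes f g :: "real \<Rightarrow> real"
  assumes f': "\<And>t. (f has_real_derivative f' t) (at t)" and g': "\<And>t. (g has_real_derivative g' t) (at t)"
    and init: "f 0 = 0" "g 0 > 0"
    and ef: "\<And>t. f t = 0 \<Longrightarrow> g t \<ge> 0 \<Longrightarrow> f' t > 0"
    and eg: "\<And>t. g t = 0 \<Longrightarrow> f t \<ge> 0 \<Longrightarrow> g' t > 0"
    and t: "t > 0"
  shows "f t > 0 \<and> g t > 0"
proof (rule ccontr)
  assume neg: "\<not> ?thesis"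
  have fc: "continuous_on S f" and gc: "continuous_on S g" for S
    using f' g' DERIV_isCont by (blast intro: continuous_at_imp_continuous_on)+
  obtain d1 where d1: "d1 > 0" "\<And>h. 0 < h \<Longrightarrow> h < d1 \<Longrightarrow> f h > 0"
    using DERIV_pos_inc_right[OF f'[of 0] ef[of 0]] init by auto
  have "eventually (\<lambda>h. g h > 0) (at 0)"
    using init(2) DERIV_isCont[OF g'[of 0]] unfolding isCont_def by (rule order_tendstoD[rotated])
  then obtain d2 where d2: "d2 > 0" "\<And>h. h \<noteq> 0 \<Longrightarrow> \<bar>h\<bar> < d2 \<Longrightarrow> g h > 0"
    unfolding eventually_at by (auto simp: dist_real_def)
  \<comment> \<open>The search for a first bad time starts at \<open>e\<close>, because time 0 is
    itself bad in the sense that \<open>f 0 \<le> 0\<close>.\<close>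
  define e where "e = min d1 d2 / 2"
  have e: "e > 0" "e < d1" "e < d2" using d1 d2 by (auto simp: e_def)
  define B where "B = {e..t} \<inter> ({s. f s \<le> 0} \<union> {s. g s \<le> 0})"
  have "compact B"
    unfolding B_def
    by (intro compact_Int_closed compact_Icc closed_Un closed_Collect_le fc gc continuous_on_const)
  moreover have "t \<in> B"
    using neg t d1(2)[of t] d2(2)[of t] e unfolding B_def by force
  ultimately obtain s where s: "s \<in> B" "\<And>r. r \<in> B \<Longrightarrow> s \<le> r"
    using compact_attains_inf[of B] by blast
  have s0: "s > 0" "s \<le> t" using s(1) e by (auto simp: B_def)
  have before: "f r > 0 \<and> g r > 0" if "0 < r" "r < s" for r
    using s(2)[of r] that s0 d1(2)[of r] d2(2)[of r] e by (force simp: B_def)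
  have lim: "h s \<ge> 0" if "continuous_on UNIV h" "\<And>r. 0 < r \<Longrightarrow> r < s \<Longrightarrow> h r > 0" for h :: "real \<Rightarrow> real"
  proof (rule tendsto_lowerbound)
    show "(h \<longlongrightarrow> h s) (at_left s)"
      using that(1) by (auto simp: continuous_on_def intro: tendsto_within_subset)
    show "\<forall>\<^sub>F r in at_left s. 0 \<le> h r"
      using eventually_at_left[of 0 s] s0 that(2) less_imp_le by blast
  qed simp
  have nonneg: "f s \<ge> 0" "g s \<ge> 0" using lim[OF fc] lim[OF gc] before by blast+
  have no_zero: "\<not> (\<exists>d. (h has_real_derivative d) (at s) \<and> d > 0)"
    if "h s = 0" "\<And>r. 0 < r \<Longrightarrow> r < s \<Longrightarrow> h r > 0" for h :: "real \<Rightarrow> real"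
  proof
    assume "\<exists>d. (h has_real_derivative d) (at s) \<and> d > 0"
    then obtain d where d: "(h has_real_derivative d) (at s)" "d > 0" by blast
    then obtain \<epsilon> where \<epsilon>: "\<epsilon> > 0" "\<And>k. k > 0 \<Longrightarrow> k < \<epsilon> \<Longrightarrow> h (s - k) < h s"
      using DERIV_pos_inc_left by blast
    define k where "k = min \<epsilon> s / 2"
    have "k > 0" "k < \<epsilon>" "k < s" using \<epsilon> s0 by (auto simp: k_def)
    then show False using \<epsilon>(2)[of k] that(1) that(2)[of "s - k"] by auto
  qed
  have "f s = 0 \<or> g s = 0" using nonneg s(1) by (auto simp: B_def)
  then show False
    using no_zero[of f] no_zero[of g] before f' g' ef[of s] eg[of s] nonneg by blast
qed

text \<open>
  The assumption \<open>ray\<close> says that the flow crosses the lines through \<open>(0, 1)\<close> and \<open>(1/2, 1)\<close>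
  clockwise. One such line separates the orbits through the positive from those through the
  negative half axis; the second one makes the set of orbits between them nondegenerate.
\<close>

locale node_normal = lipschitz_field F for F :: "real^2 \<Rightarrow> real^2" +
  fixes m :: real
  assumes m_pos: "m > 0"
    and radial: "p \<bullet> F p \<le> - m * norm p ^ 2"
    and axis: "x \<noteq> 0 \<Longrightarrow> x * F (pt x 0) $ 2 > 0"
    and ray: "s \<in> {0, 1/2} \<Longrightarrow> y \<noteq> 0 \<Longrightarrow> y * (F (pt (s * y) y) $ 1 - s * F (pt (s * y) y) $ 2) > 0"
begin

text \<open>With \<open>d = sgn t\<close> the forward and the backward orbit are both run through in
  increasing \<tau>, so that \<open>barrier\<close> covers them at once.\<close>

lemma flow_component_deriv:
  "((\<lambda>\<tau>. flow F (d * \<tau>) p $ i) has_real_derivative d * F (flow F (d * \<tau>) p) $ i) (at \<tau>)"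
proof -
  have "((\<lambda>\<tau>. d * \<tau>) has_vector_derivative d) (at \<tau>)"
    by (auto intro!: derivative_eq_intros)
  from vector_diff_chain_at[OF this flow_deriv[of p "d * \<tau>"]]
  have "((\<lambda>\<tau>. flow F (d * \<tau>) p) has_vector_derivative d *\<^sub>R F (flow F (d * \<tau>) p)) (at \<tau>)"
    by (simp add: o_def)
  from bounded_linear.has_vector_derivative[OF bounded_linear_vec_nth this, of i]
  show ?thesis by (simp add: has_real_derivative_iff_has_vector_derivative)
qed

text \<open>For \<open>x > 0\<close> the orbit enters the first quadrant, which \<open>axis\<close>
  and \<open>ray\<close> with \<open>s = 0\<close> make forward invariant; backward in time it is
  trapped in the fourth quadrant in the same way. For \<open>x < 0\<close> all signs change. Hence
  an orbit meets the axis at most once.\<close>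

lemma flow_axis_sign:
  assumes x: "x \<noteq> 0" and t: "t \<noteq> 0"
  shows "x * t * flow F t (pt x 0) $ 2 > 0"
proof -
  let ?q = "\<lambda>\<tau>. flow F (sgn t * \<tau>) (pt x 0)"
  have nz: "?q \<tau> \<noteq> 0" for \<tau> using x by simp
  have st: "sgn t * sgn t = 1" and sx: "sgn x * sgn x = 1" using x t by (auto simp: sgn_if)
  have "sgn x * sgn t * ?q \<bar>t\<bar> $ 2 > 0 \<and> sgn x * ?q \<bar>t\<bar> $ 1 > 0"
  proof (rule barrier[where f = "\<lambda>\<tau>. sgn x * sgn t * ?q \<tau> $ 2" and g = "\<lambda>\<tau>. sgn x * ?q \<tau> $ 1"
        and f' = "\<lambda>\<tau>. sgn x * sgn t * (sgn t * F (?q \<tau>) $ 2)" and g' = "\<lambda>\<tau>. sgn x * (sgn t * F (?q \<tau>) $ 1)"])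
    fix \<tau>
    show "((\<lambda>\<tau>. sgn x * sgn t * ?q \<tau> $ 2) has_real_derivative sgn x * sgn t * (sgn t * F (?q \<tau>) $ 2)) (at \<tau>)"
      "((\<lambda>\<tau>. sgn x * ?q \<tau> $ 1) has_real_derivative sgn x * (sgn t * F (?q \<tau>) $ 1)) (at \<tau>)"
      by (intro DERIV_cmult flow_component_deriv)+
    {
      assume "sgn x * sgn t * ?q \<tau> $ 2 = 0" and g: "sgn x * ?q \<tau> $ 1 \<ge> 0"
      then obtain z where q: "?q \<tau> = pt z 0" using x t by (auto simp: pt_eq_iff sgn_if split: if_splits)
      then have z: "z \<noteq> 0" using nz[of \<tau>] by auto
      from g have g: "sgn x * z \<ge> 0" unfolding q by simp
      have "sgn x * F (pt z 0) $ 2 > 0"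
        using axis[OF z] g x z by (auto simp: sgn_if zero_less_mult_iff split: if_splits)
      then show "sgn x * sgn t * (sgn t * F (?q \<tau>) $ 2) > 0"
        unfolding q using t by (auto simp: sgn_if split: if_splits)
    }
    {
      assume "sgn x * ?q \<tau> $ 1 = 0" and g: "sgn x * sgn t * ?q \<tau> $ 2 \<ge> 0"
      then obtain z where q: "?q \<tau> = pt 0 z" using x t by (auto simp: pt_eq_iff sgn_if split: if_splits)
      then have z: "z \<noteq> 0" using nz[of \<tau>] by auto
      from g have g: "sgn x * sgn t * z \<ge> 0" unfolding q by simp
      show "sgn x * (sgn t * F (?q \<tau>) $ 1) > 0"
        unfolding q using ray[of 0 z] z g x t
        by (auto simp: sgn_if zero_less_mult_iff mult_less_0_iff split: if_splits)
    }
  qed (use x t in \<open>auto simp: sgn_if\<close>)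
  moreover have "sgn t * \<bar>t\<bar> = t" by (simp add: sgn_mult_abs)
  ultimately show ?thesis
    using x t by (auto simp: sgn_if zero_less_mult_iff mult_less_0_iff split: if_splits)
qed

text \<open>Since the ray is crossed clockwise, the forward orbit stays in the sector between the
  ray and the positive half axis and the backward orbit in the one between the ray and the negative
  half axis.\<close>

lemma flow_ray_upper:
  assumes s: "s \<in> {0, 1/2}" and r: "r > 0"
  shows "flow F t (pt (s * r) r) $ 2 > 0"
proof (cases "t = 0")
  case True
  then show ?thesis using r by simp
next
  case t: False
  let ?q = "\<lambda>\<tau>. flow F (sgn t * \<tau>) (pt (s * r) r)"
  have nz: "?q \<tau> \<noteq> 0" for \<tau> using r by simp
  have "sgn t * (?q \<bar>t\<bar> $ 1 - s * ?q \<bar>t\<bar> $ 2) > 0 \<and> ?q \<bar>t\<bar> $ 2 > 0"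
  proof (rule barrier[where f = "\<lambda>\<tau>. sgn t * (?q \<tau> $ 1 - s * ?q \<tau> $ 2)" and g = "\<lambda>\<tau>. ?q \<tau> $ 2"
        and f' = "\<lambda>\<tau>. sgn t * (sgn t * F (?q \<tau>) $ 1 - s * (sgn t * F (?q \<tau>) $ 2))" and g' = "\<lambda>\<tau>. sgn t * F (?q \<tau>) $ 2"])
    fix \<tau>
    show "((\<lambda>\<tau>. sgn t * (?q \<tau> $ 1 - s * ?q \<tau> $ 2)) has_real_derivative
        sgn t * (sgn t * F (?q \<tau>) $ 1 - s * (sgn t * F (?q \<tau>) $ 2))) (at \<tau>)"
      "((\<lambda>\<tau>. ?q \<tau> $ 2) has_real_derivative sgn t * F (?q \<tau>) $ 2) (at \<tau>)"
      by (intro DERIV_cmult DERIV_diff flow_component_deriv)+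
    {
      assume "sgn t * (?q \<tau> $ 1 - s * ?q \<tau> $ 2) = 0" and g: "?q \<tau> $ 2 \<ge> 0"
      then obtain z where q: "?q \<tau> = pt (s * z) z" using t by (auto simp: pt_eq_iff sgn_if split: if_splits)
      then have z: "z \<noteq> 0" using nz[of \<tau>] by auto
      from g have g: "z \<ge> 0" unfolding q by simp
      have "F (pt (s * z) z) $ 1 - s * F (pt (s * z) z) $ 2 > 0"
        using ray[OF s z] g z by (simp add: zero_less_mult_iff)
      then show "sgn t * (sgn t * F (?q \<tau>) $ 1 - s * (sgn t * F (?q \<tau>) $ 2)) > 0"
        unfolding q using t by (auto simp: sgn_if split: if_splits)
    }
    {
      assume "?q \<tau> $ 2 = 0" and g: "sgn t * (?q \<tau> $ 1 - s * ?q \<tau> $ 2) \<ge> 0"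
      then obtain z where q: "?q \<tau> = pt z 0" by (auto simp: pt_eq_iff)
      then have z: "z \<noteq> 0" using nz[of \<tau>] by auto
      from g have g: "sgn t * z \<ge> 0" unfolding q by simp
      show "sgn t * F (?q \<tau>) $ 2 > 0"
        unfolding q using axis[OF z] g t z
        by (auto simp: sgn_if zero_less_mult_iff mult_less_0_iff split: if_splits)
    }
  qed (use r t in \<open>auto simp: sgn_if\<close>)
  moreover have "sgn t * \<bar>t\<bar> = t" by (simp add: sgn_mult_abs)
  ultimately show ?thesis by simp
qed

section \<open>The norm as a parameter along orbits\<close>

lemma norm_flow_decay:
  assumes "s \<le> t"
  shows "norm (flow F t p) \<le> exp (- m * (t - s)) * norm (flow F s p)"
proof (rule gronwall_nonincreasing[OF assms flow_continuous_time])
  fix r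
  show "\<exists>d. ((\<lambda>t. flow F t p) has_vector_derivative d) (at r) \<and> flow F r p \<bullet> d \<le> - m * norm (flow F r p) ^ 2"
    by (intro exI[of _ "F (flow F r p)"] conjI flow_deriv radial)
qed

lemma norm_flow_less:
  assumes "s < t" "p \<noteq> 0"
  shows "norm (flow F t p) < norm (flow F s p)"
proof -
  have "exp (- m * (t - s)) < 1" using assms m_pos by simp
  then have "exp (- m * (t - s)) * norm (flow F s p) < 1 * norm (flow F s p)"
    using assms by (intro mult_strict_right_mono) auto
  then show ?thesis using norm_flow_decay[of s t p] assms by linarith
qed

lemma norm_flow_less_iff: "p \<noteq> 0 \<Longrightarrow> norm (flow F t p) < norm (flow F s p) \<longleftrightarrow> s < t"
  using norm_flow_less[of s t p] norm_flow_less[of t s p] by (cases s t rule: linorder_cases) auto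

lemma ex1_norm_flow:
  assumes p: "p \<noteq> 0" and l: "l > 0"
  shows "\<exists>!t. norm (flow F t p) = l"
proof -
  define n where "n = norm p"
  have n: "n > 0" using p by (simp add: n_def)
  \<comment> \<open>The rate \<open>m\<close> brings the norm down to at most \<open>l\<close> by
    time \<open>T\<close>, and up to at least \<open>l\<close> at time \<open>- T\<close>.\<close>
  define T where "T = \<bar>ln (l / n)\<bar> / m"
  have T: "T \<ge> 0" "m * T = \<bar>ln (l / n)\<bar>" using m_pos by (auto simp: T_def)
  have ln: "exp (ln (l / n)) * n = l" using n l by simp
  have "norm (flow F T p) \<le> exp (- m * T) * n"
    using norm_flow_decay[of 0 T p] T by (simp add: n_def)
  also have "\<dots> \<le> exp (ln (l / n)) * n" using T n by (intro mult_right_mono) auto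
  finally have 1: "norm (flow F T p) \<le> l" using ln by simp
  have "n \<le> exp (- m * T) * norm (flow F (- T) p)"
    using norm_flow_decay[of "- T" 0 p] T by (simp add: n_def)
  then have "exp (m * T) * n \<le> exp (m * T) * (exp (- m * T) * norm (flow F (- T) p))"
    by (intro mult_left_mono) auto
  also have "\<dots> = exp (m * T + - m * T) * norm (flow F (- T) p)" by (simp only: exp_add mult.assoc)
  also have "\<dots> = norm (flow F (- T) p)" by simp
  finally have "exp (m * T) * n \<le> norm (flow F (- T) p)" .
  moreover have "exp (ln (l / n)) * n \<le> exp (m * T) * n" using T n by (intro mult_right_mono) auto
  ultimately have 2: "l \<le> norm (flow F (- T) p)" using ln by simp
  obtain t where t: "norm (flow F t p) = l"
    using IVT2'[of "\<lambda>t. norm (flow F t p)" T l "- T"] 1 2 T continuous_on_norm[OF flow_continuous_time]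
    by auto
  show ?thesis
  proof (rule ex1I[of _ t])
    fix s assume "norm (flow F s p) = l"
    then show "s = t"
      using norm_flow_less[OF _ p, of s t] norm_flow_less[OF _ p, of t s] t by (cases s t rule: linorder_cases) auto
  qed (rule t)
qed

text \<open>The norm runs strictly decreasingly through all positive values along every orbit other
  than the origin, so each prescribed norm is attained at one time. Passing from \<open>flow\<close>
  to \<open>orb\<close> forgets the speed, which an orbital equivalence does not have to
  respect.\<close>

definition hit :: "real^2 \<Rightarrow> real \<Rightarrow> real" where
  "hit p l = (THE t. norm (flow F t p) = l)"

definition orb :: "real^2 \<Rightarrow> real \<Rightarrow> real^2" where
  "orb p l = flow F (hit p l) p"

lemma norm_orb: "p \<noteq> 0 \<Longrightarrow> l > 0 \<Longrightarrow> norm (orb p l) = l"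
  unfolding orb_def hit_def by (rule theI'[OF ex1_norm_flow])

lemma hit_eqI:
  assumes "p \<noteq> 0" "norm (flow F t p) = l"
  shows "hit p l = t"
proof -
  have "l > 0" using assms by force
  from the1_equality[OF ex1_norm_flow[OF assms(1) this] assms(2)] show ?thesis by (simp add: hit_def)
qed

lemma orb_norm_flow: "p \<noteq> 0 \<Longrightarrow> orb p (norm (flow F t p)) = flow F t p"
  using hit_eqI[of p t "norm (flow F t p)"] by (simp add: orb_def)

lemma orb_flow:
  assumes "p \<noteq> 0" "l > 0"
  shows "orb (flow F t p) l = orb p l"
proof -
  have "norm (flow F (hit p l - t) (flow F t p)) = l"
    using norm_orb[OF assms] by (simp add: flow_flow orb_def)
  with assms(1) have "hit (flow F t p) l = hit p l - t" by (intro hit_eqI) simp_all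
  then show ?thesis by (simp add: orb_def flow_flow)
qed

text \<open>The norm is larger than \<open>l\<close> at time \<open>t - e\<close> and smaller at
  time \<open>t + e\<close>. These strict inequalities persist for nearby points and levels, and by
  monotonicity they enclose the hitting time.\<close>

lemma hit_tendsto:
  assumes f: "(f \<longlongrightarrow> p) A" and g: "(g \<longlongrightarrow> l) A" and p: "p \<noteq> 0" and l: "l > 0"
  shows "((\<lambda>x. hit (f x) (g x)) \<longlongrightarrow> hit p l) A"
proof (rule tendstoI)
  fix e :: real assume e: "e > 0"
  define t where "t = hit p l"
  have t: "norm (flow F t p) = l" using norm_orb[OF p l] by (simp add: t_def orb_def)
  have lim: "((\<lambda>x. norm (flow F s (f x)) - g x) \<longlongrightarrow> norm (flow F s p) - l) A" for s
    by (intro tendsto_intros flow_tendsto f g)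
  have "norm (flow F (t - e) p) - l > 0" "norm (flow F (t + e) p) - l < 0"
    using norm_flow_less[of "t - e" t p] norm_flow_less[of t "t + e" p] e p t by auto
  then have "\<forall>\<^sub>F x in A. norm (flow F (t - e) (f x)) - g x > 0"
    and "\<forall>\<^sub>F x in A. norm (flow F (t + e) (f x)) - g x < 0"
    using order_tendstoD(1)[OF lim[of "t - e"], of 0] order_tendstoD(2)[OF lim[of "t + e"], of 0] by simp_all
  moreover have "\<forall>\<^sub>F x in A. g x > 0" using order_tendstoD(1)[OF g l] .
  moreover have "\<forall>\<^sub>F x in A. f x \<noteq> 0" using tendsto_imp_eventually_ne[OF f p] .
  ultimately show "\<forall>\<^sub>F x in A. dist (hit (f x) (g x)) (hit p l) < e"
  proof eventually_elim
    case (elim x)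
    have h: "norm (flow F (hit (f x) (g x)) (f x)) = g x"
      using norm_orb elim by (simp add: orb_def)
    have "hit (f x) (g x) > t - e" "hit (f x) (g x) < t + e"
      using elim h norm_flow_less_iff[of "f x" "hit (f x) (g x)" "t - e"]
        norm_flow_less_iff[of "f x" "t + e" "hit (f x) (g x)"] by auto
    then show ?case by (auto simp: dist_real_def t_def)
  qed
qed

lemma orb_continuous_on: "continuous_on ((- {0}) \<times> {0<..}) (\<lambda>(p, l). orb p l)"
proof -
  have "((\<lambda>(p, l). orb p l) \<longlongrightarrow> orb p l) (at (p, l) within S)" if "p \<noteq> 0" "l > 0" for p l S
  proof -
    have "(fst \<longlongrightarrow> p) (at (p, l) within S)" "(snd \<longlongrightarrow> l) (at (p, l) within S)"
      using tendsto_fst[OF tendsto_ident_at] tendsto_snd[OF tendsto_ident_at] by fastforce+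
    with that show ?thesis
      unfolding orb_def case_prod_beta by (intro flow_tendsto hit_tendsto)
  qed
  then show ?thesis unfolding continuous_on_def by auto
qed

end

section \<open>The orbits in a closed half plane\<close>

lemma ivt_unordered:
  fixes d :: "real \<Rightarrow> real"
  assumes "continuous_on {min a b..max a b} d" "d a > 0" "d b \<le> 0"
  obtains l where "min a b \<le> l" "l \<le> max a b" "d l = 0"
proof (cases "a \<le> b")
  case True
  then show ?thesis using IVT2'[of d b 0 a] assms that by (auto simp: min_def max_def)
next
  case False
  then show ?thesis using IVT'[of d b 0 a] assms that by (auto simp: min_def max_def)
qed

lemma abs_component_le_norm: "\<bar>p $ 1\<bar> \<le> norm p" for p :: "real^2"
  by (rule component_le_norm_cart)

lemma abs_component_less_norm:
  fixes p :: "real^2"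
  assumes "p $ 2 \<noteq> 0"
  shows "\<bar>p $ 1\<bar> < norm p"
proof -
  have "sqrt ((p $ 1)\<^sup>2) < sqrt ((p $ 1)\<^sup>2 + (p $ 2)\<^sup>2)" using assms by (intro real_sqrt_less_mono) simp
  then show ?thesis by (simp add: norm_vec2)
qed

lemma upper_eqI:
  fixes p q :: "real^2"
  assumes "norm p = norm q" "p $ 2 \<ge> 0" "q $ 2 \<ge> 0" "p $ 1 = q $ 1"
  shows "p = q"
proof -
  have "(p $ 2)\<^sup>2 = (q $ 2)\<^sup>2" using assms(1,4) by (simp add: norm_vec2)
  then have "p $ 2 = q $ 2" using assms(2,3) by simp
  then show ?thesis using assms(4) by (simp add: vec_eq_iff forall_2)
qed

lemma upper_unit_eq:
  fixes p :: "real^2"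
  assumes "norm p = 1" "p $ 2 \<ge> 0"
  shows "p = pt (p $ 1) (sqrt (1 - (p $ 1)\<^sup>2))"
proof -
  have "(p $ 1)\<^sup>2 + (p $ 2)\<^sup>2 = 1" using assms(1) by (simp add: norm_vec2)
  then have "1 - (p $ 1)\<^sup>2 = (p $ 2)\<^sup>2" by simp
  then show ?thesis using assms(2) by (simp add: pt_eq_iff)
qed

lemma norm_pt_unit:
  assumes "\<bar>x\<bar> \<le> 1"
  shows "norm (pt x (sqrt (1 - x\<^sup>2))) = 1"
proof -
  have "x\<^sup>2 \<le> 1" using assms by (simp add: abs_square_le_1)
  then show ?thesis by (simp add: norm_vec2)
qed

text \<open>
  \<open>Q p l\<close> is the point of norm \<open>l\<close> on the orbit of \<open>p\<close>.
\<close>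

locale orbit_structure =
  fixes Q :: "real^2 \<Rightarrow> real \<Rightarrow> real^2"
  assumes Q_norm: "p \<noteq> 0 \<Longrightarrow> l > 0 \<Longrightarrow> norm (Q p l) = l"
    and Q_self: "p \<noteq> 0 \<Longrightarrow> Q p (norm p) = p"
    and Q_Q: "p \<noteq> 0 \<Longrightarrow> l > 0 \<Longrightarrow> l' > 0 \<Longrightarrow> Q (Q p l) l' = Q p l'"
    and Q_cont: "continuous_on ((- {0}) \<times> {0<..}) (\<lambda>(p, l). Q p l)"
    and Q_in: "x \<noteq> 0 \<Longrightarrow> 0 < l \<Longrightarrow> l < \<bar>x\<bar> \<Longrightarrow> x * Q (pt x 0) l $ 2 > 0"
    and Q_out: "x \<noteq> 0 \<Longrightarrow> \<bar>x\<bar> < l \<Longrightarrow> x * Q (pt x 0) l $ 2 < 0"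
    and Q_rays: "\<exists>b1 b2. norm b1 = 1 \<and> norm b2 = 1 \<and> b1 \<noteq> b2 \<and> (\<forall>l>0. Q b1 l $ 2 > 0 \<and> Q b2 l $ 2 > 0)"
begin

lemma Q_nonzero: "p \<noteq> 0 \<Longrightarrow> l > 0 \<Longrightarrow> Q p l \<noteq> 0"
  using Q_norm[of p l] by force

lemma Q_continuous_on:
  assumes "continuous_on S f" "continuous_on S g" "\<And>x. x \<in> S \<Longrightarrow> f x \<noteq> 0" "\<And>x. x \<in> S \<Longrightarrow> g x > 0"
  shows "continuous_on S (\<lambda>x. Q (f x) (g x))"
proof -
  have "continuous_on S (\<lambda>x. (f x, g x))" using assms(1,2) by (rule continuous_on_Pair)
  from continuous_on_compose2[OF Q_cont this] assms(3,4) show ?thesis by auto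
qed

lemma Q_axis_self: "x \<noteq> 0 \<Longrightarrow> Q (pt x 0) \<bar>x\<bar> = pt x 0"
  using Q_self[of "pt x 0"] by simp

text \<open>On an upper half circle the abscissa is a coordinate. If the order of two orbits changed
  while both are in the closed half plane, they would have equal abscissae at some common norm,
  hence a common point, and would coincide.\<close>

lemma order_preserved:
  assumes nz: "p \<noteq> 0" "q \<noteq> 0" and l: "l0 > 0" "l1 > 0"
    and up: "\<And>l. min l0 l1 \<le> l \<Longrightarrow> l \<le> max l0 l1 \<Longrightarrow> Q p l $ 2 \<ge> 0 \<and> Q q l $ 2 \<ge> 0"
    and less: "Q p l0 $ 1 < Q q l0 $ 1"
  shows "Q p l1 $ 1 < Q q l1 $ 1"
proof (rule ccontr)
  assume "\<not> ?thesis"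
  then have 1: "Q q l1 $ 1 - Q p l1 $ 1 \<le> 0" and 0: "Q q l0 $ 1 - Q p l0 $ 1 > 0" using less by auto
  have "continuous_on {min l0 l1..max l0 l1} (\<lambda>l. Q q l $ 1 - Q p l $ 1)"
    using nz l by (intro continuous_on_diff continuous_on_component Q_continuous_on) auto
  from ivt_unordered[OF this 0 1] obtain l' where
    l': "min l0 l1 \<le> l'" "l' \<le> max l0 l1" "Q q l' $ 1 - Q p l' $ 1 = 0" .
  have l'0: "l' > 0" using l l'(1) by linarith
  have "Q p l' = Q q l'"
    using up[OF l'(1,2)] l'(3) Q_norm[OF nz(1) l'0] Q_norm[OF nz(2) l'0] by (intro upper_eqI) auto
  then have "Q p l0 = Q q l0" using Q_Q[OF nz(1) l'0 l(1)] Q_Q[OF nz(2) l'0 l(1)] by simp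
  then show False using less by simp
qed

definition crosses :: "real^2 \<Rightarrow> real \<Rightarrow> bool" where
  "crosses p x \<longleftrightarrow> x \<noteq> 0 \<and> Q p \<bar>x\<bar> = pt x 0"

lemma crosses_Q:
  assumes "p \<noteq> 0" "crosses p x" "l > 0"
  shows "Q p l = Q (pt x 0) l"
  using assms Q_Q[of p "\<bar>x\<bar>" l] by (simp add: crosses_def)

lemma Q_axis_pos_iff:
  assumes "x > 0" "l > 0"
  shows "Q (pt x 0) l $ 2 \<ge> 0 \<longleftrightarrow> l \<le> x"
  using assms Q_in[of x l] Q_out[of x l] Q_axis_self[of x]
  by (cases l x rule: linorder_cases) (auto simp: zero_less_mult_iff mult_less_0_iff)

lemma Q_axis_neg_iff:
  assumes "x < 0" "l > 0"
  shows "Q (pt x 0) l $ 2 \<ge> 0 \<longleftrightarrow> - x \<le> l"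
  using assms Q_in[of x l] Q_out[of x l] Q_axis_self[of x]
  by (cases l "- x" rule: linorder_cases) (auto simp: zero_less_mult_iff mult_less_0_iff)

lemma crosses_unique:
  assumes p: "p \<noteq> 0" and x: "crosses p x" and y: "crosses p y"
  shows "x = y"
proof -
  have nz: "x \<noteq> 0" "y \<noteq> 0" using x y by (auto simp: crosses_def)
  have "Q (pt x 0) \<bar>y\<bar> = pt y 0" using crosses_Q[OF p x, of "\<bar>y\<bar>"] y nz by (simp add: crosses_def)
  then have "\<bar>y\<bar> = \<bar>x\<bar>"
    using Q_in[of x "\<bar>y\<bar>"] Q_out[of x "\<bar>y\<bar>"] nz by (cases "\<bar>y\<bar>" "\<bar>x\<bar>" rule: linorder_cases) auto
  then have "pt x 0 = pt y 0" using x y by (simp add: crosses_def)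
  then show ?thesis by (simp add: vec_eq_iff forall_2)
qed

lemma crosses_zero:
  assumes "p \<noteq> 0" "l > 0" "Q p l $ 2 = 0"
  shows "crosses p (Q p l $ 1)"
proof -
  have "norm (Q p l) = \<bar>Q p l $ 1\<bar>" using assms(3) by (simp add: norm_vec2)
  then have l: "\<bar>Q p l $ 1\<bar> = l" using Q_norm assms by simp
  have "Q p l = pt (Q p l $ 1) 0" using assms(3) by (simp add: pt_eq_iff)
  moreover have "Q p l $ 1 \<noteq> 0" using l assms(2) by auto
  ultimately show ?thesis using l by (simp add: crosses_def)
qed

lemma not_crosses_upper:
  assumes p: "p \<noteq> 0" and nc: "\<And>x. \<not> crosses p x" and l: "l0 > 0" "l > 0" and up: "Q p l0 $ 2 > 0"
  shows "Q p l $ 2 > 0"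
proof (rule ccontr)
  assume "\<not> ?thesis"
  then have 1: "Q p l $ 2 \<le> 0" by simp
  have "continuous_on {min l0 l..max l0 l} (\<lambda>l. Q p l $ 2)"
    using p l by (intro continuous_on_component Q_continuous_on) auto
  from ivt_unordered[OF this up 1] obtain k where k: "min l0 l \<le> k" "Q p k $ 2 = 0" by metis
  then show False using nc crosses_zero[OF p, of k] l by (auto simp: min_def split: if_splits)
qed

text \<open>The orbit through \<open>(x, 0)\<close> is in the closed upper half plane at norm 1 only
  for \<open>1 \<le> x\<close> or \<open>-1 \<le> x < 0\<close>; only there does the abscissa
  determine the point.\<close>

definition axis_abscissa :: "real \<Rightarrow> real" where
  "axis_abscissa x = Q (pt x 0) 1 $ 1"

lemma axis_abscissa_1: "axis_abscissa 1 = 1" and axis_abscissa_m1: "axis_abscissa (-1) = -1"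
  using Q_axis_self[of 1] Q_axis_self[of "-1"] by (auto simp: axis_abscissa_def)

lemma axis_abscissa_bound: "x \<noteq> 0 \<Longrightarrow> \<bar>axis_abscissa x\<bar> \<le> 1"
  using abs_component_le_norm[of "Q (pt x 0) 1"] Q_norm[of "pt x 0" 1] by (simp add: axis_abscissa_def)

text \<open>At norm \<open>x\<close> the orbit through \<open>(x, 0)\<close> is on the axis and so
  has the largest abscissa on its circle, while the other orbit is strictly above the axis.
  \<open>order_preserved\<close> carries this comparison to norm 1. The next three lemmas argue
  alike, with the smallest abscissa on the negative side.\<close>

lemma axis_abscissa_strict_pos:
  assumes "1 \<le> x" "x < y"
  shows "axis_abscissa y < axis_abscissa x"
  unfolding axis_abscissa_def
proof (rule order_preserved[where ?l0.0 = x])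
  have "Q (pt y 0) x $ 2 > 0" using Q_in[of y x] assms by (auto simp: zero_less_mult_iff)
  then have "\<bar>Q (pt y 0) x $ 1\<bar> < norm (Q (pt y 0) x)" by (intro abs_component_less_norm) simp
  then show "Q (pt y 0) x $ 1 < Q (pt x 0) x $ 1" using Q_norm[of "pt y 0" x] Q_axis_self[of x] assms by simp
  show "0 \<le> Q (pt y 0) l $ 2 \<and> 0 \<le> Q (pt x 0) l $ 2" if "min x 1 \<le> l" "l \<le> max x 1" for l
    using that assms by (subst (1 2) Q_axis_pos_iff) auto
qed (use assms in auto)

lemma axis_abscissa_strict_neg:
  assumes "-1 \<le> x" "x < y" "y < 0"
  shows "axis_abscissa x < axis_abscissa y"
  unfolding axis_abscissa_def
proof (rule order_preserved[where ?l0.0 = "- x"])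
  have "Q (pt y 0) (- x) $ 2 > 0" using Q_out[of y "- x"] assms by (auto simp: mult_less_0_iff)
  then have "\<bar>Q (pt y 0) (- x) $ 1\<bar> < norm (Q (pt y 0) (- x))" by (intro abs_component_less_norm) simp
  then show "Q (pt x 0) (- x) $ 1 < Q (pt y 0) (- x) $ 1" using Q_norm[of "pt y 0" "- x"] Q_axis_self[of x] assms by simp
  show "0 \<le> Q (pt x 0) l $ 2 \<and> 0 \<le> Q (pt y 0) l $ 2" if "min (- x) 1 \<le> l" "l \<le> max (- x) 1" for l
    using that assms by (subst (1 2) Q_axis_neg_iff) auto
qed (use assms in auto)

lemma axis_abscissa_ray_pos:
  assumes b: "norm b = 1" "\<And>l. l > 0 \<Longrightarrow> Q b l $ 2 > 0" and x: "1 \<le> x"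
  shows "b $ 1 < axis_abscissa x"
proof -
  have bn: "b \<noteq> 0" using b(1) by auto
  have "Q b 1 $ 1 < Q (pt x 0) 1 $ 1"
  proof (rule order_preserved[where ?l0.0 = x])
    have "\<bar>Q b x $ 1\<bar> < norm (Q b x)" using b(2)[of x] x by (intro abs_component_less_norm) simp
    then show "Q b x $ 1 < Q (pt x 0) x $ 1" using Q_norm[OF bn, of x] Q_axis_self[of x] x by simp
    show "0 \<le> Q b l $ 2 \<and> 0 \<le> Q (pt x 0) l $ 2" if "min x 1 \<le> l" "l \<le> max x 1" for l
      using that x b(2)[of l] by (subst Q_axis_pos_iff) auto
  qed (use x bn in auto)
  then show ?thesis using Q_self[OF bn] b(1) by (simp add: axis_abscissa_def)
qed

lemma axis_abscissa_ray_neg: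
  assumes b: "norm b = 1" "\<And>l. l > 0 \<Longrightarrow> Q b l $ 2 > 0" and x: "-1 \<le> x" "x < 0"
  shows "axis_abscissa x < b $ 1"
proof -
  have bn: "b \<noteq> 0" using b(1) by auto
  have "Q (pt x 0) 1 $ 1 < Q b 1 $ 1"
  proof (rule order_preserved[where ?l0.0 = "- x"])
    have "\<bar>Q b (- x) $ 1\<bar> < norm (Q b (- x))" using b(2)[of "- x"] x by (intro abs_component_less_norm) simp
    then show "Q (pt x 0) (- x) $ 1 < Q b (- x) $ 1" using Q_norm[OF bn, of "- x"] Q_axis_self[of x] x by simp
    show "0 \<le> Q (pt x 0) l $ 2 \<and> 0 \<le> Q b l $ 2" if "min (- x) 1 \<le> l" "l \<le> max (- x) 1" for l
      using that x b(2)[of l] by (subst Q_axis_neg_iff) auto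
  qed (use x bn in auto)
  then show ?thesis using Q_self[OF bn] b(1) by (simp add: axis_abscissa_def)
qed

text \<open>By monotonicity these are the limits of \<open>axis_abscissa x\<close> for
  \<open>x\<close> to infinity and for \<open>x\<close> to 0 from below. For a linear field in
  normal form they are \<open>1 / sqrt 2\<close> and \<open>- 1 / sqrt 2\<close>, given by the slow
  eigendirection \<open>(1, 1)\<close> and the fast one \<open>(-1, 1)\<close>.\<close>

definition arc_hi :: real where "arc_hi = Inf (axis_abscissa ` {1..})"
definition arc_lo :: real where "arc_lo = Sup (axis_abscissa ` {-1..<0})"

lemma axis_abscissa_bdd_below: "bdd_below (axis_abscissa ` {1..})"
proof (rule bdd_belowI2)
  show "-1 \<le> axis_abscissa x" if "x \<in> {1..}" for x using that axis_abscissa_bound[of x] by auto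
qed

lemma axis_abscissa_bdd_above: "bdd_above (axis_abscissa ` {-1..<0})"
proof (rule bdd_aboveI2)
  show "axis_abscissa x \<le> 1" if "x \<in> {-1..<0}" for x using that axis_abscissa_bound[of x] by auto
qed

lemma arc_hi_less:
  assumes "x \<ge> 1"
  shows "arc_hi < axis_abscissa x"
proof -
  have "arc_hi \<le> axis_abscissa (x + 1)" unfolding arc_hi_def using assms by (intro cInf_lower axis_abscissa_bdd_below) auto
  also have "\<dots> < axis_abscissa x" using assms by (intro axis_abscissa_strict_pos) auto
  finally show ?thesis .
qed

lemma less_arc_lo:
  assumes "-1 \<le> x" "x < 0"
  shows "axis_abscissa x < arc_lo"
proof -
  have "axis_abscissa x < axis_abscissa (x / 2)" using assms by (intro axis_abscissa_strict_neg) auto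
  also have "\<dots> \<le> arc_lo" unfolding arc_lo_def using assms by (intro cSup_upper axis_abscissa_bdd_above) auto
  finally show ?thesis .
qed

lemma arc_bounds: "-1 < arc_lo" "arc_hi < 1"
  using less_arc_lo[of "-1"] arc_hi_less[of 1] axis_abscissa_1 axis_abscissa_m1 by auto

text \<open>Every orbit that stays in the open half plane meets the unit circle between the two
  bounds. One such orbit gives only \<open>arc_lo \<le> arc_hi\<close>; the second one, with a
  different abscissa, makes the inequality strict.\<close>

lemma arc_lo_less_hi: "arc_lo < arc_hi"
proof -
  obtain b1 b2 where b: "norm b1 = 1" "norm b2 = 1" "b1 \<noteq> b2"
    and up: "\<And>l. l > 0 \<Longrightarrow> Q b1 l $ 2 > 0" "\<And>l. l > 0 \<Longrightarrow> Q b2 l $ 2 > 0"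
    using Q_rays by blast
  have "b1 \<noteq> 0" "b2 \<noteq> 0" using b by auto
  then have up1: "b1 $ 2 > 0" "b2 $ 2 > 0" using up[of 1] Q_self[of b1] Q_self[of b2] b by simp_all
  then have ne: "b1 $ 1 \<noteq> b2 $ 1" using upper_eqI[of b1 b2] b by auto
  have "b1 $ 1 \<le> arc_hi" "b2 $ 1 \<le> arc_hi"
    unfolding arc_hi_def
    using less_imp_le[OF axis_abscissa_ray_pos[OF b(1) up(1)]] less_imp_le[OF axis_abscissa_ray_pos[OF b(2) up(2)]]
    by (auto intro!: cINF_greatest)
  moreover have "arc_lo \<le> b1 $ 1" "arc_lo \<le> b2 $ 1"
    unfolding arc_lo_def
    using less_imp_le[OF axis_abscissa_ray_neg[OF b(1) up(1)]] less_imp_le[OF axis_abscissa_ray_neg[OF b(2) up(2)]]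
    by (auto intro!: cSUP_least)
  ultimately show ?thesis using ne by linarith
qed

text \<open>
  Labels for the orbits that meet the closed upper half plane: a label \<open>s > 1\<close> stands for the
  orbit through \<open>(1 / (s - 1), 0)\<close>, a label \<open>s < -1\<close> for the one through \<open>(s + 1, 0)\<close>, and the
  labels in \<open>[-1, 1]\<close> for those that avoid the axis. The latter meet the unit circle in a closed
  arc, whose end points have the abscissae \<open>arc_lo\<close> and \<open>arc_hi\<close>. The set \<open>labels\<close> of pairs of a
  label and a norm that occur in the half plane does not depend on \<open>Q\<close>.
\<close>

definition arc_at :: "real \<Rightarrow> real" where
  "arc_at s = arc_lo + (arc_hi - arc_lo) * (s + 1) / 2"

definition rep :: "real \<Rightarrow> real^2" where
  "rep s = (if s > 1 then pt (1 / (s - 1)) 0 else if s < -1 then pt (s + 1) 0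
            else pt (arc_at s) (sqrt (1 - (arc_at s)\<^sup>2)))"

lemma arc_at_bounds:
  assumes "-1 \<le> s" "s \<le> 1"
  shows "arc_lo \<le> arc_at s" "arc_at s \<le> arc_hi" "\<bar>arc_at s\<bar> < 1"
proof -
  have "0 \<le> (arc_hi - arc_lo) * (s + 1)" using arc_lo_less_hi assms by simp
  then show 1: "arc_lo \<le> arc_at s" by (simp add: arc_at_def)
  have "(arc_hi - arc_lo) * (s + 1) \<le> (arc_hi - arc_lo) * 2"
    using arc_lo_less_hi assms by (intro mult_left_mono) auto
  then show 2: "arc_at s \<le> arc_hi" by (simp add: arc_at_def)
  show "\<bar>arc_at s\<bar> < 1" using 1 2 arc_bounds by linarith
qed

lemma arc_at_mono: "s < s' \<Longrightarrow> arc_at s < arc_at s'"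
  using arc_lo_less_hi by (simp add: arc_at_def)

lemma rep_pos: "s > 1 \<Longrightarrow> rep s = pt (1 / (s - 1)) 0"
  and rep_neg: "s < -1 \<Longrightarrow> rep s = pt (s + 1) 0"
  and rep_arc: "-1 \<le> s \<Longrightarrow> s \<le> 1 \<Longrightarrow> rep s = pt (arc_at s) (sqrt (1 - (arc_at s)\<^sup>2))"
  by (auto simp: rep_def)

lemma norm_rep_arc: "-1 \<le> s \<Longrightarrow> s \<le> 1 \<Longrightarrow> norm (rep s) = 1"
  using norm_pt_unit arc_at_bounds(3)[of s] by (simp add: rep_arc)

lemma rep_nonzero: "rep s \<noteq> 0"
proof (cases "-1 \<le> s \<and> s \<le> 1")
  case True
  then show ?thesis using norm_rep_arc[of s] by force
next
  case False
  then show ?thesis by (auto simp: rep_def)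
qed

lemma rep_arc_upper:
  assumes "-1 \<le> s" "s \<le> 1"
  shows "rep s $ 2 > 0"
proof -
  have "(arc_at s)\<^sup>2 < 1" using arc_at_bounds(3)[OF assms] by (simp add: abs_square_less_1)
  then show ?thesis using assms by (simp add: rep_arc)
qed

lemma Q_rep_arc_1: "-1 \<le> s \<Longrightarrow> s \<le> 1 \<Longrightarrow> Q (rep s) 1 = rep s"
  using Q_self[OF rep_nonzero, of s] norm_rep_arc[of s] by simp

text \<open>An orbit that meets the axis and is in the closed half plane at norm 1 has its abscissa
  there strictly beyond \<open>arc_hi\<close> or \<open>arc_lo\<close>, since these bounds are not
  attained.\<close>

lemma rep_arc_not_crosses:
  assumes s: "-1 \<le> s" "s \<le> 1"
  shows "\<not> crosses (rep s) x"
proof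
  assume c: "crosses (rep s) x"
  then have x: "x \<noteq> 0" by (simp add: crosses_def)
  have e: "rep s = Q (pt x 0) 1" using crosses_Q[OF rep_nonzero c, of 1] Q_rep_arc_1[OF s] by simp
  then have up: "Q (pt x 0) 1 $ 2 \<ge> 0" using rep_arc_upper[OF s] by simp
  have axis_abscissa: "axis_abscissa x = arc_at s" unfolding axis_abscissa_def e[symmetric] using s by (simp add: rep_arc)
  show False
  proof (cases "x > 0")
    case True
    then have "x \<ge> 1" using up Q_axis_pos_iff[of x 1] by simp
    then show False using arc_hi_less[of x] axis_abscissa arc_at_bounds(2)[OF s] by simp
  next
    case False
    then have "x < 0" "-1 \<le> x" using up x Q_axis_neg_iff[of x 1] by simp_all
    then show False using less_arc_lo[of x] axis_abscissa arc_at_bounds(1)[OF s] by simp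
  qed
qed

lemma Q_rep_arc_upper:
  assumes "-1 \<le> s" "s \<le> 1" "l > 0"
  shows "Q (rep s) l $ 2 > 0"
  using not_crosses_upper[OF rep_nonzero rep_arc_not_crosses[OF assms(1,2)], of 1 l]
    Q_rep_arc_1 rep_arc_upper assms by simp

definition labels :: "(real \<times> real) set" where
  "labels = {(s, l). l > 0 \<and> l * (s - 1) \<le> 1 \<and> -1 - s \<le> l}"

lemma Q_rep_upper_iff:
  assumes l: "l > 0"
  shows "Q (rep s) l $ 2 \<ge> 0 \<longleftrightarrow> (s, l) \<in> labels"
proof -
  consider "s > 1" | "s < -1" | "-1 \<le> s" "s \<le> 1" by linarith
  then show ?thesis
  proof cases
    case 1
    have "Q (rep s) l $ 2 \<ge> 0 \<longleftrightarrow> l \<le> 1 / (s - 1)"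
      using Q_axis_pos_iff[of "1 / (s - 1)" l] 1 l by (simp add: rep_pos)
    also have "\<dots> \<longleftrightarrow> l * (s - 1) \<le> 1" using 1 by (simp add: pos_le_divide_eq)
    finally show ?thesis using 1 l by (simp add: labels_def)
  next
    case 2
    have "Q (rep s) l $ 2 \<ge> 0 \<longleftrightarrow> - 1 - s \<le> l"
      using Q_axis_neg_iff[of "s + 1" l] 2 l by (simp add: rep_neg algebra_simps)
    moreover have "l * (s - 1) \<le> 0" using 2 l by (simp add: mult_nonneg_nonpos)
    ultimately show ?thesis using l by (auto simp: labels_def)
  next
    case 3
    have "l * (s - 1) \<le> 0" using 3 l by (simp add: mult_nonneg_nonpos)
    then show ?thesis using Q_rep_arc_upper[OF 3 l] 3 l by (auto simp: labels_def)
  qed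
qed

text \<open>The labels in \<open>{-2..2}\<close> are those with \<open>(s, 1) \<in> labels\<close>,
  that is, those whose orbits meet the closed upper half of the unit circle; \<open>2\<close> and
  \<open>-2\<close> belong to its end points.\<close>

definition arc_abscissa :: "real \<Rightarrow> real" where
  "arc_abscissa s = Q (rep s) 1 $ 1"

lemma arc_abscissa_pos: "s > 1 \<Longrightarrow> arc_abscissa s = axis_abscissa (1 / (s - 1))"
  and arc_abscissa_neg: "s < -1 \<Longrightarrow> arc_abscissa s = axis_abscissa (s + 1)"
  by (simp_all add: arc_abscissa_def axis_abscissa_def rep_pos rep_neg)

lemma arc_abscissa_arc: "-1 \<le> s \<Longrightarrow> s \<le> 1 \<Longrightarrow> arc_abscissa s = arc_at s"
  unfolding arc_abscissa_def by (simp add: Q_rep_arc_1) (simp add: rep_arc)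

text \<open>
  Two orbits keep their angular order as long as both stay in the half plane.
\<close>

lemma arc_abscissa_strict_mono:
  assumes "-2 \<le> s" "s < t" "t \<le> 2"
  shows "arc_abscissa s < arc_abscissa t"
proof -
  have hi: "arc_hi < arc_abscissa r" if "1 < r" "r \<le> 2" for r
    using that arc_hi_less[of "1 / (r - 1)"] by (simp add: arc_abscissa_pos)
  have lo: "arc_abscissa r < arc_lo" if "-2 \<le> r" "r < -1" for r
    using that less_arc_lo[of "r + 1"] by (simp add: arc_abscissa_neg)
  consider "s < -1" "t < -1" | "s < -1" "-1 \<le> t" "t \<le> 1" | "s < -1" "1 < t"
    | "-1 \<le> s" "t \<le> 1" | "-1 \<le> s" "s \<le> 1" "1 < t" | "1 < s" by linarith
  then show ?thesis
  proof cases
    case 1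
    then show ?thesis using axis_abscissa_strict_neg[of "s + 1" "t + 1"] assms by (simp add: arc_abscissa_neg)
  next
    case 2
    then show ?thesis using lo[of s] arc_at_bounds(1)[of t] assms by (simp add: arc_abscissa_arc)
  next
    case 3
    then show ?thesis using lo[of s] hi[of t] arc_lo_less_hi assms by simp
  next
    case 4
    then show ?thesis using arc_at_mono[of s t] assms by (simp add: arc_abscissa_arc)
  next
    case 5
    then show ?thesis using hi[of t] arc_at_bounds(2)[of s] assms by (simp add: arc_abscissa_arc)
  next
    case 6
    have "1 / (t - 1) < 1 / (s - 1)" using 6 assms by (intro divide_strict_left_mono) auto
    then show ?thesis using axis_abscissa_strict_pos[of "1 / (t - 1)" "1 / (s - 1)"] 6 assms by (simp add: arc_abscissa_pos)
  qed
qed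

lemma axis_abscissa_continuous: "0 \<notin> S \<Longrightarrow> continuous_on S axis_abscissa"
  unfolding axis_abscissa_def
  by (intro continuous_on_component Q_continuous_on continuous_intros) (auto simp: pt_eq_0_iff)

text \<open>Outside the arc, the infimum or supremum supplies an orbit through the axis whose
  abscissa lies beyond \<open>y\<close>, and the intermediate value theorem applies between it and
  the end point \<open>1\<close> or \<open>-1\<close>. On the arc, \<open>arc_at\<close> is affine
  and is inverted explicitly.\<close>

lemma arc_abscissa_surj:
  assumes y: "-1 \<le> y" "y \<le> 1"
  obtains s where "-2 \<le> s" "s \<le> 2" "arc_abscissa s = y"
    "s > 1 \<longleftrightarrow> y > arc_hi" "s < -1 \<longleftrightarrow> y < arc_lo"
proof -
  consider "y > arc_hi" | "y < arc_lo" | "arc_lo \<le> y" "y \<le> arc_hi" by linarith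
  then show ?thesis
  proof cases
    case 1
    have "\<exists>x\<in>axis_abscissa ` {1..}. x < y" using 1 unfolding arc_hi_def by (intro cInf_lessD) auto
    then obtain x where x: "x \<ge> 1" "axis_abscissa x < y" by auto
    have "\<exists>z\<ge>1. z \<le> x \<and> axis_abscissa z = y"
      using x y axis_abscissa_1 by (intro IVT2' axis_abscissa_continuous) auto
    then obtain z where z: "z \<ge> 1" "axis_abscissa z = y" by blast
    show ?thesis
    proof (rule that[of "1 + 1 / z"])
      show "arc_abscissa (1 + 1 / z) = y" using z by (subst arc_abscissa_pos) auto
    qed (use z 1 arc_lo_less_hi in \<open>auto simp: field_simps\<close>)
  next
    case 2
    have "\<exists>x\<in>axis_abscissa ` {-1..<0}. y < x" using 2 unfolding arc_lo_def by (intro less_cSupD) auto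
    then obtain x where x: "-1 \<le> x" "x < 0" "y < axis_abscissa x" by auto
    have "\<exists>z\<ge>-1. z \<le> x \<and> axis_abscissa z = y"
      using x y axis_abscissa_m1 by (intro IVT' axis_abscissa_continuous) auto
    then obtain z where z: "z \<ge> -1" "z < 0" "axis_abscissa z = y" using x by force
    show ?thesis
    proof (rule that[of "z - 1"])
      show "arc_abscissa (z - 1) = y" using z by (subst arc_abscissa_neg) auto
    qed (use z 2 arc_lo_less_hi in auto)
  next
    case 3
    define s where "s = 2 * (y - arc_lo) / (arc_hi - arc_lo) - 1"
    have d: "arc_hi - arc_lo > 0" using arc_lo_less_hi by simp
    have s: "-1 \<le> s" "s \<le> 1" using 3 d by (auto simp: s_def divide_le_eq)
    have "arc_at s = y" using d by (simp add: arc_at_def s_def field_simps)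
    then have "arc_abscissa s = y" using s by (simp add: arc_abscissa_arc)
    then show ?thesis using that[of s] s 3 by auto
  qed
qed

lemma arc_abscissa_2: "arc_abscissa 2 = 1" and arc_abscissa_m2: "arc_abscissa (-2) = -1"
  by (simp_all add: arc_abscissa_pos arc_abscissa_neg axis_abscissa_1 axis_abscissa_m1)

text \<open>A monotone function with open image is continuous. This settles the seams at
  \<open>1\<close> and \<open>-1\<close>, where the three branches of \<open>rep\<close> meet,
  through surjectivity alone.\<close>

lemma arc_abscissa_continuous: "continuous_on {-2<..<2} arc_abscissa"
proof (rule continuous_onI_mono)
  have "arc_abscissa ` {-2<..<2} = {-1<..<1}"
  proof (intro equalityI subsetI)
    fix y assume "y \<in> arc_abscissa ` {-2<..<2}"
    then obtain s where s: "-2 < s" "s < 2" "y = arc_abscissa s" by auto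
    then show "y \<in> {-1<..<1}" using arc_abscissa_strict_mono[of "-2" s] arc_abscissa_strict_mono[of s 2] arc_abscissa_2 arc_abscissa_m2 by auto
  next
    fix y :: real assume y: "y \<in> {-1<..<1}"
    then obtain s where s: "-2 \<le> s" "s \<le> 2" "arc_abscissa s = y" using arc_abscissa_surj[of y] by auto
    then have "s \<noteq> 2" "s \<noteq> -2" using y arc_abscissa_2 arc_abscissa_m2 by auto
    then show "y \<in> arc_abscissa ` {-2<..<2}" using s by force
  qed
  then show "open (arc_abscissa ` {-2<..<2})" by simp
  show "arc_abscissa s \<le> arc_abscissa t" if "s \<in> {-2<..<2}" "t \<in> {-2<..<2}" "s \<le> t" for s t
    using arc_abscissa_strict_mono[of s t] that by (cases "s = t") auto
qed

definition Theta :: "real \<times> real \<Rightarrow> real^2" where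
  "Theta = (\<lambda>(s, l). Q (rep s) l)"

lemma norm_Theta: "l > 0 \<Longrightarrow> norm (Theta (s, l)) = l"
  by (simp add: Theta_def Q_norm rep_nonzero)

lemma Q_rep_1_middle:
  assumes "-2 < s" "s < 2"
  shows "Q (rep s) 1 = pt (arc_abscissa s) (sqrt (1 - (arc_abscissa s)\<^sup>2))"
  unfolding arc_abscissa_def
proof (rule upper_unit_eq)
  have "(s, 1) \<in> labels" using assms by (auto simp: labels_def)
  then show "Q (rep s) 1 $ 2 \<ge> 0" by (simp add: Q_rep_upper_iff)
qed (simp add: Q_norm rep_nonzero)

text \<open>The representative \<open>rep s\<close> itself jumps at \<open>1\<close>, escaping to
  infinity from the right, and at \<open>-1\<close>, tending to the origin from the left. Near these
  labels the orbit is therefore represented by its point on the unit circle, which depends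
  continuously on \<open>s\<close>. The three open pieces overlap and cover everything.\<close>

lemma Theta_continuous: "continuous_on (UNIV \<times> {0<..}) Theta"
proof -
  have 1: "continuous_on ({1<..} \<times> {0<..}) Theta"
  proof (rule continuous_on_eq)
    show "continuous_on ({1<..} \<times> {0<..}) (\<lambda>z. Q (pt (1 / (fst z - 1)) 0) (snd z))"
      by (intro Q_continuous_on continuous_intros) auto
  qed (auto simp: Theta_def rep_pos)
  have 2: "continuous_on ({..<-1} \<times> {0<..}) Theta"
  proof (rule continuous_on_eq)
    show "continuous_on ({..<-1} \<times> {0<..}) (\<lambda>z. Q (pt (fst z + 1) 0) (snd z))"
      by (intro Q_continuous_on continuous_intros) auto
  qed (auto simp: Theta_def rep_neg)
  have 3: "continuous_on ({-2<..<2} \<times> {0<..}) Theta"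
  proof (rule continuous_on_eq)
    have c: "continuous_on ({-2<..<2} \<times> {0<..}) (\<lambda>z. arc_abscissa (fst z))"
      by (rule continuous_on_compose2[OF arc_abscissa_continuous]) (auto intro!: continuous_intros)
    show "continuous_on ({-2<..<2} \<times> {0<..}) (\<lambda>z. Q (pt (arc_abscissa (fst z)) (sqrt (1 - (arc_abscissa (fst z))\<^sup>2))) (snd z))"
    proof (intro Q_continuous_on continuous_intros c)
      show "pt (arc_abscissa (fst z)) (sqrt (1 - (arc_abscissa (fst z))\<^sup>2)) \<noteq> 0" if "z \<in> {-2<..<2} \<times> {0<..}" for z
        using that Q_nonzero[OF rep_nonzero, of 1 "fst z"] Q_rep_1_middle[of "fst z"] by auto
    qed auto
    show "Q (pt (arc_abscissa (fst z)) (sqrt (1 - (arc_abscissa (fst z))\<^sup>2))) (snd z) = Theta z"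
      if "z \<in> {-2<..<2} \<times> {0<..}" for z
      using that Q_rep_1_middle[of "fst z"] Q_Q[OF rep_nonzero, of 1 "snd z" "fst z"]
      by (auto simp: Theta_def case_prod_beta)
  qed
  have U: "(UNIV :: real set) \<times> {0<..} = ({1<..} \<times> {0<..} \<union> {..<-1} \<times> {0<..}) \<union> {-2<..<2} \<times> {0 :: real<..}"
    by auto
  show ?thesis
    unfolding U by (intro continuous_on_open_Un open_Un open_Times 1 2 3) auto
qed

text \<open>The norm gives back \<open>l\<close>. The orbit gives back \<open>s\<close>: through the
  point where it meets the axis, or, if there is none, through its abscissa on the unit
  circle.\<close>

lemma Theta_inj: "inj_on Theta labels"
proof (rule inj_onI, clarify)
  fix s l t k
  assume sl: "(s, l) \<in> labels" and tk: "(t, k) \<in> labels" and eq: "Theta (s, l) = Theta (t, k)"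
  have l: "l > 0" and k: "k > 0" using sl tk by (auto simp: labels_def)
  have lk: "l = k" using norm_Theta[OF l, of s] norm_Theta[OF k, of t] eq by simp
  have Qeq: "Q (rep s) r = Q (rep t) r" if "r > 0" for r
  proof -
    have "Q (Q (rep s) l) r = Q (Q (rep t) l) r" using eq lk by (simp add: Theta_def)
    then show ?thesis using Q_Q[OF rep_nonzero l that] by simp
  qed
  have cross: "crosses (rep r) x \<longleftrightarrow> (r > 1 \<and> x = 1 / (r - 1)) \<or> (r < -1 \<and> x = r + 1)" for r x
  proof (cases "-1 \<le> r \<and> r \<le> 1")
    case True
    then show ?thesis using rep_arc_not_crosses by auto
  next
    case False
    define z where "z = (if r > 1 then 1 / (r - 1) else r + 1)"
    have z: "z \<noteq> 0" "rep r = pt z 0" using False by (auto simp: z_def rep_def)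
    have "crosses (rep r) z" using z Q_axis_self[of z] by (simp add: crosses_def)
    then have "crosses (rep r) x \<longleftrightarrow> x = z" using crosses_unique[OF rep_nonzero] by blast
    then show ?thesis using False by (auto simp: z_def)
  qed
  have same: "crosses (rep s) x \<longleftrightarrow> crosses (rep t) x" for x
    unfolding crosses_def using Qeq[of "\<bar>x\<bar>"] by auto
  have "s = t"
  proof (cases "-1 \<le> s \<and> s \<le> 1")
    case True
    then have "\<not> crosses (rep t) x" for x using same rep_arc_not_crosses by blast
    then have t: "-1 \<le> t" "t \<le> 1" using cross[of t] by force+
    have "rep s = rep t" using Qeq[of 1] True t by (simp add: Q_rep_arc_1)
    then have "arc_abscissa s = arc_abscissa t" by (simp add: arc_abscissa_def)
    then show ?thesis
      using arc_abscissa_strict_mono[of s t] arc_abscissa_strict_mono[of t s] True t by (cases s t rule: linorder_cases) auto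
  next
    case False
    define x where "x = (if s > 1 then 1 / (s - 1) else s + 1)"
    have "crosses (rep s) x" using False by (auto simp: cross x_def)
    then have "(t > 1 \<and> x = 1 / (t - 1)) \<or> (t < -1 \<and> x = t + 1)" using same cross by blast
    then show ?thesis
    proof
      assume t: "t > 1 \<and> x = 1 / (t - 1)"
      then have "1 / (t - 1) > 0" by simp
      with t have "x > 0" by simp
      then have "s > 1" using False by (auto simp: x_def split: if_splits)
      then show ?thesis using t by (simp add: x_def)
    next
      assume t: "t < -1 \<and> x = t + 1"
      have "\<not> s > 1"
      proof
        assume "s > 1"
        then have "x = 1 / (s - 1)" "1 / (s - 1) > 0" by (simp_all add: x_def)
        with t show False by linarith
      qed
      then show ?thesis using t by (simp add: x_def)
    qed
  qed
  then show "s = t \<and> l = k" using lk by simp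
qed

text \<open>An orbit that meets the axis at \<open>x\<close> gets the label \<open>1 + 1 / x\<close>
  or \<open>x - 1\<close>. Any other orbit through the half plane stays in it, so it can be followed
  to the unit circle, where \<open>arc_abscissa_surj\<close> finds the label.\<close>

lemma Theta_image: "Theta ` labels = {p. p \<noteq> 0 \<and> p $ 2 \<ge> 0}"
proof (intro equalityI subsetI)
  fix p assume "p \<in> Theta ` labels"
  then obtain s l where sl: "(s, l) \<in> labels" "p = Theta (s, l)" by auto
  then have "l > 0" by (simp add: labels_def)
  then show "p \<in> {p. p \<noteq> 0 \<and> p $ 2 \<ge> 0}"
    using sl Q_rep_upper_iff[of l s] Q_nonzero[OF rep_nonzero, of l s] by (simp add: Theta_def)
next
  fix p :: "real^2" assume "p \<in> {p. p \<noteq> 0 \<and> p $ 2 \<ge> 0}"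
  then have p: "p \<noteq> 0" and up: "p $ 2 \<ge> 0" by auto
  have n: "norm p > 0" using p by simp
  have "\<exists>s. p = Q (rep s) (norm p)"
  proof (cases "\<exists>x. crosses p x")
    case True
    then obtain x where c: "crosses p x" by blast
    then have x: "x \<noteq> 0" by (simp add: crosses_def)
    have pe: "p = Q (pt x 0) (norm p)" using crosses_Q[OF p c n] Q_self[OF p] by simp
    show ?thesis
    proof (cases "x > 0")
      case True
      then have "rep (1 + 1 / x) = pt x 0" by (simp add: rep_pos)
      then show ?thesis using pe by metis
    next
      case False
      then have "rep (x - 1) = pt x 0" using x by (simp add: rep_neg)
      then show ?thesis using pe by metis
    qed
  next
    case False
    have p2: "p $ 2 > 0" using up False crosses_zero[OF p n] Q_self[OF p] by fastforce
    have q2: "Q p 1 $ 2 > 0" using not_crosses_upper[OF p _ n, of 1] False p2 Q_self[OF p] by auto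
    have q1: "\<bar>Q p 1 $ 1\<bar> \<le> 1" using abs_component_le_norm[of "Q p 1"] Q_norm[OF p, of 1] by simp
    obtain s where s: "-2 \<le> s" "s \<le> 2" "arc_abscissa s = Q p 1 $ 1"
      using arc_abscissa_surj[of "Q p 1 $ 1"] q1 by (auto simp: abs_le_iff)
    have "(s, 1) \<in> labels" using s by (auto simp: labels_def)
    then have "Q (rep s) 1 $ 2 \<ge> 0" by (simp add: Q_rep_upper_iff)
    then have "Q (rep s) 1 = Q p 1"
      using s(3) q2 Q_norm[OF p, of 1] Q_norm[OF rep_nonzero, of 1 s] by (intro upper_eqI) (auto simp: arc_abscissa_def)
    then have "Q (rep s) (norm p) = p"
      using Q_Q[OF rep_nonzero, of 1 "norm p" s] Q_Q[OF p, of 1 "norm p"] n Q_self[OF p] by simp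
    then show ?thesis by metis
  qed
  then obtain s where s: "p = Q (rep s) (norm p)" by blast
  then have "(s, norm p) \<in> labels" using up Q_rep_upper_iff[OF n, of s] by simp
  moreover have "p = Theta (s, norm p)" using s by (simp add: Theta_def)
  ultimately show "p \<in> Theta ` labels" by blast
qed

definition label :: "real^2 \<Rightarrow> real \<times> real" where
  "label = inv_into labels Theta"

lemma label_Theta: "z \<in> labels \<Longrightarrow> label (Theta z) = z"
  unfolding label_def by (rule inv_into_f_f[OF Theta_inj])

lemma Theta_label: "p \<noteq> 0 \<Longrightarrow> p $ 2 \<ge> 0 \<Longrightarrow> Theta (label p) = p"
  unfolding label_def by (rule f_inv_into_f) (simp add: Theta_image)

lemma label_in: "p \<noteq> 0 \<Longrightarrow> p $ 2 \<ge> 0 \<Longrightarrow> label p \<in> labels"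
  unfolding label_def by (rule inv_into_into) (simp add: Theta_image)

text \<open>
  The inverse of \<open>Theta\<close> is continuous because the norm confines everything to compact sets.
\<close>

lemma compact_labels_band:
  assumes a: "a > 0"
  shows "compact (labels \<inter> UNIV \<times> {a..b})"
proof -
  have "labels \<inter> UNIV \<times> {a..b} = {z. a \<le> snd z} \<inter> {z. snd z \<le> b} \<inter> {z. snd z * (fst z - 1) \<le> 1} \<inter> {z. -1 - fst z \<le> snd z}"
    using a by (auto simp: labels_def)
  moreover have "closed \<dots>"
    by (intro closed_Int closed_Collect_le continuous_intros)
  moreover have "labels \<inter> UNIV \<times> {a..b} \<subseteq> {- 1 - b..1 + 1 / a} \<times> {a..b}"
  proof
    fix z assume "z \<in> labels \<inter> UNIV \<times> {a..b}"
    then obtain s l where z: "z = (s, l)" and l: "a \<le> l" "l \<le> b" "l * (s - 1) \<le> 1" "-1 - s \<le> l"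
      by (cases z) (auto simp: labels_def)
    have "s \<le> 1 + 1 / a"
    proof (cases "s \<le> 1")
      case True
      then show ?thesis using a by (meson add_increasing2 divide_nonneg_pos zero_le_one)
    next
      case False
      have "a * (s - 1) \<le> l * (s - 1)" using False l by (intro mult_right_mono) auto
      then have "a * (s - 1) \<le> 1" using l by simp
      then have "s - 1 \<le> 1 / a" using a by (simp add: pos_le_divide_eq mult.commute)
      then show ?thesis by simp
    qed
    then show "z \<in> {- 1 - b..1 + 1 / a} \<times> {a..b}" using l z by auto
  qed
  ultimately have "closed (labels \<inter> UNIV \<times> {a..b})"
    and "labels \<inter> UNIV \<times> {a..b} \<subseteq> {- 1 - b..1 + 1 / a} \<times> {a..b}" by simp_all
  then show ?thesis
    unfolding compact_eq_bounded_closed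
    using bounded_subset[OF compact_imp_bounded[OF compact_Times[OF compact_Icc compact_Icc]]] by blast
qed

lemma label_continuous: "continuous_on {p. p \<noteq> 0 \<and> p $ 2 \<ge> 0} label"
proof -
  let ?P = "{p :: real^2. p \<noteq> 0 \<and> p $ 2 \<ge> 0}"
  have band: "continuous_on (?P \<inter> {p. a < norm p \<and> norm p < b}) label" if a: "a > 0" for a b
  proof (rule continuous_on_subset)
    let ?S = "labels \<inter> UNIV \<times> {a..b}"
    show "continuous_on (Theta ` ?S) label"
    proof (rule continuous_on_inv)
      show "continuous_on ?S Theta"
        by (rule continuous_on_subset[OF Theta_continuous]) (use a in auto)
    qed (use compact_labels_band[OF a] label_Theta in auto)
    show "?P \<inter> {p. a < norm p \<and> norm p < b} \<subseteq> Theta ` ?S"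
    proof
      fix p assume p: "p \<in> ?P \<inter> {p. a < norm p \<and> norm p < b}"
      then obtain z where z: "z \<in> labels" "p = Theta z" using Theta_image by blast
      then have "snd z = norm p" using norm_Theta[of "snd z" "fst z"] by (auto simp: labels_def)
      then show "p \<in> Theta ` ?S" using z p by (intro image_eqI[of _ _ z]) (auto simp: mem_Times_iff)
    qed
  qed
  show ?thesis
    unfolding continuous_on_eq_continuous_within
  proof
    fix p assume p: "p \<in> ?P"
    let ?U = "{q :: real^2. norm p / 2 < norm q \<and> norm q < 2 * norm p}"
    have U: "open ?U" by (intro open_Collect_conj open_Collect_less continuous_intros)
    have "p \<in> ?U" using p by simp
    have "continuous (at p within ?P \<inter> ?U) label"
      using band[of "norm p / 2" "2 * norm p"] p by (simp add: continuous_on_eq_continuous_within)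
    moreover have "at p within ?P \<inter> ?U = at p within ?P"
      using \<open>p \<in> ?U\<close> U by (rule at_within_nhd) auto
    ultimately show "continuous (at p within ?P) label" by simp
  qed
qed

end

context node_normal
begin

lemma orb_eq_flow:
  assumes "p \<noteq> 0" "l > 0"
  obtains t where "orb p l = flow F t p" "norm (flow F t p) = l"
  using norm_orb[OF assms] by (simp add: orb_def)

lemma hit_less:
  assumes "p \<noteq> 0" "0 < l" "l < l'"
  shows "hit p l' < hit p l"
proof -
  have "norm (orb p l) = l" "norm (orb p l') = l'" using norm_orb assms by auto
  then show ?thesis using norm_flow_less_iff[OF assms(1), of "hit p l" "hit p l'"] assms(3) by (simp add: orb_def)
qed

sublocale orbit_structure orb
proof
  fix p :: "real^2" and l l' :: real
  assume p: "p \<noteq> 0"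
  show "orb p (norm p) = p" using orb_norm_flow[OF p, of 0] by simp
  assume l: "l > 0"
  show "norm (orb p l) = l" using norm_orb[OF p l] .
  assume "l' > 0"
  then show "orb (orb p l) l' = orb p l'" unfolding orb_def[of p l] by (rule orb_flow[OF p])
next
  show "continuous_on ((- {0}) \<times> {0<..}) (\<lambda>(p, l). orb p l)" by (rule orb_continuous_on)
next
  fix x l :: real assume x: "x \<noteq> 0"
  then have p: "pt x 0 \<noteq> 0" by simp
  {
    assume l: "0 < l" "l < \<bar>x\<bar>"
    obtain t where t: "orb (pt x 0) l = flow F t (pt x 0)" "norm (flow F t (pt x 0)) = l"
      using orb_eq_flow[OF p l(1)] .
    then have "t > 0" using norm_flow_less_iff[OF p, of t 0] l by simp
    then show "x * orb (pt x 0) l $ 2 > 0"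
      using flow_axis_sign[OF x, of t] by (simp add: t(1) zero_less_mult_iff mult_less_0_iff)
  }
  {
    assume l: "\<bar>x\<bar> < l"
    then have "l > 0" by simp
    obtain t where t: "orb (pt x 0) l = flow F t (pt x 0)" "norm (flow F t (pt x 0)) = l"
      using orb_eq_flow[OF p \<open>l > 0\<close>] .
    then have "t < 0" using norm_flow_less_iff[OF p, of 0 t] l by simp
    then show "x * orb (pt x 0) l $ 2 < 0"
      using flow_axis_sign[OF x, of t] by (auto simp: t(1) zero_less_mult_iff mult_less_0_iff)
  }
next
  \<comment> \<open>These are the rays of \<open>node_normal\<close> with slopes
    \<open>s = 0\<close> and \<open>s = 1/2\<close>, normalised: \<open>(r / 2, r)\<close> has norm
    1 for \<open>r = 2 / sqrt 5\<close>.\<close>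
  let ?b1 = "pt 0 1" and ?b2 = "pt (1/2 * (2 / sqrt 5)) (2 / sqrt 5)"
  have "norm ?b1 = 1" by (simp add: norm_vec2)
  moreover have "norm ?b2 = 1" by (simp add: norm_vec2 power_divide)
  moreover have "?b1 \<noteq> ?b2" by (simp add: vec_eq_iff forall_2)
  moreover have "orb ?b1 l $ 2 > 0" for l
    using flow_ray_upper[of 0 1 "hit ?b1 l"] by (simp add: orb_def)
  moreover have "orb ?b2 l $ 2 > 0" for l
    using flow_ray_upper[of "1/2" "2 / sqrt 5" "hit ?b2 l"] by (simp add: orb_def)
  ultimately show "\<exists>b1 b2. norm b1 = 1 \<and> norm b2 = 1 \<and> b1 \<noteq> b2 \<and> (\<forall>l>0. 0 < orb b1 l $ 2 \<and> 0 < orb b2 l $ 2)"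
    by blast
qed

end

section \<open>Matching the orbits of two nodes in a half plane\<close>

definition half :: "real \<Rightarrow> (real^2) set" where
  "half s = {p. s * p $ 2 \<ge> 0}"

context orbit_structure
begin

lemma label_decomp:
  assumes "p \<noteq> 0" "p $ 2 \<ge> 0"
  obtains s where "(s, norm p) \<in> labels" "label p = (s, norm p)" "p = Q (rep s) (norm p)"
proof -
  obtain s l where sl: "label p = (s, l)" by (cases "label p")
  have lab: "(s, l) \<in> labels" and Th: "p = Theta (s, l)" using label_in[OF assms] Theta_label[OF assms] sl by auto
  then have "l = norm p" using norm_Theta[of l s] by (simp add: labels_def)
  then show ?thesis using that[of s] lab Th sl by (simp add: Theta_def)
qed

lemma axis_Theta:
  assumes "x \<noteq> 0"
  shows "((if x > 0 then 1 + 1 / x else x - 1), \<bar>x\<bar>) \<in> labels"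
    and "Theta ((if x > 0 then 1 + 1 / x else x - 1), \<bar>x\<bar>) = pt x 0"
proof -
  let ?s = "if x > 0 then 1 + 1 / x else x - 1"
  have r: "rep ?s = pt x 0" using assms by (auto simp: rep_pos rep_neg)
  then show T: "Theta (?s, \<bar>x\<bar>) = pt x 0" using Q_axis_self[OF assms] by (simp add: Theta_def)
  then have "Q (rep ?s) \<bar>x\<bar> $ 2 \<ge> 0" by (simp add: Theta_def)
  then show "(?s, \<bar>x\<bar>) \<in> labels" using Q_rep_upper_iff[of "\<bar>x\<bar>" ?s] assms by simp
qed

end

text \<open>A point and its image have the same label and the same norm. The map is meant for the
  closed upper half plane only; the origin has no label and is fixed by hand.\<close>

definition orbit_match :: "(real^2 \<Rightarrow> real \<Rightarrow> real^2) \<Rightarrow> (real^2 \<Rightarrow> real \<Rightarrow> real^2) \<Rightarrow> real^2 \<Rightarrow> real^2" where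
  "orbit_match Q R p = (if p = 0 then 0 else orbit_structure.Theta R (orbit_structure.label Q p))"

locale orbit_structure_pair = Q: orbit_structure Q + R: orbit_structure R for Q R
begin

lemma match_label:
  assumes "p \<noteq> 0" "p $ 2 \<ge> 0" "Q.label p = (s, norm p)"
  shows "orbit_match Q R p = R (R.rep s) (norm p)"
  using assms by (simp add: orbit_match_def R.Theta_def)

lemma match_upper:
  assumes "p $ 2 \<ge> 0"
  shows "norm (orbit_match Q R p) = norm p" "orbit_match Q R p $ 2 \<ge> 0"
    "orbit_match R Q (orbit_match Q R p) = p"
proof -
  have "norm (orbit_match Q R p) = norm p \<and> orbit_match Q R p $ 2 \<ge> 0 \<and> orbit_match R Q (orbit_match Q R p) = p"
  proof (cases "p = 0")
    case True
    then show ?thesis by (simp add: orbit_match_def)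
  next
    case p: False
    obtain s where s: "(s, norm p) \<in> Q.labels" "Q.label p = (s, norm p)" "p = Q (Q.rep s) (norm p)"
      using Q.label_decomp[OF p assms] .
    have H: "orbit_match Q R p = R.Theta (s, norm p)" using match_label[OF p assms s(2)] by (simp add: R.Theta_def)
    have n: "norm (R.Theta (s, norm p)) = norm p" using p by (intro R.norm_Theta) simp
    then have "R.Theta (s, norm p) \<noteq> 0" using p by force
    then have "orbit_match R Q (R.Theta (s, norm p)) = Q.Theta (s, norm p)"
      using R.label_Theta[OF s(1)] by (simp add: orbit_match_def)
    also have "\<dots> = p" using s(3) by (simp add: Q.Theta_def)
    moreover have "R.Theta (s, norm p) $ 2 \<ge> 0"
      using R.Q_rep_upper_iff[of "norm p" s] p s(1) by (simp add: R.Theta_def)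
    ultimately show ?thesis using H n by simp
  qed
  then show "norm (orbit_match Q R p) = norm p" "orbit_match Q R p $ 2 \<ge> 0"
    "orbit_match R Q (orbit_match Q R p) = p" by auto
qed

text \<open>Labels outside \<open>{-1..1}\<close> encode the abscissa of the crossing point by a
  formula that does not involve the orbits, so a point of the axis has the same label and norm in
  both structures. This makes the later gluing possible.\<close>

lemma match_axis: "orbit_match Q R (pt x 0) = pt x 0"
proof (cases "x = 0")
  case True
  then show ?thesis by (simp add: orbit_match_def)
next
  case False
  let ?s = "if x > 0 then 1 + 1 / x else x - 1"
  have "Q.label (pt x 0) = (?s, \<bar>x\<bar>)"
    using Q.label_Theta[OF Q.axis_Theta(1)[OF False]] unfolding Q.axis_Theta(2)[OF False] .
  then show ?thesis using R.axis_Theta(2)[OF False] False by (simp add: orbit_match_def)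
qed

text \<open>In both structures the orbit with label \<open>s\<close> is in the half plane at norm
  \<open>l\<close> if and only if \<open>(s, l) \<in> labels\<close>.\<close>

lemma match_orbit:
  assumes p: "p \<noteq> 0" "p $ 2 \<ge> 0" and l: "l > 0"
  shows "Q p l $ 2 \<ge> 0 \<longleftrightarrow> R (orbit_match Q R p) l $ 2 \<ge> 0"
    and "Q p l $ 2 \<ge> 0 \<Longrightarrow> orbit_match Q R (Q p l) = R (orbit_match Q R p) l"
proof -
  have n: "norm p > 0" using p by simp
  obtain s where s: "(s, norm p) \<in> Q.labels" "Q.label p = (s, norm p)" "p = Q (Q.rep s) (norm p)"
    using Q.label_decomp[OF p] .
  have 1: "Q p l = Q (Q.rep s) l" using Q.Q_Q[OF Q.rep_nonzero n l, of s] s(3) by simp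
  have 2: "R (orbit_match Q R p) l = R (R.rep s) l"
    unfolding match_label[OF p s(2)] by (rule R.Q_Q[OF R.rep_nonzero n l])
  show "Q p l $ 2 \<ge> 0 \<longleftrightarrow> R (orbit_match Q R p) l $ 2 \<ge> 0"
    unfolding 1 2 Q.Q_rep_upper_iff[OF l] R.Q_rep_upper_iff[OF l] ..
  assume "Q p l $ 2 \<ge> 0"
  then have "(s, l) \<in> Q.labels" using 1 Q.Q_rep_upper_iff[OF l] by simp
  from Q.label_Theta[OF this] have "Q.label (Q p l) = (s, l)" unfolding 1 by (simp add: Q.Theta_def)
  then show "orbit_match Q R (Q p l) = R (orbit_match Q R p) l"
    using Q.Q_nonzero[OF p(1) l] 2 by (simp add: orbit_match_def R.Theta_def)
qed

lemma match_continuous: "continuous_on {p. p $ 2 \<ge> 0} (orbit_match Q R)"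
proof -
  let ?P = "{p :: real^2. p $ 2 \<ge> 0}" and ?N = "{p :: real^2. p \<noteq> 0 \<and> p $ 2 \<ge> 0}"
  have c: "continuous_on ?N (orbit_match Q R)"
  proof (rule continuous_on_eq)
    have "Q.labels \<subseteq> UNIV \<times> {0<..}" by (auto simp: Q.labels_def)
    then have "Q.label ` ?N \<subseteq> UNIV \<times> {0<..}" using Q.label_in by blast
    then show "continuous_on ?N (\<lambda>p. R.Theta (Q.label p))"
      using continuous_on_compose2[OF R.Theta_continuous Q.label_continuous] by blast
  qed (simp add: orbit_match_def)
  have "continuous (at p within ?P) (orbit_match Q R)" if p: "p \<in> ?P" for p
  proof (cases "p = 0")
    case True
    \<comment> \<open>The coordinates break down at the origin; there continuity comes from the
      preservation of the norm.\<close>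
    have "((\<lambda>q. norm (orbit_match Q R q)) \<longlongrightarrow> 0) (at 0 within ?P)"
    proof (rule Lim_transform_eventually)
      show "((\<lambda>q :: real^2. norm q) \<longlongrightarrow> 0) (at 0 within ?P)"
        by (intro tendsto_norm_zero tendsto_ident_at)
      show "\<forall>\<^sub>F q in at 0 within ?P. norm q = norm (orbit_match Q R q)"
        unfolding eventually_at_filter using match_upper(1) by (intro always_eventually) auto
    qed
    then have "(orbit_match Q R \<longlongrightarrow> 0) (at 0 within ?P)" by (rule tendsto_norm_zero_cancel)
    moreover have "orbit_match Q R 0 = 0" by (simp add: orbit_match_def)
    ultimately show ?thesis unfolding continuous_within True by simp
  next
    case False
    have "continuous (at p within ?N) (orbit_match Q R)"
      using c p False by (simp add: continuous_on_eq_continuous_within)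
    moreover have "at p within ?N = at p within ?P"
      by (rule at_within_nhd[of p "- {0}"]) (use False in auto)
    ultimately show ?thesis by simp
  qed
  then show ?thesis by (simp add: continuous_on_eq_continuous_within)
qed

end

text \<open>The change of time is a bijection of the whole line although the orbits are compared
  only while they are in the half planes; the equivalence in the second line says that this happens
  at corresponding times. Thanks to \<open>\<alpha> 0 = 0\<close>, the changes of time from the two
  sides of a crossing point can be joined there.\<close>

definition orbit_onto :: "(real^2 \<Rightarrow> real^2) \<Rightarrow> real \<Rightarrow> (real^2 \<Rightarrow> real^2) \<Rightarrow> real \<Rightarrow> (real^2 \<Rightarrow> real^2) \<Rightarrow> real^2 \<Rightarrow> bool" where
  "orbit_onto H s F s' F' p \<longleftrightarrow>
     (\<exists>\<alpha>. strict_mono \<alpha> \<and> surj \<alpha> \<and> \<alpha> 0 = 0 \<and>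
        (\<forall>t. flow F t p \<in> half s \<longleftrightarrow> flow F' (\<alpha> t) (H p) \<in> half s') \<and>
        (\<forall>t. flow F t p \<in> half s \<longrightarrow> H (flow F t p) = flow F' (\<alpha> t) (H p)))"

text \<open>Here \<kappa> is the factor, \<open>1\<close> or \<open>-1\<close> in the applications,
  by which the axis is stretched. Two half planes can be glued when they share it.\<close>

definition half_equiv :: "real \<Rightarrow> (real^2 \<Rightarrow> real^2) \<Rightarrow> real \<Rightarrow> (real^2 \<Rightarrow> real^2) \<Rightarrow> real \<Rightarrow> bool" where
  "half_equiv s F s' F' \<kappa> \<longleftrightarrow>
     (\<exists>H H'. homeomorphism (half s) (half s') H H' \<and> (\<forall>x. H (pt x 0) = pt (\<kappa> * x) 0) \<and>
        (\<forall>p\<in>half s. orbit_onto H s F s' F' p))"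

lemma node_normal_half_equiv:
  assumes "node_normal F m" "node_normal G n"
  shows "half_equiv 1 F 1 G 1"
proof -
  interpret F: node_normal F m by fact
  interpret G: node_normal G n by fact
  interpret FG: orbit_structure_pair F.orb G.orb ..
  interpret GF: orbit_structure_pair G.orb F.orb ..
  let ?H = "orbit_match F.orb G.orb" and ?H' = "orbit_match G.orb F.orb"
  have half: "half 1 = {p. p $ 2 \<ge> 0}" by (simp add: half_def)
  have "homeomorphism (half 1) (half 1) ?H ?H'"
    unfolding half homeomorphism_def
    using FG.match_upper GF.match_upper FG.match_continuous GF.match_continuous
    by (auto simp: image_iff) metis+
  moreover have "orbit_onto ?H 1 F 1 G p" if p: "p \<in> half 1" for p
  proof (cases "p = 0")
    case True
    then show ?thesis
      unfolding orbit_onto_def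
      by (intro exI[of _ "\<lambda>t. t"]) (auto simp: orbit_match_def half strict_mono_def)
  next
    case nz: False
    have up: "p $ 2 \<ge> 0" using p by (simp add: half)
    have nH: "norm (?H p) = norm p" using FG.match_upper(1)[OF up] .
    then have Hnz: "?H p \<noteq> 0" using nz by force
    \<comment> \<open>The image orbit is asked for the time at which it has the norm of
      \<open>flow F t p\<close>. Norms decrease in time along both orbits, so \<alpha> is
      increasing.\<close>
    define \<alpha> where "\<alpha> = (\<lambda>t. G.hit (?H p) (norm (flow F t p)))"
    have pos: "norm (flow F t p) > 0" for t using nz by simp
    have fG: "flow G (\<alpha> t) (?H p) = G.orb (?H p) (norm (flow F t p))" for t
      by (simp add: \<alpha>_def G.orb_def)
    have fF: "flow F t p = F.orb p (norm (flow F t p))" for t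
      using F.orb_norm_flow[OF nz] by simp
    have "strict_mono \<alpha>"
      by (rule strict_monoI) (simp add: \<alpha>_def G.hit_less[OF Hnz pos] F.norm_flow_less[OF _ nz])
    moreover have "surj \<alpha>"
    proof (rule surjI)
      fix u
      have l: "norm (flow G u (?H p)) > 0" using Hnz by simp
      have "norm (flow F (F.hit p (norm (flow G u (?H p)))) p) = norm (flow G u (?H p))"
        using F.norm_orb[OF nz l] by (simp add: F.orb_def)
      then show "\<alpha> (F.hit p (norm (flow G u (?H p)))) = u"
        unfolding \<alpha>_def by (simp add: G.hit_eqI[OF Hnz refl])
    qed
    moreover have "\<alpha> 0 = 0" unfolding \<alpha>_def by (rule G.hit_eqI[OF Hnz]) (simp add: nH)
    moreover have "flow F t p \<in> half 1 \<longleftrightarrow> flow G (\<alpha> t) (?H p) \<in> half 1" for t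
      using FG.match_orbit(1)[OF nz up pos, of t] unfolding fG fF[symmetric] by (simp add: half)
    moreover have "?H (flow F t p) = flow G (\<alpha> t) (?H p)" if "flow F t p \<in> half 1" for t
      using FG.match_orbit(2)[OF nz up pos, of t] that unfolding fG fF[symmetric] by (simp add: half)
    ultimately show ?thesis unfolding orbit_onto_def by blast
  qed
  ultimately show ?thesis
    unfolding half_equiv_def using FG.match_axis by (intro exI[of _ ?H] exI[of _ ?H']) simp
qed

section \<open>Reduction to the normal form\<close>

text \<open>For \<open>\<bar>a\<bar> = 1\<close> this is a linear map that preserves the axis and
  acts on it as \<open>x\<close> to \<open>a * x\<close>, so that the parametrisation of the axis
  survives up to a sign. The sign of \<open>c\<close> decides whether the half planes are
  interchanged. The formula of \<open>unshear\<close> uses that \<open>a\<close> is its own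
  inverse.\<close>

definition shear :: "real \<Rightarrow> real \<Rightarrow> real \<Rightarrow> real^2 \<Rightarrow> real^2" where
  "shear a b c p = pt (a * (p $ 1 + b * p $ 2)) (c * p $ 2)"

definition unshear :: "real \<Rightarrow> real \<Rightarrow> real \<Rightarrow> real^2 \<Rightarrow> real^2" where
  "unshear a b c q = pt (a * q $ 1 - b / c * q $ 2) (q $ 2 / c)"

text \<open>
  The factor \<open>\<delta> = \<plusminus>1\<close> allows for a reversal of time.
\<close>

definition pull :: "real \<Rightarrow> real \<Rightarrow> real \<Rightarrow> real \<Rightarrow> (real^2 \<Rightarrow> real^2) \<Rightarrow> real^2 \<Rightarrow> real^2" where
  "pull \<delta> a b c F p = \<delta> *\<^sub>R unshear a b c (F (shear a b c p))"

lemma shear_bounded_linear: "bounded_linear (shear a b c)"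
  unfolding linear_conv_bounded_linear[symmetric]
  by (rule linearI) (auto simp: shear_def vec_eq_iff forall_2 algebra_simps)

lemma unshear_bounded_linear: "bounded_linear (unshear a b c)"
  unfolding linear_conv_bounded_linear[symmetric]
  by (rule linearI) (auto simp: unshear_def vec_eq_iff forall_2 algebra_simps add_divide_distrib)

locale shear_data =
  fixes \<delta> a c :: real
  assumes \<delta>: "\<bar>\<delta>\<bar> = 1" and a: "\<bar>a\<bar> = 1" and c: "c \<noteq> 0"
begin

lemma aa: "a * a = 1" "a * (a * x) = x" and \<delta>\<delta>: "\<delta> * \<delta> = 1" "\<delta> * (\<delta> * x) = x"
proof -
  show "a * a = 1" "\<delta> * \<delta> = 1" using a \<delta> by (auto simp: abs_if split: if_splits)
  then show "a * (a * x) = x" "\<delta> * (\<delta> * x) = x" by (simp_all flip: mult.assoc)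
qed

lemma unshear_shear [simp]: "unshear a b c (shear a b c p) = p"
  using c by (simp add: unshear_def shear_def vec_eq_iff forall_2 aa)

lemma shear_unshear [simp]: "shear a b c (unshear a b c q) = q"
  using c by (simp add: unshear_def shear_def vec_eq_iff forall_2 aa)

lemma shear_axis: "shear a b c (pt x 0) = pt (a * x) 0"
  and unshear_axis: "unshear a b c (pt x 0) = pt (a * x) 0"
  by (simp_all add: shear_def unshear_def)

lemma shear_half: "shear a b c p \<in> half 1 \<longleftrightarrow> p \<in> half (sgn c)"
  using c by (auto simp: shear_def half_def sgn_if zero_le_mult_iff)

lemma unshear_half: "unshear a b c q \<in> half (sgn c) \<longleftrightarrow> q \<in> half 1"
  using shear_half[of b "unshear a b c q"] by simp

lemma pull_lipschitz_field:
  assumes "lipschitz_field F"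
  shows "lipschitz_field (pull \<delta> a b c F)"
proof
  interpret lipschitz_field F by fact
  interpret S: bounded_linear "shear a b c" by (rule shear_bounded_linear)
  interpret U: bounded_linear "unshear a b c" by (rule unshear_bounded_linear)
  obtain K where K: "K-lipschitz_on UNIV F" using lipschitz by blast
  have K0: "K \<ge> 0" using K by (rule lipschitz_on_nonneg)
  obtain s where s: "s > 0" "\<And>x. norm (shear a b c x) \<le> norm x * s" using S.pos_bounded by blast
  obtain u where u: "u > 0" "\<And>x. norm (unshear a b c x) \<le> norm x * u" using U.pos_bounded by blast
  have "(K * s * u)-lipschitz_on UNIV (pull \<delta> a b c F)"
  proof (rule lipschitz_onI)
    fix x y
    have "dist (pull \<delta> a b c F x) (pull \<delta> a b c F y) = norm (unshear a b c (F (shear a b c x) - F (shear a b c y)))"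
      using \<delta> by (simp add: dist_norm pull_def U.diff flip: scaleR_diff_right)
    also have "\<dots> \<le> norm (F (shear a b c x) - F (shear a b c y)) * u" by (rule u)
    also have "\<dots> \<le> (K * norm (shear a b c (x - y))) * u"
      using lipschitz_onD[OF K, of "shear a b c x" "shear a b c y"] u(1)
      by (intro mult_right_mono) (auto simp: dist_norm S.diff)
    also have "\<dots> \<le> (K * (norm (x - y) * s)) * u"
      using s u(1) K0 by (intro mult_right_mono mult_left_mono) auto
    finally show "dist (pull \<delta> a b c F x) (pull \<delta> a b c F y) \<le> K * s * u * dist x y"
      by (simp add: dist_norm mult_ac)
  qed (use K0 s u in auto)
  then show "\<exists>K. K-lipschitz_on UNIV (pull \<delta> a b c F)" by blast
  show "pull \<delta> a b c F 0 = 0" by (simp add: pull_def S.zero U.zero)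
qed

lemma flow_pull:
  assumes "lipschitz_field F"
  shows "flow (pull \<delta> a b c F) t p = unshear a b c (flow F (\<delta> * t) (shear a b c p))"
proof -
  interpret F: lipschitz_field F by fact
  interpret G: lipschitz_field "pull \<delta> a b c F" by (rule pull_lipschitz_field[OF assms])
  let ?\<psi> = "\<lambda>t. unshear a b c (flow F (\<delta> * t) (shear a b c p))"
  have "(?\<psi> has_vector_derivative pull \<delta> a b c F (?\<psi> t)) (at t)" for t
  proof -
    have "((\<lambda>t. \<delta> * t) has_vector_derivative \<delta>) (at t)" by (auto intro!: derivative_eq_intros)
    from vector_diff_chain_at[OF this F.flow_deriv[of "shear a b c p" "\<delta> * t"]]
    have "((\<lambda>t. flow F (\<delta> * t) (shear a b c p)) has_vector_derivative \<delta> *\<^sub>R F (flow F (\<delta> * t) (shear a b c p))) (at t)"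
      by (simp add: o_def)
    from bounded_linear.has_vector_derivative[OF unshear_bounded_linear this, of a b c]
    show ?thesis
      by (simp add: pull_def linear_cmul[OF bounded_linear.linear[OF unshear_bounded_linear]])
  qed
  from G.flow_unique_UNIV[of ?\<psi>, OF this, of t 0]
  show ?thesis by (simp add: F.flow_0)
qed

end

text \<open>Both fields are pulled back with the same \<delta>; the change of time is conjugated to
  \<open>\<delta> * \<alpha> (\<delta> * t)\<close>, which is increasing because \<delta> enters
  twice. On the axis the two changes of coordinates multiply to \<open>a * a'\<close>.\<close>

lemma half_equiv_pull:
  assumes F: "lipschitz_field F" and G: "lipschitz_field G" and eq: "half_equiv 1 F 1 G 1"
    and S: "shear_data \<delta> a c" and S': "shear_data \<delta> a' c'"
  shows "half_equiv (sgn c) (pull \<delta> a b c F) (sgn c') (pull \<delta> a' b' c' G) (a * a')"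
proof -
  interpret S: shear_data \<delta> a c by fact
  interpret S': shear_data \<delta> a' c' by fact
  let ?S = "shear a b c" and ?U = "unshear a b c" and ?T = "shear a' b' c'" and ?V = "unshear a' b' c'"
  obtain H H' where hom: "homeomorphism (half 1) (half 1) H H'" and ax: "\<And>x. H (pt x 0) = pt x 0"
    and \<alpha>: "\<And>p. p \<in> half 1 \<Longrightarrow> orbit_onto H 1 F 1 G p"
    using eq unfolding half_equiv_def by auto
  have h1: "homeomorphism (half (sgn c)) (half 1) ?S ?U"
    using S.shear_half S.unshear_half
    by (auto intro!: homeomorphismI linear_continuous_on shear_bounded_linear unshear_bounded_linear)
  have h2: "homeomorphism (half 1) (half (sgn c')) ?V ?T"
    using S'.shear_half S'.unshear_half
    by (auto intro!: homeomorphismI linear_continuous_on shear_bounded_linear unshear_bounded_linear)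
  have "homeomorphism (half (sgn c)) (half (sgn c')) (?V \<circ> (H \<circ> ?S)) ((?U \<circ> H') \<circ> ?T)"
    by (intro homeomorphism_compose[OF homeomorphism_compose[OF h1 hom] h2])
  moreover have "(?V \<circ> (H \<circ> ?S)) (pt x 0) = pt (a * a' * x) 0" for x
    by (simp add: S.shear_axis S'.unshear_axis ax mult_ac)
  moreover have "orbit_onto (?V \<circ> (H \<circ> ?S)) (sgn c) (pull \<delta> a b c F) (sgn c') (pull \<delta> a' b' c' G) p"
    if p: "p \<in> half (sgn c)" for p
  proof -
    obtain \<alpha> where al: "strict_mono \<alpha>" "surj \<alpha>" "\<alpha> 0 = 0"
      and al1: "\<And>t. flow F t (?S p) \<in> half 1 \<longleftrightarrow> flow G (\<alpha> t) (H (?S p)) \<in> half 1"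
      and al2: "\<And>t. flow F t (?S p) \<in> half 1 \<Longrightarrow> H (flow F t (?S p)) = flow G (\<alpha> t) (H (?S p))"
      using \<alpha>[of "?S p"] p S.shear_half unfolding orbit_onto_def by blast
    define \<beta> where "\<beta> = (\<lambda>t. \<delta> * \<alpha> (\<delta> * t))"
    have fl: "flow (pull \<delta> a' b' c' G) (\<beta> t) ((?V \<circ> (H \<circ> ?S)) p) = ?V (flow G (\<alpha> (\<delta> * t)) (H (?S p)))" for t
      by (simp add: S'.flow_pull[OF G] \<beta>_def S.\<delta>\<delta>)
    have "strict_mono \<beta>"
    proof (rule strict_monoI)
      fix s t :: real assume "s < t"
      then show "\<beta> s < \<beta> t"
        using strict_monoD[OF al(1), of s t] strict_monoD[OF al(1), of "-t" "-s"] S.\<delta>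
        by (auto simp: \<beta>_def abs_if split: if_splits)
    qed
    moreover have "surj \<beta>"
    proof (rule surjI)
      fix u
      have "\<alpha> (inv \<alpha> (\<delta> * u)) = \<delta> * u" using al(2) by (rule surj_f_inv_f)
      then show "\<beta> (\<delta> * inv \<alpha> (\<delta> * u)) = u" by (simp add: \<beta>_def S.\<delta>\<delta>)
    qed
    moreover have "\<beta> 0 = 0" by (simp add: \<beta>_def al)
    ultimately show ?thesis
      unfolding orbit_onto_def
      by (intro exI[of _ \<beta>]) (simp add: fl[simplified] S.flow_pull[OF F] S.unshear_half S'.unshear_half al1 al2)
  qed
  ultimately show ?thesis unfolding half_equiv_def by blast
qed

text \<open>The factor \<open>\<delta> * a * sgn c\<close> is the direction in which the pulled
  field crosses the positive half axis. Choosing \<open>a\<close> accordingly later gives it the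
  value \<kappa> of the original field.\<close>

lemma pull_axis_sign:
  assumes S: "shear_data \<delta> a c" and F: "node_normal F m" and x: "x \<noteq> 0"
  shows "\<delta> * a * sgn c * x * pull \<delta> a b c F (pt x 0) $ 2 > 0"
    and "t \<noteq> 0 \<Longrightarrow> \<delta> * a * sgn c * x * t * flow (pull \<delta> a b c F) t (pt x 0) $ 2 > 0"
proof -
  interpret S: shear_data \<delta> a c by fact
  interpret F: node_normal F m by fact
  have L: "lipschitz_field F" ..
  have ax: "a * x \<noteq> 0" using x S.a by auto
  have p: "u > 0 \<Longrightarrow> u / \<bar>c\<bar> > 0" for u using S.c by simp
  have sc: "sgn c * (u / c) = u / \<bar>c\<bar>" for u using S.c by (simp add: sgn_if abs_if)
  have "\<delta> * a * sgn c * x * pull \<delta> a b c F (pt x 0) $ 2 = (\<delta> * \<delta>) * ((a * x) * (sgn c * (F (pt (a * x) 0) $ 2 / c)))"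
    by (simp add: pull_def S.shear_axis unshear_def mult_ac)
  also have "\<dots> = (a * x * F (pt (a * x) 0) $ 2) / \<bar>c\<bar>" unfolding sc S.\<delta>\<delta> by simp
  also have "\<dots> > 0" by (rule p) (rule F.axis[OF ax])
  finally show "\<delta> * a * sgn c * x * pull \<delta> a b c F (pt x 0) $ 2 > 0" .
  assume t: "t \<noteq> 0"
  have \<delta>t: "\<delta> * t \<noteq> 0" using t S.\<delta> by auto
  have "\<delta> * a * sgn c * x * t * flow (pull \<delta> a b c F) t (pt x 0) $ 2
      = (a * x) * (\<delta> * t) * (sgn c * (flow F (\<delta> * t) (pt (a * x) 0) $ 2 / c))"
    by (simp add: S.flow_pull[OF L] S.shear_axis unshear_def mult_ac)
  also have "\<dots> = ((a * x) * (\<delta> * t) * flow F (\<delta> * t) (pt (a * x) 0) $ 2) / \<bar>c\<bar>" unfolding sc by simp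
  also have "\<dots> > 0" by (rule p) (rule F.flow_axis_sign[OF ax \<delta>t])
  finally show "\<delta> * a * sgn c * x * t * flow (pull \<delta> a b c F) t (pt x 0) $ 2 > 0" .
qed

section \<open>The linear normal form and its small perturbations\<close>

definition sym_linear :: "real \<Rightarrow> real \<Rightarrow> real^2 \<Rightarrow> real^2" where
  "sym_linear \<mu> \<nu> p = pt (- \<mu> * p $ 1 + \<nu> * p $ 2) (\<nu> * p $ 1 - \<mu> * p $ 2)"

lemma sym_linear_bounded_linear: "bounded_linear (sym_linear \<mu> \<nu>)"
  unfolding linear_conv_bounded_linear[symmetric]
  by (rule linearI) (auto simp: sym_linear_def vec_eq_iff forall_2 algebra_simps)

lemma vec2_inner: "p \<bullet> q = p $ 1 * q $ 1 + p $ 2 * q $ 2" for p q :: "real^2"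
  by (simp add: inner_vec_def sum_2)

lemma norm_vec2_sq: "norm p ^ 2 = (p $ 1)\<^sup>2 + (p $ 2)\<^sup>2" for p :: "real^2"
  by (simp add: norm_vec2)

text \<open>The linear part has eigenvalues \<open>- \<mu> + \<nu>\<close> on \<open>(1, 1)\<close>
  and \<open>- \<mu> - \<nu>\<close> on \<open>(1, -1)\<close>. The bound
  \<open>(\<mu> - \<nu>) / 2\<close> gives up half of its rate of decay. The bound
  \<open>\<nu> / 4\<close> is enough on the axis, where the main term is
  \<open>\<nu> * x\<^sup>2\<close>, and on the rays, where the main term is at least
  \<open>3/4 * \<nu> * y\<^sup>2\<close> and the error at most
  \<open>9/16 * \<nu> * y\<^sup>2\<close>.\<close>

lemma node_normal_perturbation:
  assumes \<nu>: "0 < \<nu>" "\<nu> < \<mu>" and R: "\<exists>K. K-lipschitz_on UNIV R"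
    and small: "\<And>p. norm (R p) \<le> min (\<nu> / 4) ((\<mu> - \<nu>) / 2) * norm p"
  shows "node_normal (\<lambda>p. sym_linear \<mu> \<nu> p + R p) ((\<mu> - \<nu>) / 2)"
proof
  interpret L: bounded_linear "sym_linear \<mu> \<nu>" by (rule sym_linear_bounded_linear)
  have R1: "norm (R p) \<le> \<nu> / 4 * norm p" and R2: "norm (R p) \<le> (\<mu> - \<nu>) / 2 * norm p" for p
    by (rule order_trans[OF small], rule mult_right_mono, rule min.cobounded1, simp)
      (rule order_trans[OF small], rule mult_right_mono, rule min.cobounded2, simp)
  have Rc: "\<bar>R p $ i\<bar> \<le> \<nu> / 4 * norm p" for p i
    using component_le_norm_cart[of "R p" i] R1[of p] by linarith
  show "\<exists>K. K-lipschitz_on UNIV (\<lambda>p. sym_linear \<mu> \<nu> p + R p)"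
  proof -
    obtain K where "K-lipschitz_on UNIV R" using R by blast
    moreover obtain B where B: "B > 0" "\<And>x. norm (sym_linear \<mu> \<nu> x) \<le> norm x * B" using L.pos_bounded by blast
    moreover have "B-lipschitz_on UNIV (sym_linear \<mu> \<nu>)"
    proof (rule lipschitz_onI)
      show "dist (sym_linear \<mu> \<nu> x) (sym_linear \<mu> \<nu> y) \<le> B * dist x y" for x y
        using B(2)[of "x - y"] by (simp add: dist_norm L.diff mult.commute)
    qed (use B in simp)
    ultimately show ?thesis using lipschitz_on_add by blast
  qed
  show "sym_linear \<mu> \<nu> 0 + R 0 = 0" using R1[of 0] by (simp add: L.zero)
  show "(\<mu> - \<nu>) / 2 > 0" using \<nu> by simp
  show "p \<bullet> (sym_linear \<mu> \<nu> p + R p) \<le> - ((\<mu> - \<nu>) / 2) * norm p ^ 2" for p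
  proof -
    have "p \<bullet> sym_linear \<mu> \<nu> p = - (\<mu> - \<nu>) * norm p ^ 2 - \<nu> * (p $ 1 - p $ 2)\<^sup>2"
      unfolding norm_vec2_sq by (simp add: vec2_inner sym_linear_def power2_eq_square algebra_simps)
    also have "\<dots> \<le> - (\<mu> - \<nu>) * norm p ^ 2" using \<nu> by simp
    finally have 1: "p \<bullet> sym_linear \<mu> \<nu> p \<le> - (\<mu> - \<nu>) * norm p ^ 2" .
    have "p \<bullet> R p \<le> norm p * norm (R p)" by (rule norm_cauchy_schwarz)
    also have "\<dots> \<le> norm p * ((\<mu> - \<nu>) / 2 * norm p)" by (intro mult_left_mono R2) simp
    finally have 2: "p \<bullet> R p \<le> (\<mu> - \<nu>) / 2 * norm p ^ 2" by (simp add: power2_eq_square mult_ac)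
    have "- (\<mu> - \<nu>) * norm p ^ 2 + (\<mu> - \<nu>) / 2 * norm p ^ 2 = - ((\<mu> - \<nu>) / 2) * norm p ^ 2"
      by (simp add: field_simps)
    with 1 2 show ?thesis unfolding inner_add_right by linarith
  qed
  show "x * (sym_linear \<mu> \<nu> (pt x 0) + R (pt x 0)) $ 2 > 0" if x: "x \<noteq> 0" for x
  proof -
    have "\<bar>x * R (pt x 0) $ 2\<bar> \<le> \<bar>x\<bar> * (\<nu> / 4 * \<bar>x\<bar>)"
      unfolding abs_mult using Rc[of "pt x 0" 2] by (intro mult_left_mono) auto
    also have "\<dots> = \<nu> / 4 * x\<^sup>2" by (simp add: power2_eq_square)
    finally have "\<bar>x * R (pt x 0) $ 2\<bar> \<le> \<nu> / 4 * x\<^sup>2" .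
    moreover have "\<nu> / 4 * x\<^sup>2 < \<nu> * x\<^sup>2" using \<nu> x by simp
    moreover have "x * (sym_linear \<mu> \<nu> (pt x 0) + R (pt x 0)) $ 2 = \<nu> * x\<^sup>2 + x * R (pt x 0) $ 2"
      by (simp add: sym_linear_def power2_eq_square algebra_simps)
    ultimately show ?thesis by linarith
  qed
  show "y * ((sym_linear \<mu> \<nu> (pt (s * y) y) + R (pt (s * y) y)) $ 1 -
             s * (sym_linear \<mu> \<nu> (pt (s * y) y) + R (pt (s * y) y)) $ 2) > 0"
    if s: "s \<in> {0, 1/2}" and y: "y \<noteq> 0" for s y
  proof -
    let ?p = "pt (s * y) y"
    have s': "0 \<le> s" "s \<le> 1/2" using s by auto
    then have s2: "s\<^sup>2 \<le> 1/4" using power_mono[of s "1/2" 2] by (simp add: power_divide)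
    have "norm ?p \<le> \<bar>s * y\<bar> + \<bar>y\<bar>" using norm_le_l1_cart[of ?p] by (simp add: sum_2)
    also have "\<dots> \<le> 1/2 * \<bar>y\<bar> + \<bar>y\<bar>" using s' mult_right_mono[of s "1/2" "\<bar>y\<bar>"] by (simp only: abs_mult abs_of_nonneg) simp
    finally have np: "norm ?p \<le> 3/2 * \<bar>y\<bar>" by simp
    have Ri: "\<bar>R ?p $ i\<bar> \<le> 3/8 * \<nu> * \<bar>y\<bar>" for i
    proof -
      have "\<bar>R ?p $ i\<bar> \<le> \<nu> / 4 * norm ?p" by (rule Rc)
      also have "\<dots> \<le> \<nu> / 4 * (3/2 * \<bar>y\<bar>)" using \<nu> by (intro mult_left_mono np) auto
      finally show ?thesis by simp
    qed
    have "\<bar>s * R ?p $ 2\<bar> \<le> 1/2 * \<bar>R ?p $ 2\<bar>" unfolding abs_mult using s' by (intro mult_right_mono) auto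
    then have "\<bar>R ?p $ 1 - s * R ?p $ 2\<bar> \<le> 9/16 * \<nu> * \<bar>y\<bar>" 
      using Ri[of 1] Ri[of 2] abs_triangle_ineq4[of "R ?p $ 1" "s * R ?p $ 2"] by linarith
    then have "\<bar>y\<bar> * \<bar>R ?p $ 1 - s * R ?p $ 2\<bar> \<le> \<bar>y\<bar> * (9/16 * \<nu> * \<bar>y\<bar>)" by (rule mult_left_mono) simp
    also have "\<dots> = 9/16 * \<nu> * (\<bar>y\<bar> * \<bar>y\<bar>)" by (simp only: mult_ac)
    also have "\<bar>y\<bar> * \<bar>y\<bar> = y\<^sup>2" by (simp add: power2_eq_square)
    finally have 1: "\<bar>y * (R ?p $ 1 - s * R ?p $ 2)\<bar> \<le> 9/16 * \<nu> * y\<^sup>2" by (simp only: abs_mult)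
    have "\<nu> * y\<^sup>2 * (3/4) \<le> \<nu> * y\<^sup>2 * (1 - s\<^sup>2)" using s2 \<nu> by (intro mult_left_mono) auto
    moreover have "\<nu> * y\<^sup>2 > 0" using \<nu> y by simp
    moreover have "y * ((sym_linear \<mu> \<nu> ?p + R ?p) $ 1 - s * (sym_linear \<mu> \<nu> ?p + R ?p) $ 2)
        = \<nu> * y\<^sup>2 * (1 - s\<^sup>2) + y * (R ?p $ 1 - s * R ?p $ 2)"
      by (simp add: sym_linear_def power2_eq_square algebra_simps)
    ultimately show ?thesis using 1 by linarith
  qed
qed

text \<open>Only the nonlinear remainder is modified: it is composed with the projection onto a
  small ball. The projection is 1-Lipschitz and does not increase the norm, so the remainder becomes
  globally Lipschitz and stays small relative to \<open>norm p\<close>.\<close>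

lemma node_normal_extension:
  fixes X :: "real^2 \<Rightarrow> real^2"
  assumes \<nu>: "0 < \<nu>" "\<nu> < \<mu>" and X0: "X 0 = 0" and r: "r > 0" and lip: "K-lipschitz_on (cball 0 r) X"
    and der: "(X has_derivative sym_linear \<mu> \<nu>) (at 0)"
  obtains F m d where "node_normal F m" "d > 0" "\<And>p. norm p \<le> d \<Longrightarrow> F p = X p"
proof -
  interpret L: bounded_linear "sym_linear \<mu> \<nu>" by (rule sym_linear_bounded_linear)
  define e where "e = min (\<nu> / 4) ((\<mu> - \<nu>) / 2)"
  have e: "e > 0" using \<nu> by (simp add: e_def)
  obtain d0 where d0: "d0 > 0" "\<And>y. norm y < d0 \<Longrightarrow> norm (X y - sym_linear \<mu> \<nu> y) \<le> e * norm y"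
    using der[unfolded has_derivative_at_alt, THEN conjunct2, rule_format, OF e] X0 by auto
  define d where "d = min r (d0 / 2)"
  have d: "d > 0" "d \<le> r" "d < d0" using r d0 by (auto simp: d_def)
  define P where "P = closest_point (cball (0 :: real^2) d)"
  define R where "R = (\<lambda>p. X (P p) - sym_linear \<mu> \<nu> (P p))"
  have ne: "cball (0 :: real^2) d \<noteq> {}" using d by simp
  have P1: "dist (P p) (P q) \<le> dist p q" for p q
    unfolding P_def using ne by (intro closest_point_lipschitz) auto
  have Pin: "P p \<in> cball 0 d" for p unfolding P_def using ne by (intro closest_point_in_set) auto
  have Pid: "norm p \<le> d \<Longrightarrow> P p = p" for p unfolding P_def by (rule closest_point_self) simp
  have Pn: "norm (P p) \<le> norm p" for p using P1[of p 0] Pid[of 0] d by simp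
  obtain B where B: "B > 0" "\<And>x. norm (sym_linear \<mu> \<nu> x) \<le> norm x * B" using L.pos_bounded by blast
  have K0: "K \<ge> 0" using lip by (rule lipschitz_on_nonneg)
  have "(K + B)-lipschitz_on UNIV R"
  proof (rule lipschitz_onI)
    fix p q
    have "dist (R p) (R q) = norm ((X (P p) - X (P q)) - sym_linear \<mu> \<nu> (P p - P q))"
      by (simp add: R_def dist_norm L.diff algebra_simps)
    also have "\<dots> \<le> norm (X (P p) - X (P q)) + norm (sym_linear \<mu> \<nu> (P p - P q))" by (rule norm_triangle_ineq4)
    also have "\<dots> \<le> K * dist (P p) (P q) + dist (P p) (P q) * B"
    proof (rule add_mono)
      have "P p \<in> cball 0 r" "P q \<in> cball 0 r" using Pin[of p] Pin[of q] d by auto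
      from lipschitz_onD[OF lip this] show "norm (X (P p) - X (P q)) \<le> K * dist (P p) (P q)" by (simp add: dist_norm)
      show "norm (sym_linear \<mu> \<nu> (P p - P q)) \<le> dist (P p) (P q) * B" using B(2)[of "P p - P q"] by (simp add: dist_norm)
    qed
    also have "\<dots> = (K + B) * dist (P p) (P q)" by (simp add: algebra_simps)
    also have "\<dots> \<le> (K + B) * dist p q" using K0 B by (intro mult_left_mono P1) auto
    finally show "dist (R p) (R q) \<le> (K + B) * dist p q" .
  qed (use K0 B in auto)
  moreover have "norm (R p) \<le> min (\<nu> / 4) ((\<mu> - \<nu>) / 2) * norm p" for p
  proof -
    have "norm (R p) \<le> e * norm (P p)" unfolding R_def using Pin[of p] d by (intro d0) auto
    also have "\<dots> \<le> e * norm p" using e Pn by (intro mult_left_mono) auto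
    finally show ?thesis by (simp add: e_def)
  qed
  ultimately have "node_normal (\<lambda>p. sym_linear \<mu> \<nu> p + R p) ((\<mu> - \<nu>) / 2)"
    by (intro node_normal_perturbation \<nu>) auto
  then show ?thesis by (rule that[OF _ d(1)]) (simp add: R_def Pid)
qed

lemma C1_vfield_lipschitz:
  assumes C1: "C1_vfield W X" and W: "open W" "p \<in> W"
  obtains r K where "r > 0" "K-lipschitz_on (cball p r) X"
proof -
  obtain r where r: "r > 0" "cball p r \<subseteq> W" using W open_contains_cball by blast
  have der: "(X has_derivative (*v) (jacobian X (at q))) (at q)" if "q \<in> W" for q
    using C1 that jacobian_works[of X "at q"] by (auto simp: C1_vfield_def)
  have "continuous_on (cball p r) (\<lambda>q. jacobian X (at q))"
    using C1 r by (auto simp: C1_vfield_def intro: continuous_on_subset)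
  then have "bounded ((\<lambda>q. jacobian X (at q)) ` cball p r)"
    by (intro compact_imp_bounded compact_continuous_image) auto
  then obtain B where "\<forall>J\<in>(\<lambda>q. jacobian X (at q)) ` cball p r. norm J \<le> B"
    unfolding bounded_iff by blast
  then have B: "\<And>q. q \<in> cball p r \<Longrightarrow> norm (jacobian X (at q)) \<le> B" by blast
  \<comment> \<open>The factor 4 counts the entries of the matrix, each of which is bounded by
    \<open>B\<close>.\<close>
  have on: "onorm ((*v) (jacobian X (at q))) \<le> 4 * B" if "q \<in> cball p r" for q
  proof -
    have "\<bar>jacobian X (at q) $ i $ j\<bar> \<le> B" for i j
    proof -
      have "\<bar>jacobian X (at q) $ i $ j\<bar> \<le> norm (jacobian X (at q) $ i)" by (rule component_le_norm_cart)
      also have "\<dots> \<le> norm (jacobian X (at q))" by (rule Finite_Cartesian_Product.norm_nth_le)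
      finally show ?thesis using B[OF that] by simp
    qed
    from onorm_le_matrix_component[OF this] show ?thesis by simp
  qed
  have "norm (jacobian X (at p)) \<le> B" using B[of p] r by simp
  then have B0: "B \<ge> 0" using norm_ge_zero order_trans by blast
  have "(4 * B)-lipschitz_on (cball p r) X"
  proof (rule lipschitz_onI)
    fix x y assume xy: "x \<in> cball p r" "y \<in> cball p r"
    show "dist (X x) (X y) \<le> 4 * B * dist x y"
      unfolding dist_norm
    proof (rule differentiable_bound[OF convex_cball _ on xy])
      show "(X has_derivative (*v) (jacobian X (at q))) (at q within cball p r)" if "q \<in> cball p r" for q
        using der r that by (blast intro: has_derivative_at_withinI)
    qed
  qed (use B0 in simp)
  then show ?thesis using that r(1) by blast
qed

text \<open>\<open>det\<close> and \<open>disc\<close> describe a node with distinct real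
  eigenvalues. A repelling one is turned into an attracting one by \<open>\<delta> = -1\<close>. The
  half plane \<open>s\<close> is to become the upper one, which fixes the sign of \<open>c\<close>;
  the sign of \<open>a\<close> is then forced by the lower left entry
  \<open>\<delta> * a * c * A $ 2 $ 1\<close>, which has to be the positive number \<nu>.\<close>

lemma node_normal_form:
  fixes A :: "real^2^2"
  assumes C1: "C1_vfield W X" and W: "open W" "0 \<in> W" and X0: "X 0 = 0"
    and A_def: "A = jacobian X (at 0)"
    and det: "det A > 0" and disc: "(A $ 1 $ 1 + A $ 2 $ 2)\<^sup>2 > 4 * det A" and A21: "A $ 2 $ 1 \<noteq> 0" and s: "\<bar>s\<bar> = 1"
    and \<delta>: "\<delta> = - sgn (A $ 1 $ 1 + A $ 2 $ 2)" and a: "a = \<delta> * s * sgn (A $ 2 $ 1)"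
  obtains b c F m d where "shear_data \<delta> a c" "sgn c = s" "node_normal F m" "d > 0"
    "\<And>p. norm p \<le> d \<Longrightarrow> X p = pull \<delta> a b c F p"
proof -
  \<comment> \<open>In the new coordinates \<open>b\<close> makes the two diagonal entries equal and \<open>c\<close> makes the matrix
    symmetric.\<close>
  define tr where "tr = A $ 1 $ 1 + A $ 2 $ 2"
  define \<mu> where "\<mu> = \<bar>tr\<bar> / 2"
  define \<nu> where "\<nu> = sqrt (tr\<^sup>2 - 4 * det A) / 2"
  define b where "b = (A $ 2 $ 2 - A $ 1 $ 1) / (2 * A $ 2 $ 1)"
  define c where "c = s * \<nu> / \<bar>A $ 2 $ 1\<bar>"
  have tr: "tr \<noteq> 0" using det disc by (auto simp: tr_def)
  have \<nu>: "\<nu> > 0" using disc by (simp add: \<nu>_def tr_def)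
  have "sqrt (tr\<^sup>2 - 4 * det A) < sqrt (tr\<^sup>2)" using det by (intro real_sqrt_less_mono) simp
  then have \<nu>\<mu>: "\<nu> < \<mu>" by (simp add: \<nu>_def \<mu>_def)
  have \<nu>2: "4 * \<nu>\<^sup>2 = (A $ 2 $ 2 - A $ 1 $ 1)\<^sup>2 + 4 * A $ 1 $ 2 * A $ 2 $ 1"
  proof -
    have "4 * \<nu>\<^sup>2 = tr\<^sup>2 - 4 * det A" using disc by (simp add: \<nu>_def tr_def power_divide)
    then show ?thesis by (simp add: tr_def det_2 power2_eq_square algebra_simps)
  qed
  have d1: "\<bar>\<delta>\<bar> = 1" using tr \<delta> by (simp add: tr_def abs_sgn_eq)
  have a1: "\<bar>a\<bar> = 1" using A21 a s d1 by (simp add: abs_mult abs_sgn_eq)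
  have c0: "c \<noteq> 0" using s \<nu> A21 by (auto simp: c_def)
  have sc: "sgn c = s"
  proof -
    have "sgn (\<nu> / \<bar>A $ 2 $ 1\<bar>) = 1" using \<nu> A21 by simp
    moreover have "sgn s = s" using s by (auto simp: abs_if split: if_splits)
    moreover have "c = s * (\<nu> / \<bar>A $ 2 $ 1\<bar>)" by (simp add: c_def)
    ultimately show ?thesis by (simp only: sgn_mult mult_1_right)
  qed
  interpret S: shear_data \<delta> a c using d1 a1 c0 by unfold_locales
  have ac: "\<delta> * a * c * A $ 2 $ 1 = \<nu>"
  proof -
    have "\<delta> * a * c * A $ 2 $ 1 = (\<delta> * \<delta>) * (s * s) * \<nu> * (sgn (A $ 2 $ 1) * A $ 2 $ 1 / \<bar>A $ 2 $ 1\<bar>)"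
      by (simp add: a c_def)
    moreover have "s * s = 1" using s by (auto simp: abs_if split: if_splits)
    moreover have "sgn (A $ 2 $ 1) * A $ 2 $ 1 / \<bar>A $ 2 $ 1\<bar> = 1" using A21 by (simp add: sgn_if)
    ultimately show ?thesis by (simp add: S.\<delta>\<delta>)
  qed
  have \<delta>tr: "\<delta> * tr = - 2 * \<mu>" unfolding \<delta> \<mu>_def tr_def[symmetric] by (simp add: sgn_mult_self_eq abs_sgn[symmetric] mult.commute)
  have bA: "b * A $ 2 $ 1 = (A $ 2 $ 2 - A $ 1 $ 1) / 2" using A21 by (simp add: b_def)
  \<comment> \<open>Rescaling by \<open>c\<close> does not change the product of the off-diagonal
    entries. Since it is \<open>\<nu>\<^sup>2\<close> and the lower left entry is \<nu> by
    \<open>ac\<close>, the upper right one is \<nu> as well.\<close>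
  have "A $ 2 $ 1 * (A $ 1 $ 2 + b * (A $ 2 $ 2 - A $ 1 $ 1) - b * (b * A $ 2 $ 1)) = \<nu>\<^sup>2"
  proof -
    have "A $ 2 $ 1 * (A $ 1 $ 2 + b * (A $ 2 $ 2 - A $ 1 $ 1) - b * (b * A $ 2 $ 1))
      = A $ 2 $ 1 * A $ 1 $ 2 + (b * A $ 2 $ 1) * (A $ 2 $ 2 - A $ 1 $ 1) - (b * A $ 2 $ 1) * (b * A $ 2 $ 1)"
      by (simp add: algebra_simps)
    also have "\<dots> = \<nu>\<^sup>2" unfolding bA using \<nu>2 by (simp add: power2_eq_square field_simps)
    finally show ?thesis .
  qed
  then have up: "\<delta> * a / c * (A $ 1 $ 2 + b * (A $ 2 $ 2 - A $ 1 $ 1) - b * (b * A $ 2 $ 1)) = \<nu>" (is "_ * ?z = _")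
  proof -
    assume z: "A $ 2 $ 1 * ?z = \<nu>\<^sup>2"
    have "\<nu> * (\<delta> * a / c * ?z) = (\<delta> * a * c * A $ 2 $ 1) * (\<delta> * a / c * ?z)" unfolding ac ..
    also have "\<dots> = (\<delta> * \<delta>) * (a * a) * (A $ 2 $ 1 * ?z)" using c0 by (simp add: field_simps)
    also have "\<dots> = \<nu> * \<nu>" unfolding z S.\<delta>\<delta> S.aa by (simp add: power2_eq_square)
    finally show ?thesis by (rule mult_left_cancel[THEN iffD1, rotated]) (use \<nu> in simp)
  qed
  \<comment> \<open>\<open>Xh\<close> is \<open>X\<close> in the new coordinates and the new time,
    so that \<open>X\<close> is the \<open>pull\<close> of \<open>Xh\<close>.\<close>
  define Xh where "Xh = (\<lambda>q. \<delta> *\<^sub>R shear a b c (X (unshear a b c q)))"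
  interpret Sh: bounded_linear "shear a b c" by (rule shear_bounded_linear)
  interpret U: bounded_linear "unshear a b c" by (rule unshear_bounded_linear)
  have "X differentiable (at 0)" using C1 W by (simp add: C1_vfield_def)
  then have dX: "(X has_derivative (*v) A) (at (unshear a b c 0))"
    using jacobian_works[of X "at 0"] by (simp add: A_def U.zero)
  have "(Xh has_derivative (\<lambda>h. \<delta> *\<^sub>R shear a b c (A *v unshear a b c h))) (at 0)"
  proof -
    have "((\<lambda>q. X (unshear a b c q)) has_derivative (\<lambda>h. A *v unshear a b c h)) (at 0)"
      using diff_chain_at[OF bounded_linear_imp_has_derivative[OF unshear_bounded_linear] dX] by (simp add: o_def)
    then show ?thesis unfolding Xh_def by (intro has_derivative_scaleR_right Sh.has_derivative)
  qed
  moreover have "\<delta> *\<^sub>R shear a b c (A *v unshear a b c h) = sym_linear \<mu> \<nu> h" for h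
  proof -
    define u v where "u = h $ 1" and "v = h $ 2"
    have 2: "(\<delta> *\<^sub>R shear a b c (A *v unshear a b c h)) $ 2
        = (\<delta> * a * c * A $ 2 $ 1) * u + \<delta> * (A $ 2 $ 2 - b * A $ 2 $ 1) * v"
      using c0 by (simp add: shear_def unshear_def matrix_vector_mult_def sum_2 u_def v_def field_simps)
    have 1: "(\<delta> *\<^sub>R shear a b c (A *v unshear a b c h)) $ 1
        = (a * a) * \<delta> * (A $ 1 $ 1 + b * A $ 2 $ 1) * u
          + \<delta> * a / c * (A $ 1 $ 2 + b * (A $ 2 $ 2 - A $ 1 $ 1) - b * (b * A $ 2 $ 1)) * v"
      using c0 by (simp add: shear_def unshear_def matrix_vector_mult_def sum_2 u_def v_def field_simps)
    have e1: "\<delta> * (A $ 1 $ 1 + b * A $ 2 $ 1) = - \<mu>" and e2: "\<delta> * (A $ 2 $ 2 - b * A $ 2 $ 1) = - \<mu>"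
      unfolding bA using \<delta>tr by (simp_all add: tr_def field_simps)
    have "(\<delta> *\<^sub>R shear a b c (A *v unshear a b c h)) $ 1 = - \<mu> * u + \<nu> * v"
      unfolding 1 up S.aa using e1 by simp
    moreover have "(\<delta> *\<^sub>R shear a b c (A *v unshear a b c h)) $ 2 = \<nu> * u - \<mu> * v"
      unfolding 2 ac e2 by simp
    ultimately show ?thesis by (simp add: sym_linear_def pt_eq_iff u_def v_def)
  qed
  ultimately have dXh: "(Xh has_derivative sym_linear \<mu> \<nu>) (at 0)" by simp
  obtain r K where r: "r > 0" and K: "K-lipschitz_on (cball 0 r) X" using C1_vfield_lipschitz[OF C1 W] .
  have K0: "K \<ge> 0" using K by (rule lipschitz_on_nonneg)
  obtain B where B: "B > 0" "\<And>x. norm (shear a b c x) \<le> norm x * B" using Sh.pos_bounded by blast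
  obtain D where D: "D > 0" "\<And>x. norm (unshear a b c x) \<le> norm x * D" using U.pos_bounded by blast
  have "(K * D * B)-lipschitz_on (cball 0 (r / D)) Xh"
  proof (rule lipschitz_onI)
    fix x y :: "real^2" assume xy: "x \<in> cball 0 (r / D)" "y \<in> cball 0 (r / D)"
    have in_ball: "unshear a b c z \<in> cball 0 r" if "z \<in> cball 0 (r / D)" for z
    proof -
      have "norm (unshear a b c z) \<le> norm z * D" by (rule D)
      also have "\<dots> \<le> r / D * D" using that D by (intro mult_right_mono) auto
      finally show ?thesis using D by simp
    qed
    have "dist (Xh x) (Xh y) = norm (shear a b c (X (unshear a b c x) - X (unshear a b c y)))"
      using d1 by (simp add: Xh_def dist_norm Sh.diff flip: scaleR_diff_right)
    also have "\<dots> \<le> norm (X (unshear a b c x) - X (unshear a b c y)) * B" by (rule B)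
    also have "\<dots> \<le> (K * norm (unshear a b c (x - y))) * B"
      using lipschitz_onD[OF K in_ball[OF xy(1)] in_ball[OF xy(2)]] B(1)
      by (intro mult_right_mono) (auto simp: dist_norm U.diff)
    also have "\<dots> \<le> (K * (norm (x - y) * D)) * B"
      using D B(1) K0 by (intro mult_right_mono mult_left_mono) auto
    finally show "dist (Xh x) (Xh y) \<le> K * D * B * dist x y"
      by (simp add: dist_norm mult_ac)
  qed (use K0 B D in auto)
  moreover have "Xh 0 = 0" by (simp add: Xh_def U.zero X0 Sh.zero)
  ultimately obtain F m d where F: "node_normal F m" and d: "d > 0" "\<And>p. norm p \<le> d \<Longrightarrow> F p = Xh p"
    using node_normal_extension[OF \<nu> \<nu>\<mu> _ _ _ dXh, of "r / D" "K * D * B"] r D(1) by auto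
  show ?thesis
  proof (rule that[OF S.shear_data_axioms sc F])
    show "d / B > 0" using d B by simp
    fix p :: "real^2" assume p: "norm p \<le> d / B"
    have "norm (shear a b c p) \<le> norm p * B" by (rule B)
    also have "\<dots> \<le> d / B * B" using p B by (intro mult_right_mono) auto
    also have "\<dots> = d" using B by simp
    finally have "F (shear a b c p) = Xh (shear a b c p)" by (rule d(2))
    then show "X p = pull \<delta> a b c F p"
      by (simp add: pull_def Xh_def U.scaleR S.\<delta>\<delta>)
  qed
qed

section \<open>Trajectories of the piecewise smooth field\<close>

text \<open>On the line this leaves only rest at the origin. Hence a trajectory can be at any other
  point of the line only at its exceptional times.\<close>

definition moves :: "(real \<Rightarrow> real^2 \<Rightarrow> real^2) \<Rightarrow> (real \<Rightarrow> real^2) \<Rightarrow> real \<Rightarrow> bool" where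
  "moves FF \<phi> t \<longleftrightarrow>
     (\<phi> t $ 2 \<noteq> 0 \<and> (\<phi> has_vector_derivative FF (sgn (\<phi> t $ 2)) (\<phi> t)) (at t)) \<or>
     (\<phi> t = 0 \<and> (\<phi> has_vector_derivative 0) (at t))"

text \<open>This keeps of \<open>trajectory\<close> what uniqueness needs, without the domain and
  the intervals around the times. It passes to subintervals and to reversed time.\<close>

definition weak_trajectory :: "(real \<Rightarrow> real^2 \<Rightarrow> real^2) \<Rightarrow> real set \<Rightarrow> (real \<Rightarrow> real^2) \<Rightarrow> bool" where
  "weak_trajectory FF I \<phi> \<longleftrightarrow> is_interval I \<and> continuous_on I \<phi> \<and>
     (\<exists>T. (\<forall>a\<in>I. \<forall>b\<in>I. finite (T \<inter> {a..b})) \<and> (\<forall>t\<in>I - T. moves FF \<phi> t))"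

lemma weak_trajectory_subset:
  assumes "weak_trajectory FF I \<phi>" "J \<subseteq> I" "is_interval J"
  shows "weak_trajectory FF J \<phi>"
proof -
  obtain T where T: "\<And>a b. a \<in> I \<Longrightarrow> b \<in> I \<Longrightarrow> finite (T \<inter> {a..b})" "\<And>t. t \<in> I - T \<Longrightarrow> moves FF \<phi> t"
    using assms(1) by (auto simp: weak_trajectory_def)
  have "continuous_on J \<phi>" using assms by (auto simp: weak_trajectory_def intro: continuous_on_subset)
  moreover have "\<forall>a\<in>J. \<forall>b\<in>J. finite (T \<inter> {a..b})" "\<forall>t\<in>J - T. moves FF \<phi> t"
    using assms(2) T by blast+
  ultimately show ?thesis unfolding weak_trajectory_def using assms(3) by blast
qed

lemma moves_reverse:
  assumes "moves FF \<phi> (- t)"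
  shows "moves (\<lambda>s p. - FF s p) (\<lambda>t. \<phi> (- t)) t"
  using assms has_vector_derivative_uminus_arg[of \<phi> _ t] unfolding moves_def by fastforce

lemma weak_trajectory_reverse:
  assumes "weak_trajectory FF I \<phi>"
  shows "weak_trajectory (\<lambda>s p. - FF s p) (uminus ` I) (\<lambda>t. \<phi> (- t))"
proof -
  obtain T where T: "\<And>a b. a \<in> I \<Longrightarrow> b \<in> I \<Longrightarrow> finite (T \<inter> {a..b})" "\<And>t. t \<in> I - T \<Longrightarrow> moves FF \<phi> t"
    using assms by (auto simp: weak_trajectory_def)
  have I: "is_interval I" "continuous_on I \<phi>" using assms by (auto simp: weak_trajectory_def)
  have "finite (uminus ` T \<inter> {a..b})" if "a \<in> uminus ` I" "b \<in> uminus ` I" for a b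
  proof -
    have "uminus ` T \<inter> {a..b} = uminus ` (T \<inter> {- b..- a})" by force
    then show ?thesis using T(1)[of "- b" "- a"] that by auto
  qed
  moreover have "moves (\<lambda>s p. - FF s p) (\<lambda>t. \<phi> (- t)) t" if "t \<in> uminus ` I - uminus ` T" for t
  proof (rule moves_reverse, rule T(2))
    show "- t \<in> I - T" using that by (auto simp: image_iff)
  qed
  moreover have "is_interval (uminus ` I)"
    using I(1) by simp
  moreover have "continuous_on (uminus ` I) (\<lambda>t. \<phi> (- t))"
    by (rule continuous_on_compose2[OF I(2)]) (auto intro!: continuous_intros)
  ultimately show ?thesis unfolding weak_trajectory_def by (intro conjI exI[of _ "uminus ` T"]) auto
qed

lemma flow_reverse:
  assumes "lipschitz_field F"
  shows "lipschitz_field (\<lambda>p. - F p)" "flow (\<lambda>p. - F p) t p = flow F (- t) p"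
proof -
  interpret F: lipschitz_field F by fact
  obtain K where K: "K-lipschitz_on UNIV F" using F.lipschitz by blast
  have "K-lipschitz_on UNIV (\<lambda>p. - F p)" using K by (rule lipschitz_on_minus)
  then show L: "lipschitz_field (\<lambda>p. - F p)" by unfold_locales auto
  interpret G: lipschitz_field "\<lambda>p. - F p" by (rule L)
  have "((\<lambda>t. flow F (- t) p) has_vector_derivative - F (flow F (- t) p)) (at t)" for t
    by (rule has_vector_derivative_uminus_arg) (rule F.flow_deriv)
  from G.flow_unique_UNIV[of "\<lambda>t. flow F (- t) p", OF this, of t 0]
  show "flow (\<lambda>p. - F p) t p = flow F (- t) p" by simp
qed

text \<open>Continuous induction: the supremum of the times up to which the curves agree is reached
  by continuity, and \<open>step\<close> pushes it further unless it is \<open>b\<close>.\<close>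

lemma agree_forward:
  fixes \<phi> \<psi> :: "real \<Rightarrow> 'a::real_normed_vector"
  assumes "a \<le> b" and c: "continuous_on {a..b} \<phi>" "continuous_on {a..b} \<psi>" and a: "\<phi> a = \<psi> a"
    and step: "\<And>t. a \<le> t \<Longrightarrow> t < b \<Longrightarrow> \<phi> t = \<psi> t \<Longrightarrow> \<exists>b'>t. b' \<le> b \<and> (\<forall>s\<in>{t..b'}. \<phi> s = \<psi> s)"
  shows "\<phi> b = \<psi> b"
proof -
  define A where "A = {s \<in> {a..b}. \<forall>r\<in>{a..s}. \<phi> r = \<psi> r}"
  have aA: "a \<in> A" using assms(1) a by (simp add: A_def)
  have bdd: "bdd_above A" by (rule bdd_aboveI[of _ b]) (auto simp: A_def)
  define m where "m = Sup A"
  have am: "a \<le> m" unfolding m_def by (rule cSup_upper[OF aA bdd])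
  have mb: "m \<le> b" unfolding m_def by (rule cSup_least) (use aA in \<open>auto simp: A_def\<close>)
  have below: "\<phi> r = \<psi> r" if "a \<le> r" "r < m" for r
  proof -
    have "A \<noteq> {}" "r < Sup A" using aA that by (auto simp: m_def)
    from less_cSupD[OF this] obtain s where "s \<in> A" "r < s" by blast
    then show ?thesis using that by (simp add: A_def)
  qed
  have at_m: "\<phi> m = \<psi> m"
  proof (cases "m = a")
    case False
    have "closed {s \<in> {a..b}. \<phi> s - \<psi> s = 0}"
      by (rule continuous_closed_preimage_constant[OF continuous_on_diff[OF c] closed_atLeastAtMost])
    moreover have "{a..<m} \<subseteq> {s \<in> {a..b}. \<phi> s - \<psi> s = 0}"
    proof
      fix s assume "s \<in> {a..<m}"
      then show "s \<in> {s \<in> {a..b}. \<phi> s - \<psi> s = 0}" using below[of s] mb by simp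
    qed
    ultimately have "closure {a..<m} \<subseteq> {s \<in> {a..b}. \<phi> s - \<psi> s = 0}" by (intro closure_minimal)
    moreover have "m \<in> closure {a..<m}" using am False by (simp add: closure_atLeastLessThan)
    ultimately show ?thesis by auto
  next
    case True
    then show ?thesis using a by simp
  qed
  have "m = b"
  proof (rule ccontr)
    assume "m \<noteq> b"
    then have "m < b" using mb by simp
    from step[OF am this at_m]
    obtain b' where b': "b' > m" "b' \<le> b" "\<And>s. s \<in> {m..b'} \<Longrightarrow> \<phi> s = \<psi> s" by blast
    have "\<phi> r = \<psi> r" if "a \<le> r" "r \<le> b'" for r
      using below[of r] b'(3)[of r] that by (cases "r < m") simp_all
    then have "b' \<in> A" using b'(1,2) am by (simp add: A_def)
    then have "b' \<le> m" unfolding m_def by (rule cSup_upper[OF _ bdd])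
    then show False using b' by simp
  qed
  then show ?thesis using at_m by simp
qed

lemma has_vector_derivative_component:
  fixes \<phi> :: "real \<Rightarrow> real^2"
  assumes "(\<phi> has_vector_derivative d) (at t)"
  shows "((\<lambda>t. \<phi> t $ i) has_real_derivative d $ i) (at t)"
  using bounded_linear.has_vector_derivative[OF bounded_linear_vec_nth assms, of i]
  by (simp add: has_real_derivative_iff_has_vector_derivative)

text \<open>
  The field is \<open>FF 1\<close> above and \<open>FF (-1)\<close> below the switching line; \<open>\<kappa>\<close> is the sign of the vertical
  component of both on the positive half axis.
\<close>

locale piecewise_field =
  fixes FF :: "real \<Rightarrow> real^2 \<Rightarrow> real^2" and \<kappa> :: real
  assumes \<kappa>: "\<bar>\<kappa>\<bar> = 1"
    and field: "\<bar>s\<bar> = 1 \<Longrightarrow> lipschitz_field (FF s)"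
    and axis: "\<bar>s\<bar> = 1 \<Longrightarrow> x \<noteq> 0 \<Longrightarrow> \<kappa> * x * FF s (pt x 0) $ 2 > 0"
    and flow_axis: "\<bar>s\<bar> = 1 \<Longrightarrow> x \<noteq> 0 \<Longrightarrow> t \<noteq> 0 \<Longrightarrow> \<kappa> * x * t * flow (FF s) t (pt x 0) $ 2 > 0"
begin

lemma reverse: "piecewise_field (\<lambda>s p. - FF s p) (- \<kappa>)"
proof (rule piecewise_field.intro)
  show "\<bar>- \<kappa>\<bar> = 1" using \<kappa> by simp
  fix s :: real assume s: "\<bar>s\<bar> = 1"
  show "lipschitz_field (\<lambda>p. - FF s p)" by (rule flow_reverse(1)[OF field[OF s]])
  fix x :: real assume x: "x \<noteq> 0"
  show "- \<kappa> * x * (- FF s (pt x 0)) $ 2 > 0" using axis[OF s x] by simp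
  fix t :: real assume t: "t \<noteq> 0"
  show "- \<kappa> * x * t * flow (\<lambda>p. - FF s p) t (pt x 0) $ 2 > 0"
    using flow_axis[OF s x, of "- t"] t by (simp add: flow_reverse(2)[OF field[OF s]])
qed

text \<open>The half plane in which a trajectory is right after \<open>p\<close>. On the line both
  fields push the same way, with the sign of \<open>\<kappa> * p $ 1\<close>. The origin is treated
  separately in \<open>germ\<close>.\<close>

definition side :: "real^2 \<Rightarrow> real" where
  "side p = (if p $ 2 \<noteq> 0 then sgn (p $ 2) else sgn (\<kappa> * p $ 1))"

definition germ :: "real \<Rightarrow> real^2 \<Rightarrow> real^2" where
  "germ r p = (if p = 0 then 0 else flow (FF (side p)) r p)"

lemma abs_side: "p \<noteq> 0 \<Longrightarrow> \<bar>side p\<bar> = 1"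
  using \<kappa> by (auto simp: side_def vec2_eq_0_iff abs_sgn_eq)

lemma common_lipschitz:
  obtains K where "K-lipschitz_on UNIV (FF 1)" "K-lipschitz_on UNIV (FF (-1))"
proof -
  obtain K1 K2 where "K1-lipschitz_on UNIV (FF 1)" "K2-lipschitz_on UNIV (FF (-1))"
    using lipschitz_field.lipschitz[OF field[of 1]] lipschitz_field.lipschitz[OF field[of "-1"]] by auto
  then show ?thesis
    using that[of "max K1 K2"] lipschitz_on_le[of K1 UNIV "FF 1" "max K1 K2"] lipschitz_on_le[of K2 UNIV "FF (-1)" "max K1 K2"]
    by simp
qed

lemma solves_near:
  assumes bb: "t < b" and c: "continuous_on {t..b} \<phi>" and p: "\<phi> t \<noteq> 0"
    and mv: "\<And>s. t < s \<Longrightarrow> s < b \<Longrightarrow> moves FF \<phi> s"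
    and sd: "\<And>s. t < s \<Longrightarrow> s < b \<Longrightarrow> sgn (\<phi> s $ 2) = side (\<phi> t)"
    and s: "s \<in> {t..b}"
  shows "\<phi> s = germ (s - t) (\<phi> t)"
proof -
  interpret L: lipschitz_field "FF (side (\<phi> t))" by (rule field[OF abs_side[OF p]])
  have "(\<phi> has_vector_derivative FF (side (\<phi> t)) (\<phi> s)) (at s)" if "t < s" "s < b" for s
    using mv[OF that] sd[OF that] abs_side[OF p] unfolding moves_def by auto
  from L.flow_unique[OF c this, of t s] show ?thesis using p s bb by (simp add: germ_def)
qed

text \<open>Local uniqueness to the right. At the origin, the common Lipschitz constant and Gronwall
  keep the trajectory at rest. Off the line, it stays on its side for a while. At another point of
  the line, both fields have a vertical component of sign \<open>s0\<close> nearby and exceptional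
  times are isolated, so the height is strictly monotone and the trajectory enters the half plane
  \<open>side (\<phi> t)\<close> at once.\<close>

lemma right_germ:
  assumes traj: "weak_trajectory FF I \<phi>" and t: "t \<in> I" and b: "b \<in> I" "t < b"
  shows "\<exists>b'>t. b' \<le> b \<and> (\<forall>s\<in>{t..b'}. \<phi> s = germ (s - t) (\<phi> t))"
proof -
  obtain T where T: "\<And>a b. a \<in> I \<Longrightarrow> b \<in> I \<Longrightarrow> finite (T \<inter> {a..b})" "\<And>t. t \<in> I - T \<Longrightarrow> moves FF \<phi> t"
    using traj by (auto simp: weak_trajectory_def)
  have I: "is_interval I" "continuous_on I \<phi>" using traj by (auto simp: weak_trajectory_def)
  have sub: "{t..b} \<subseteq> I" using mem_is_interval_1_I[OF I(1) t b(1)] by auto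
  have cont: "continuous_on {t..b} \<phi>" using I(2) sub by (rule continuous_on_subset)
  \<comment> \<open>The time \<open>t\<close> may itself be exceptional, so it is taken out; just to
    the right of it there are no exceptional times.\<close>
  have "finite (T \<inter> {t..b} - {t})" using T(1)[OF t b(1)] by simp
  from finite_imp_closed[OF this] have "open (- (T \<inter> {t..b} - {t}))" by (rule open_Compl)
  then have "\<exists>e>0. ball t e \<subseteq> - (T \<inter> {t..b} - {t})" unfolding open_contains_ball by blast
  then obtain e where e: "e > 0" "ball t e \<subseteq> - (T \<inter> {t..b} - {t})" by blast
  define b1 where "b1 = min b (t + e / 2)"
  have b1: "t < b1" "b1 \<le> b" "b1 < t + e" using e b by (auto simp: b1_def)
  have mv: "moves FF \<phi> s" if "t < s" "s < b1" for s
  proof (rule T(2))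
    have "s \<in> ball t e" using that b1(3) by (simp add: dist_real_def)
    then have "s \<notin> T \<inter> {t..b} - {t}" using e(2) by blast
    moreover have "s \<in> {t..b} - {t}" using that b1(2) by simp
    ultimately show "s \<in> I - T" using sub by blast
  qed
  have c1: "continuous_on {t..b'} \<phi>" if "b' \<le> b" for b' 
    using cont by (rule continuous_on_subset) (simp add: that)
  have near: "\<exists>b'>t. b' \<le> b1 \<and> (\<forall>s\<in>{t..b'}. P (\<phi> s))" if op: "open (Collect P)" "P (\<phi> t)" for P
  proof -
    have "(\<phi> \<longlongrightarrow> \<phi> t) (at t within {t..b1})"
      using c1[OF b1(2)] b1(1) by (simp add: continuous_on_def)
    from topological_tendstoD[OF this op(1)] op(2)
    have "\<forall>\<^sub>F s in at t within {t..b1}. P (\<phi> s)" by simp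
    then obtain e' where e': "e' > 0" "\<forall>s\<in>{t..b1}. s \<noteq> t \<and> dist s t < e' \<longrightarrow> P (\<phi> s)"
      unfolding eventually_at by blast
    define b' where "b' = min b1 (t + e' / 2)"
    have "P (\<phi> s)" if "s \<in> {t..b'}" for s
    proof (cases "s = t")
      case False
      have "s \<in> {t..b1}" "dist s t < e'" using that e'(1) by (auto simp: b'_def dist_real_def)
      then show ?thesis using e'(2) False by blast
    next
      case True
      then show ?thesis using op(2) by simp
    qed
    moreover have "b' > t" "b' \<le> b1" using b1 e' by (auto simp: b'_def)
    ultimately show ?thesis by blast
  qed
  show ?thesis
  proof (cases "\<phi> t = 0")
    case True
    obtain K where K: "K-lipschitz_on UNIV (FF 1)" "K-lipschitz_on UNIV (FF (-1))" using common_lipschitz .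
    have K0: "K \<ge> 0" using K(1) by (rule lipschitz_on_nonneg)
    have FK: "norm (FF s q) \<le> K * norm q" if "\<bar>s\<bar> = 1" for s q
    proof -
      have "s = 1 \<or> s = -1" using that by linarith
      then have "K-lipschitz_on UNIV (FF s)" using K by blast
      from lipschitz_onD[OF this, of q 0] show ?thesis
        using lipschitz_field.F_0[OF field[OF that]] by (simp add: dist_norm)
    qed
    have "\<phi> s = 0" if s: "s \<in> {t..b1}" for s
    proof -
      have "norm (\<phi> s) \<le> exp (K * (s - t)) * norm (\<phi> t)"
      proof (rule gronwall(1)[where \<delta> = \<phi>])
        show "t \<le> s" "continuous_on {t..s} \<phi>" using s c1 b1 by auto
        fix r assume "t < r" "r < s"
        then have "moves FF \<phi> r" using mv s by auto
        then show "\<exists>d. (\<phi> has_vector_derivative d) (at r) \<and> norm d \<le> K * norm (\<phi> r)"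
          unfolding moves_def
        proof (elim disjE conjE)
          assume y: "\<phi> r $ 2 \<noteq> 0" "(\<phi> has_vector_derivative FF (sgn (\<phi> r $ 2)) (\<phi> r)) (at r)"
          from y(1) have "\<bar>sgn (\<phi> r $ 2)\<bar> = 1" by (simp add: abs_sgn_eq)
          from FK[OF this] y(2) show ?thesis by blast
        next
          assume "\<phi> r = 0" "(\<phi> has_vector_derivative 0) (at r)"
          then show ?thesis by (intro exI[of _ 0]) simp
        qed
      qed
      then show ?thesis using True by simp
    qed
    then show ?thesis using b1 True by (intro exI[of _ b1]) (auto simp: germ_def)
  next
    case p: False
    show ?thesis
    proof (cases "\<phi> t $ 2 = 0")
      case False
      define s0 where "s0 = sgn (\<phi> t $ 2)"
      have "open {q :: real^2. s0 * q $ 2 > 0}" by (intro open_Collect_less continuous_intros)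
      moreover have "s0 * \<phi> t $ 2 > 0" using False by (simp add: s0_def sgn_if)
      ultimately have "\<exists>b'>t. b' \<le> b1 \<and> (\<forall>s\<in>{t..b'}. s0 * \<phi> s $ 2 > 0)"
        by (rule near)
      then obtain b' where b': "b' > t" "b' \<le> b1" "\<And>s. s \<in> {t..b'} \<Longrightarrow> s0 * \<phi> s $ 2 > 0" by blast
      have sd: "sgn (\<phi> s $ 2) = side (\<phi> t)" if "t < s" "s < b'" for s
        using b'(3)[of s] that False by (auto simp: side_def s0_def sgn_if zero_less_mult_iff split: if_splits)
      have "\<phi> s = germ (s - t) (\<phi> t)" if "s \<in> {t..b'}" for s
      proof (rule solves_near[where t = t and b = b' and \<phi> = \<phi>])
        show "continuous_on {t..b'} \<phi>" using c1 b' b1 by simp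
        show "moves FF \<phi> r" if "t < r" "r < b'" for r using mv that b' by simp
        show "sgn (\<phi> r $ 2) = side (\<phi> t)" if "t < r" "r < b'" for r using sd that .
        show "t < b'" "\<phi> t \<noteq> 0" "s \<in> {t..b'}" using b'(1) p that by blast+
      qed
      moreover have "t < b'" "b' \<le> b" using b'(1,2) b1(2) by simp_all
      ultimately show ?thesis by blast
    next
      case True
      define x where "x = \<phi> t $ 1"
      have px: "\<phi> t = pt x 0" using True by (simp add: pt_eq_iff x_def)
      have x: "x \<noteq> 0" using p px by auto
      define s0 where "s0 = sgn (\<kappa> * x)"
      have s0: "\<bar>s0\<bar> = 1" using \<kappa> x by (auto simp: s0_def abs_sgn_eq)
      have pos: "s0 * FF s (pt x 0) $ 2 > 0" if "\<bar>s\<bar> = 1" for s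
        using axis[OF that x] zero_less_mult_iff[of "\<kappa> * x" "FF s (pt x 0) $ 2"]
        by (auto simp: s0_def sgn_if split: if_splits)
      have Fc: "continuous_on UNIV (FF s)" if "\<bar>s\<bar> = 1" for s
        using lipschitz_field.field_continuous[OF field[OF that]] .
      have "open {q. s0 * FF 1 q $ 2 > 0 \<and> s0 * FF (-1) q $ 2 > 0 \<and> q \<noteq> 0}"
        by (intro open_Collect_conj open_Collect_less continuous_intros Fc open_Collect_neq) auto
      moreover have "s0 * FF 1 (\<phi> t) $ 2 > 0 \<and> s0 * FF (-1) (\<phi> t) $ 2 > 0 \<and> \<phi> t \<noteq> 0"
        using pos[of 1] pos[of "-1"] x by (simp add: px)
      ultimately have "\<exists>b'>t. b' \<le> b1 \<and>
          (\<forall>s\<in>{t..b'}. s0 * FF 1 (\<phi> s) $ 2 > 0 \<and> s0 * FF (-1) (\<phi> s) $ 2 > 0 \<and> \<phi> s \<noteq> 0)"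
        by (rule near)
      then obtain b' where b': "b' > t" "b' \<le> b1"
        "\<And>s. s \<in> {t..b'} \<Longrightarrow> s0 * FF 1 (\<phi> s) $ 2 > 0 \<and> s0 * FF (-1) (\<phi> s) $ 2 > 0 \<and> \<phi> s \<noteq> 0"
        by blast
      have sd: "sgn (\<phi> s $ 2) = side (\<phi> t)" if s: "t < s" "s < b'" for s
      proof -
        have "s0 * \<phi> t $ 2 < s0 * \<phi> s $ 2"
        proof (rule DERIV_pos_imp_increasing_open[where f = "\<lambda>r. s0 * \<phi> r $ 2" and a = t and b = s])
          show "t < s" by (rule s(1))
          have "s \<le> b" using s b' b1 by simp
          then show "continuous_on {t..s} (\<lambda>r. s0 * \<phi> r $ 2)"
            by (intro continuous_on_mult continuous_on_const continuous_on_component c1)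
          fix r assume r: "t < r" "r < s"
          then have "moves FF \<phi> r" "\<phi> r \<noteq> 0" using mv s b' by auto
          then have d: "(\<phi> has_vector_derivative FF (sgn (\<phi> r $ 2)) (\<phi> r)) (at r)" and y: "\<phi> r $ 2 \<noteq> 0"
            by (auto simp: moves_def)
          have "s0 * FF (sgn (\<phi> r $ 2)) (\<phi> r) $ 2 > 0"
            using b'(3)[of r] r s y by (auto simp: sgn_if)
          moreover have "((\<lambda>r. s0 * \<phi> r $ 2) has_real_derivative s0 * FF (sgn (\<phi> r $ 2)) (\<phi> r) $ 2) (at r)"
            by (intro DERIV_cmult has_vector_derivative_component d)
          ultimately show "\<exists>y. ((\<lambda>r. s0 * \<phi> r $ 2) has_real_derivative y) (at r) \<and> 0 < y" by blast
        qed
        then have "s0 * \<phi> s $ 2 > 0" using True by simp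
        moreover have "side (\<phi> t) = s0" using True by (simp add: side_def s0_def x_def)
        ultimately show ?thesis using s0 by (auto simp: abs_if sgn_if zero_less_mult_iff split: if_splits)
      qed
      have "\<phi> s = germ (s - t) (\<phi> t)" if "s \<in> {t..b'}" for s
      proof (rule solves_near[where t = t and b = b' and \<phi> = \<phi>])
        show "continuous_on {t..b'} \<phi>" using c1 b' b1 by simp
        show "moves FF \<phi> r" if "t < r" "r < b'" for r using mv that b' by simp
        show "sgn (\<phi> r $ 2) = side (\<phi> t)" if "t < r" "r < b'" for r using sd that .
        show "t < b'" "\<phi> t \<noteq> 0" "s \<in> {t..b'}" using b'(1) p that by blast+
      qed
      moreover have "t < b'" "b' \<le> b" using b'(1,2) b1(2) by simp_all
      ultimately show ?thesis by blast
    qed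
  qed
qed

lemma weak_trajectory_agree_forward:
  assumes "weak_trajectory FF I \<phi>" "weak_trajectory FF I \<psi>" "t \<in> I" "\<phi> t = \<psi> t" "s \<in> I" "t \<le> s"
  shows "\<phi> s = \<psi> s"
proof -
  have I: "is_interval I" "continuous_on I \<phi>" "continuous_on I \<psi>" using assms by (auto simp: weak_trajectory_def)
  have sub: "{t..s} \<subseteq> I" using mem_is_interval_1_I[OF I(1) assms(3,5)] by auto
  show ?thesis
  proof (rule agree_forward[where a = t and b = s and \<phi> = \<phi> and \<psi> = \<psi>])
    show "t \<le> s" "\<phi> t = \<psi> t" by fact+
    show "continuous_on {t..s} \<phi>" "continuous_on {t..s} \<psi>" using I sub continuous_on_subset by blast+
    fix r assume r: "t \<le> r" "r < s" "\<phi> r = \<psi> r"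
    then have "r \<in> I" using sub by auto
    obtain b1 where b1: "b1 > r" "b1 \<le> s" "\<And>u. u \<in> {r..b1} \<Longrightarrow> \<phi> u = germ (u - r) (\<phi> r)"
      using right_germ[OF assms(1) \<open>r \<in> I\<close> assms(5) r(2)] by blast
    obtain b2 where b2: "b2 > r" "b2 \<le> s" "\<And>u. u \<in> {r..b2} \<Longrightarrow> \<psi> u = germ (u - r) (\<psi> r)"
      using right_germ[OF assms(2) \<open>r \<in> I\<close> assms(5) r(2)] by blast
    show "\<exists>b'>r. b' \<le> s \<and> (\<forall>u\<in>{r..b'}. \<phi> u = \<psi> u)"
    proof (intro exI[of _ "min b1 b2"] conjI ballI)
      show "min b1 b2 > r" "min b1 b2 \<le> s" using b1(1,2) b2(1) by simp_all
      fix u assume "u \<in> {r..min b1 b2}"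
      then have "u \<in> {r..b1}" "u \<in> {r..b2}" by simp_all
      then show "\<phi> u = \<psi> u" using b1(3)[of u] b2(3)[of u] r(3) by metis
    qed
  qed
qed

end

text \<open>Uniqueness to the left is uniqueness to the right for the reversed fields, which form a
  \<open>piecewise_field\<close> with \<open>- \<kappa>\<close>.\<close>

lemma (in piecewise_field) weak_trajectory_agree:
  assumes "weak_trajectory FF I \<phi>" "weak_trajectory FF I \<psi>" "t \<in> I" "\<phi> t = \<psi> t" "s \<in> I"
  shows "\<phi> s = \<psi> s"
proof (cases "t \<le> s")
  case True
  then show ?thesis using weak_trajectory_agree_forward assms by blast
next
  case False
  interpret rev: piecewise_field "\<lambda>s p. - FF s p" "- \<kappa>" by (rule reverse)
  have "\<phi> (- (- s)) = \<psi> (- (- s))"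
    by (rule rev.weak_trajectory_agree_forward[OF weak_trajectory_reverse[OF assms(1)] weak_trajectory_reverse[OF assms(2)], of "- t"])
      (use assms False in auto)
  then show ?thesis by simp
qed

lemma (in lipschitz_field) flow_shift_deriv:
  "((\<lambda>t. flow F (t - c) p) has_vector_derivative F (flow F (t - c) p)) (at t)"
proof -
  have "((\<lambda>t. t - c) has_vector_derivative 1) (at t)" by (auto intro!: derivative_eq_intros)
  from vector_diff_chain_at[OF this flow_deriv[of p "t - c"]] show ?thesis by (simp add: o_def)
qed

section \<open>Complete trajectories\<close>

context piecewise_field
begin

text \<open>The curve that is at \<open>(x, 0)\<close> at time \<open>t0\<close> and changes from
  one field to the other there. The sign of \<open>\<kappa> * x\<close> is the half plane that it
  enters.\<close>

definition mixed :: "real \<Rightarrow> real \<Rightarrow> real \<Rightarrow> real^2" where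
  "mixed x t0 t = flow (FF (if t0 \<le> t then sgn (\<kappa> * x) else - sgn (\<kappa> * x))) (t - t0) (pt x 0)"

text \<open>Rest, a curve in one open half plane, and a curve with one crossing. There are no
  further kinds: by \<open>flow_axis\<close> a curve that has left the line never returns to it, and
  the same holds backward in time.\<close>

definition complete :: "(real \<Rightarrow> real^2) \<Rightarrow> bool" where
  "complete g \<longleftrightarrow> g = (\<lambda>t. 0) \<or>
     (\<exists>s p. \<bar>s\<bar> = 1 \<and> (\<forall>t. sgn (flow (FF s) t p $ 2) = s) \<and> g = (\<lambda>t. flow (FF s) t p)) \<or>
     (\<exists>x t0. x \<noteq> 0 \<and> g = mixed x t0)"

lemma abs_sgn_\<kappa>: "x \<noteq> 0 \<Longrightarrow> \<bar>sgn (\<kappa> * x)\<bar> = 1"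
  using \<kappa> by (auto simp: abs_sgn_eq)

lemma flow_axis_sgn:
  assumes "\<bar>s\<bar> = 1" "x \<noteq> 0" "t \<noteq> 0"
  shows "sgn (flow (FF s) t (pt x 0) $ 2) = sgn (\<kappa> * x) * sgn t"
proof -
  let ?y = "flow (FF s) t (pt x 0) $ 2"
  have "sgn (\<kappa> * x * t * ?y) = 1" using flow_axis[OF assms] by simp
  then have 1: "sgn (\<kappa> * x) * sgn t * sgn ?y = 1" by (simp add: sgn_mult)
  then have "sgn ?y \<noteq> 0" by auto
  then have "sgn ?y * sgn ?y = 1" by (auto simp: sgn_if)
  then have "sgn (\<kappa> * x) * sgn t = sgn (\<kappa> * x) * sgn t * sgn ?y * sgn ?y" by (simp only: mult.assoc mult_1_right)
  then show ?thesis unfolding 1 by simp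
qed

lemma mixed_self: "x \<noteq> 0 \<Longrightarrow> mixed x t0 t0 = pt x 0"
  using lipschitz_field.flow_0[OF field[OF abs_sgn_\<kappa>]] by (simp add: mixed_def)

lemma mixed_sgn:
  assumes "x \<noteq> 0" "t \<noteq> t0"
  shows "sgn (mixed x t0 t $ 2) = (if t0 \<le> t then sgn (\<kappa> * x) else - sgn (\<kappa> * x))"
  using flow_axis_sgn[of _ x "t - t0"] assms abs_sgn_\<kappa>[OF assms(1)] by (auto simp: mixed_def)

lemma mixed_continuous:
  assumes x: "x \<noteq> 0"
  shows "continuous_on UNIV (mixed x t0)"
proof -
  have c: "continuous_on S (\<lambda>t. flow (FF s) (t - t0) (pt x 0))" if "\<bar>s\<bar> = 1" for s S
    by (intro lipschitz_field.flow_continuous_on[OF field[OF that]] continuous_intros)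
  have \<sigma>: "\<bar>sgn (\<kappa> * x)\<bar> = 1" "\<bar>- sgn (\<kappa> * x)\<bar> = 1" using abs_sgn_\<kappa>[OF x] by simp_all
  have "continuous_on {t0..} (mixed x t0)"
    by (rule continuous_on_eq[OF c[OF \<sigma>(1)]]) (simp add: mixed_def)
  moreover have "continuous_on {..t0} (mixed x t0)"
  proof (rule continuous_on_eq[OF c[OF \<sigma>(2)]])
    fix t assume "t \<in> {..t0}"
    then consider "t = t0" | "t < t0" by force
    then show "flow (FF (- sgn (\<kappa> * x))) (t - t0) (pt x 0) = mixed x t0 t"
    proof cases
      case 1
      then show ?thesis using mixed_self[OF x] lipschitz_field.flow_0[OF field[OF \<sigma>(2)]] by simp
    next
      case 2
      then show ?thesis by (simp add: mixed_def)
    qed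
  qed
  ultimately have "continuous_on ({t0..} \<union> {..t0}) (mixed x t0)" by (intro continuous_on_closed_Un) auto
  moreover have "{t0..} \<union> {..t0} = UNIV" by auto
  ultimately show ?thesis by simp
qed

lemma complete_continuous: "complete g \<Longrightarrow> continuous_on UNIV g"
  unfolding complete_def
  by (auto intro!: mixed_continuous lipschitz_field.flow_continuous_time field)

text \<open>The behaviour on an open interval that yields a \<open>solution_arc\<close> of one of
  the three fields. A complete curve has it except at its crossing time.\<close>

definition one_sided :: "(real \<Rightarrow> real^2) \<Rightarrow> real \<Rightarrow> bool" where
  "one_sided g t \<longleftrightarrow> (\<exists>J. open J \<and> is_interval J \<and> t \<in> J \<and>
    ((\<forall>r\<in>J. g r = 0) \<or>
     (\<exists>s. \<bar>s\<bar> = 1 \<and> (\<forall>r\<in>J. sgn (g r $ 2) = s \<and> (g has_vector_derivative FF s (g r)) (at r)))))"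

lemma complete_one_sided:
  assumes "complete g"
  shows "\<exists>tc. \<forall>t. t \<noteq> tc \<longrightarrow> one_sided g t"
proof -
  from assms consider "g = (\<lambda>t. 0)"
    | s p where "\<bar>s\<bar> = 1" "\<And>t. sgn (flow (FF s) t p $ 2) = s" "g = (\<lambda>t. flow (FF s) t p)"
    | x t0 where "x \<noteq> 0" "g = mixed x t0"
    unfolding complete_def by blast
  then show ?thesis
  proof cases
    case 1
    have "one_sided g t" for t unfolding one_sided_def by (rule exI[of _ UNIV]) (simp add: 1)
    then show ?thesis by blast
  next
    case 2
    have "\<forall>r\<in>UNIV. sgn (g r $ 2) = s \<and> (g has_vector_derivative FF s (g r)) (at r)"
      using 2 lipschitz_field.flow_deriv[OF field[OF 2(1)]] by simp
    then have "one_sided g t" for t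
      unfolding one_sided_def using 2(1) by (intro exI[of _ UNIV]) blast
    then show ?thesis by blast
  next
    case 3
    show ?thesis
    proof (intro exI[of _ t0] allI impI)
      fix t assume t: "t \<noteq> t0"
      define J where "J = (if t0 \<le> t then {t0<..} else {..<t0})"
      define s where "s = (if t0 \<le> t then sgn (\<kappa> * x) else - sgn (\<kappa> * x))"
      have s: "\<bar>s\<bar> = 1" using abs_sgn_\<kappa>[OF 3(1)] by (simp add: s_def)
      have J: "open J" "is_interval J" "t \<in> J" using t by (auto simp: J_def is_interval_1)
      have eq: "flow (FF s) (r - t0) (pt x 0) = g r" if "r \<in> J" for r
        using that t by (auto simp: 3(2) mixed_def s_def J_def split: if_splits)
      have "sgn (g r $ 2) = s \<and> (g has_vector_derivative FF s (g r)) (at r)" if r: "r \<in> J" for r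
      proof
        show "sgn (g r $ 2) = s"
          using mixed_sgn[OF 3(1), of r t0] r t by (auto simp: 3(2) s_def J_def split: if_splits)
        have "((\<lambda>t. flow (FF s) (t - t0) (pt x 0)) has_vector_derivative FF s (g r)) (at r)"
          using lipschitz_field.flow_shift_deriv[OF field[OF s], of t0 "pt x 0" r] eq[OF r] by simp
        then show "(g has_vector_derivative FF s (g r)) (at r)"
          by (rule has_vector_derivative_transform_within_open[OF _ J(1) r]) (rule eq)
      qed
      then show "one_sided g t" unfolding one_sided_def using J s by blast
    qed
  qed
qed

lemma complete_weak_trajectory:
  assumes "complete g"
  shows "weak_trajectory FF UNIV g"
proof -
  obtain tc where tc: "\<And>t. t \<noteq> tc \<Longrightarrow> one_sided g t"
    using complete_one_sided[OF assms] by blast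
  have "moves FF g t" if "t \<noteq> tc" for t
  proof -
    from tc[OF that] obtain J where J: "open J" "t \<in> J"
      and alt: "(\<forall>r\<in>J. g r = 0) \<or>
        (\<exists>s. \<bar>s\<bar> = 1 \<and> (\<forall>r\<in>J. sgn (g r $ 2) = s \<and> (g has_vector_derivative FF s (g r)) (at r)))"
      unfolding one_sided_def by blast
    from alt show ?thesis
    proof
      assume z: "\<forall>r\<in>J. g r = 0"
      have "((\<lambda>t. 0) has_vector_derivative 0) (at t)" by (rule has_vector_derivative_const)
      then have "(g has_vector_derivative 0) (at t)"
        by (rule has_vector_derivative_transform_within_open[OF _ J]) (simp add: z)
      then show ?thesis using z J(2) by (simp add: moves_def)
    next
      assume "\<exists>s. \<bar>s\<bar> = 1 \<and> (\<forall>r\<in>J. sgn (g r $ 2) = s \<and> (g has_vector_derivative FF s (g r)) (at r))"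
      then obtain s where s: "\<bar>s\<bar> = 1" "sgn (g t $ 2) = s" "(g has_vector_derivative FF s (g t)) (at t)"
        using J(2) by blast
      then have "g t $ 2 \<noteq> 0" by auto
      then show ?thesis using s(2,3) by (simp add: moves_def)
    qed
  qed
  then show ?thesis
    unfolding weak_trajectory_def using complete_continuous[OF assms]
    by (intro conjI exI[of _ "{tc}"]) auto
qed

lemma complete_unique:
  assumes "complete g" "complete g'" "g t = g' t"
  shows "g = g'"
  using weak_trajectory_agree[OF complete_weak_trajectory[OF assms(1)] complete_weak_trajectory[OF assms(2)] _ assms(3)] by auto

text \<open>Off the line, the orbit of the field of that half plane is followed in both directions.
  If it meets the line at some time \<open>t\<close>, the curve is a \<open>mixed\<close> one that
  crosses at \<open>t0 + t\<close>; otherwise it never leaves its half plane.\<close>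

lemma complete_exists: "\<exists>g. complete g \<and> g t0 = p"
proof (cases "p $ 2 = 0")
  case True
  then have p: "p = pt (p $ 1) 0" by (simp add: pt_eq_iff)
  show ?thesis
  proof (cases "p = 0")
    case True
    then show ?thesis by (intro exI[of _ "\<lambda>t. 0"]) (simp add: complete_def)
  next
    case False
    have nz: "p $ 1 \<noteq> 0" using False True by (simp add: vec2_eq_0_iff)
    then have "mixed (p $ 1) t0 t0 = p" using mixed_self[OF nz] p by simp
    then show ?thesis using nz unfolding complete_def by blast
  qed
next
  case y: False
  define s where "s = sgn (p $ 2)"
  have s: "\<bar>s\<bar> = 1" using y by (simp add: s_def abs_sgn_eq)
  interpret L: lipschitz_field "FF s" by (rule field[OF s])
  show ?thesis
  proof (cases "\<exists>t. flow (FF s) t p $ 2 = 0")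
    case True
    then obtain t where t: "flow (FF s) t p $ 2 = 0" by blast
    define x where "x = flow (FF s) t p $ 1"
    have fx: "flow (FF s) t p = pt x 0" using t by (simp add: pt_eq_iff x_def)
    have x: "x \<noteq> 0"
    proof
      assume "x = 0"
      then have "p = 0" using fx L.flow_eq_0_iff[of t p] by simp
      then show False using y by simp
    qed
    have t0: "t \<noteq> 0" using t y by auto
    have inv: "flow (FF s) (- t) (pt x 0) = p" using L.flow_inverse[of t p] fx by simp
    \<comment> \<open>This sign makes \<open>mixed\<close> use the field \<open>FF s\<close> at time
      \<open>t0\<close>, whether the crossing lies in the past or in the future.\<close>
    have "s = sgn (\<kappa> * x) * sgn (- t)" using flow_axis_sgn[OF s x, of "- t"] t0 inv by (simp add: s_def)
    then have "(if t0 + t \<le> t0 then sgn (\<kappa> * x) else - sgn (\<kappa> * x)) = s" using t0 by (simp add: sgn_if)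
    then have "mixed x (t0 + t) t0 = p" using inv by (simp add: mixed_def)
    then show ?thesis using x unfolding complete_def by blast
  next
    case False
    have "sgn (flow (FF s) t p $ 2) = s" for t
    proof (rule ccontr)
      assume neq: "sgn (flow (FF s) t p $ 2) \<noteq> s"
      have c: "continuous_on S (\<lambda>r. s * flow (FF s) r p $ 2)" for S
        by (intro continuous_on_mult continuous_on_const continuous_on_component L.flow_continuous_time)
      have "s * p $ 2 > 0" using y by (simp add: s_def sgn_if)
      then have 1: "s * flow (FF s) 0 p $ 2 > 0" by simp
      have 2: "s * flow (FF s) t p $ 2 \<le> 0"
        using neq s False by (auto simp: sgn_if abs_if mult_le_0_iff split: if_splits)
      from ivt_unordered[OF c 1 2] obtain r where "s * flow (FF s) r p $ 2 = 0" .
      then show False using False s by auto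
    qed
    then have sg: "sgn (flow (FF s) t (flow (FF s) (- t0) p) $ 2) = s" for t by (simp add: L.flow_flow)
    have "complete (\<lambda>t. flow (FF s) t (flow (FF s) (- t0) p))"
      unfolding complete_def using s sg by blast
    moreover have "flow (FF s) t0 (flow (FF s) (- t0) p) = p" by (simp add: L.flow_flow)
    ultimately show ?thesis by (intro exI[of _ "\<lambda>t. flow (FF s) t (flow (FF s) (- t0) p)"]) simp
  qed
qed

text \<open>Trajectories are thus restrictions of complete curves, and orbits in \<open>U\<close>
  amount to the maximal intervals in which a complete curve stays in \<open>U\<close>.\<close>

lemma weak_trajectory_complete:
  assumes traj: "weak_trajectory FF I \<phi>" and t: "t \<in> I"
  obtains g where "complete g" "\<And>s. s \<in> I \<Longrightarrow> \<phi> s = g s"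
proof -
  obtain g where g: "complete g" "g t = \<phi> t" using complete_exists by blast
  have "is_interval I" using traj by (simp add: weak_trajectory_def)
  then have "weak_trajectory FF I g" using weak_trajectory_subset[OF complete_weak_trajectory[OF g(1)]] by simp
  then have "\<phi> s = g s" if "s \<in> I" for s using weak_trajectory_agree[OF traj _ t _ that] g(2) by simp
  then show ?thesis using that g(1) by blast
qed

end

section \<open>Comparison with the given piecewise smooth field near the origin\<close>

locale piecewise_local = piecewise_field +
  fixes W :: "(real^2) set" and X Y :: vfield and U :: "(real^2) set"
  assumes W: "0 \<in> W" and U: "U \<subseteq> W" and equilibrium: "X 0 = 0" "Y 0 = 0"
    and X_eq: "p \<in> U \<Longrightarrow> X p = FF 1 p" and Y_eq: "p \<in> U \<Longrightarrow> Y p = FF (-1) p"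
begin

lemma Z_switch_0: "Z_switch W (X, Y) 0 = 0"
  by (simp add: Z_switch_def equilibrium)

text \<open>Away from the origin both vertical components have the sign of
  \<open>\<kappa> * x\<close>, so the point is in the crossing set and the field there is
  \<open>X\<close> or \<open>Y\<close>, neither of which is tangent to the line.\<close>

lemma Z_switch_crossing:
  assumes "x \<noteq> 0" "pt x 0 \<in> U"
  shows "Z_switch W (X, Y) (pt x 0) $ 2 \<noteq> 0"
proof -
  have X: "\<kappa> * x * X (pt x 0) $ 2 > 0" and Y: "\<kappa> * x * Y (pt x 0) $ 2 > 0"
    using axis[of 1, OF _ assms(1)] axis[of "-1", OF _ assms(1)] X_eq[OF assms(2)] Y_eq[OF assms(2)] by simp_all
  have "0 < (\<kappa> * x * X (pt x 0) $ 2) * (\<kappa> * x * Y (pt x 0) $ 2)" using X Y by simp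
  also have "\<dots> = (\<kappa> * x)\<^sup>2 * (X (pt x 0) $ 2 * Y (pt x 0) $ 2)" by (simp add: power2_eq_square)
  finally have "X (pt x 0) $ 2 * Y (pt x 0) $ 2 > 0" by (simp add: zero_less_mult_iff)
  moreover have "X (pt x 0) $ 2 \<noteq> 0" "Y (pt x 0) $ 2 \<noteq> 0" using X Y by auto
  ultimately show ?thesis by (simp add: Z_switch_def)
qed

lemma trajectory_weak_trajectory:
  assumes "trajectory W (X, Y) U I \<phi>"
  shows "weak_trajectory FF I \<phi>"
proof -
  have I: "is_interval I" "continuous_on I \<phi>" "\<phi> ` I \<subseteq> U" using assms by (simp_all add: trajectory_def)
  obtain T where T: "\<forall>a\<in>I. \<forall>b\<in>I. finite (T \<inter> {a..b})"
    and arcs: "\<And>t. t \<in> I - T \<Longrightarrow> \<exists>J. open J \<and> is_interval J \<and> t \<in> J \<and> J \<subseteq> I \<and>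
             (solution_arc X (upper W) J \<phi> \<or> solution_arc Y (lower W) J \<phi> \<or>
              solution_arc (Z_switch W (X, Y)) (switching_line W) J \<phi>)"
    using assms unfolding trajectory_def fst_conv snd_conv by blast
  have "moves FF \<phi> t" if tI: "t \<in> I - T" for t
  proof -
    obtain J where J: "open J" "t \<in> J" and alt: "solution_arc X (upper W) J \<phi> \<or> solution_arc Y (lower W) J \<phi> \<or>
              solution_arc (Z_switch W (X, Y)) (switching_line W) J \<phi>"
      using arcs[OF tI] by blast
    have tU: "\<phi> t \<in> U" using I(3) tI by auto
    from alt show ?thesis
    proof (elim disjE)
      assume a: "solution_arc X (upper W) J \<phi>"
      then have "\<phi> t \<in> upper W" "(\<phi> has_vector_derivative X (\<phi> t)) (at t)" using J by (auto simp: solution_arc_def)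
      then show ?thesis using X_eq[OF tU] by (simp add: moves_def upper_def)
    next
      assume a: "solution_arc Y (lower W) J \<phi>"
      then have "\<phi> t \<in> lower W" "(\<phi> has_vector_derivative Y (\<phi> t)) (at t)" using J by (auto simp: solution_arc_def)
      then show ?thesis using Y_eq[OF tU] by (simp add: moves_def lower_def)
    next
      assume a: "solution_arc (Z_switch W (X, Y)) (switching_line W) J \<phi>"
      then have y: "\<phi> r $ 2 = 0" if "r \<in> J" for r
        using that by (auto simp: solution_arc_def switching_line_def)
      have d: "(\<phi> has_vector_derivative Z_switch W (X, Y) (\<phi> t)) (at t)" using a J by (simp add: solution_arc_def)
      \<comment> \<open>An arc inside the line has vertical velocity 0. The field on the line is
        transversal except at the origin, so the arc is at the origin.\<close>
      have "((\<lambda>r. 0) has_real_derivative 0) (at t)" by (rule DERIV_const)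
      then have "((\<lambda>r. \<phi> r $ 2) has_real_derivative 0) (at t)"
        unfolding has_real_derivative_iff_has_vector_derivative
        by (rule has_vector_derivative_transform_within_open[OF _ J]) (simp add: y)
      from DERIV_unique[OF this has_vector_derivative_component[OF d]] have z: "Z_switch W (X, Y) (\<phi> t) $ 2 = 0" by simp
      define x where "x = \<phi> t $ 1"
      have px: "\<phi> t = pt x 0" using y[OF J(2)] by (simp add: pt_eq_iff x_def)
      have "x = 0" using Z_switch_crossing[of x] z tU unfolding px by blast
      then have "\<phi> t = 0" using px by simp
      then show ?thesis using d Z_switch_0 by (simp add: moves_def)
    qed
  qed
  then show ?thesis unfolding weak_trajectory_def using I T by blast
qed

lemma complete_trajectory:
  assumes g: "complete g" and I: "is_interval I" "I \<noteq> {}" and gU: "g ` I \<subseteq> U"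
  shows "trajectory W (X, Y) U I g"
proof -
  obtain tc where tc: "\<And>t. t \<noteq> tc \<Longrightarrow> one_sided g t"
    using complete_one_sided[OF g] by blast
  \<comment> \<open>A solution arc needs an open interval inside \<open>I\<close>; so besides the
    crossing time the end points of \<open>I\<close>, as far as they belong to \<open>I\<close>, are
    exceptional.\<close>
  define T where "T = {t \<in> I. \<forall>r\<in>I. r \<le> t} \<union> {t \<in> I. \<forall>r\<in>I. t \<le> r} \<union> {tc}"
  have single: "finite {t. P t}" if "\<And>t r. P t \<Longrightarrow> P r \<Longrightarrow> t = r" for P :: "real \<Rightarrow> bool"
  proof (cases "\<exists>t. P t")
    case True
    then obtain t where "P t" by blast
    then have "{t. P t} \<subseteq> {t}" using that by blast
    then show ?thesis by (rule finite_subset) simp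
  qed simp
  have "finite {t \<in> I. \<forall>r\<in>I. r \<le> t}" "finite {t \<in> I. \<forall>r\<in>I. t \<le> r}"
    by (rule single, fastforce)+
  then have "finite T" by (simp add: T_def)
  have "\<exists>J. open J \<and> is_interval J \<and> t \<in> J \<and> J \<subseteq> I \<and>
             (solution_arc X (upper W) J g \<or> solution_arc Y (lower W) J g \<or>
              solution_arc (Z_switch W (X, Y)) (switching_line W) J g)" if t: "t \<in> I - T" for t
  proof -
    from t obtain a b where ab: "a \<in> I" "b \<in> I" "a < t" "t < b" by (auto simp: T_def not_le)
    from t have "t \<noteq> tc" by (simp add: T_def)
    from tc[OF this] obtain J where J: "open J" "is_interval J" "t \<in> J"
      and alt: "(\<forall>r\<in>J. g r = 0) \<or>
        (\<exists>s. \<bar>s\<bar> = 1 \<and> (\<forall>r\<in>J. sgn (g r $ 2) = s \<and> (g has_vector_derivative FF s (g r)) (at r)))"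
      unfolding one_sided_def by blast
    define K where "K = J \<inter> {a<..<b}"
    have K: "open K" "is_interval K" "t \<in> K" "K \<subseteq> J" using J ab by (auto simp: K_def intro!: is_interval_Int)
    have KI: "K \<subseteq> I" using mem_is_interval_1_I[OF I(1) ab(1,2)] by (auto simp: K_def)
    then have gK: "g r \<in> U" if "r \<in> K" for r using gU that by blast
    have gW: "g r \<in> W" if "r \<in> K" for r using gK[OF that] U by blast
    from alt have "solution_arc X (upper W) K g \<or> solution_arc Y (lower W) K g \<or>
              solution_arc (Z_switch W (X, Y)) (switching_line W) K g"
    proof
      assume z: "\<forall>r\<in>J. g r = 0"
      have "(g has_vector_derivative Z_switch W (X, Y) (g r)) (at r)" if r: "r \<in> K" for r
      proof -
        have "r \<in> J" using r K by blast
        have "((\<lambda>t. 0) has_vector_derivative 0) (at r)" by (rule has_vector_derivative_const)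
        then have "(g has_vector_derivative 0) (at r)"
          by (rule has_vector_derivative_transform_within_open[OF _ J(1) \<open>r \<in> J\<close>]) (simp add: z)
        then show ?thesis using z \<open>r \<in> J\<close> Z_switch_0 by simp
      qed
      moreover have "g ` K \<subseteq> switching_line W" using z K W by (auto simp: switching_line_def)
      ultimately show ?thesis by (simp add: solution_arc_def)
    next
      assume "\<exists>s. \<bar>s\<bar> = 1 \<and> (\<forall>r\<in>J. sgn (g r $ 2) = s \<and> (g has_vector_derivative FF s (g r)) (at r))"
      then obtain s where s: "\<bar>s\<bar> = 1" "\<And>r. r \<in> K \<Longrightarrow> sgn (g r $ 2) = s"
        "\<And>r. r \<in> K \<Longrightarrow> (g has_vector_derivative FF s (g r)) (at r)" using K(4) by blast
      have "s = 1 \<or> s = -1" using s(1) by linarith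
      then show ?thesis
      proof
        assume s1: "s = 1"
        have "g ` K \<subseteq> upper W" using s(2) gW unfolding s1 by (auto simp: upper_def sgn_1_pos)
        moreover have "(g has_vector_derivative X (g r)) (at r)" if "r \<in> K" for r
          using s(3)[OF that] X_eq[OF gK[OF that]] unfolding s1 by simp
        ultimately show ?thesis by (simp add: solution_arc_def)
      next
        assume s1: "s = -1"
        have "g ` K \<subseteq> lower W" using s(2) gW unfolding s1 by (auto simp: lower_def sgn_1_neg)
        moreover have "(g has_vector_derivative Y (g r)) (at r)" if "r \<in> K" for r
          using s(3)[OF that] Y_eq[OF gK[OF that]] unfolding s1 by simp
        ultimately show ?thesis by (simp add: solution_arc_def)
      qed
    qed
    then show ?thesis using K KI by blast
  qed
  moreover have "\<forall>a\<in>I. \<forall>b\<in>I. finite (T \<inter> {a..b})" using \<open>finite T\<close> by simp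
  moreover have "continuous_on I g" using complete_continuous[OF g] by (rule continuous_on_subset) simp
  ultimately show ?thesis unfolding trajectory_def fst_conv snd_conv using I gU by blast
qed

end

section \<open>Gluing the half planes\<close>

lemma strict_mono_surj_inv:
  fixes \<tau> :: "real \<Rightarrow> real"
  assumes "strict_mono \<tau>" "surj \<tau>"
  shows "strict_mono (inv \<tau>)" "surj (inv \<tau>)" "\<tau> (inv \<tau> u) = u" "inv \<tau> (\<tau> t) = t"
proof -
  have inj: "inj \<tau>" using assms(1) by (rule strict_mono_imp_inj_on)
  show r: "\<tau> (inv \<tau> u) = u" for u using assms(2) by (rule surj_f_inv_f)
  show "inv \<tau> (\<tau> t) = t" using inj by (rule inv_f_f)
  show "surj (inv \<tau>)" using inj by (rule inj_imp_surj_inv)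
  show "strict_mono (inv \<tau>)"
  proof (rule strict_monoI)
    fix u v :: real assume "u < v"
    then have "\<tau> (inv \<tau> u) < \<tau> (inv \<tau> v)" by (simp add: r)
    then show "inv \<tau> u < inv \<tau> v" using strict_mono_less[OF assms(1)] by blast
  qed
qed

lemma is_interval_strict_mono_image:
  fixes \<tau> :: "real \<Rightarrow> real"
  assumes \<tau>: "strict_mono \<tau>" "surj \<tau>" and I: "is_interval I"
  shows "is_interval (\<tau> ` I)"
  unfolding is_interval_1
proof (intro ballI allI impI)
  fix u v w assume u: "u \<in> \<tau> ` I" and v: "v \<in> \<tau> ` I" and w: "u \<le> w \<and> w \<le> v"
  obtain a b where ab: "a \<in> I" "b \<in> I" "u = \<tau> a" "v = \<tau> b" using u v by blast
  obtain c where c: "w = \<tau> c" using \<tau>(2) by (meson surjD)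
  have "a \<le> c" "c \<le> b" using w strict_mono_less_eq[OF \<tau>(1)] by (simp_all add: ab c)
  then have "c \<in> I" using mem_is_interval_1_I[OF I ab(1,2)] by blast
  then show "w \<in> \<tau> ` I" by (simp add: c)
qed

text \<open>The relation of \<open>g t \<in> U\<close> to \<open>g' (\<tau> t) \<in> V\<close> makes
  \<tau> carry the maximal intervals of \<open>g\<close> in \<open>U\<close> to those of
  \<open>g'\<close> in \<open>V\<close>. \<open>Rel\<close> is kept abstract so that the lemma can
  be used in both directions, once as \<open>H p = q\<close> and once with the roles
  exchanged.\<close>

lemma orbit_transfer:
  assumes A: "piecewise_local FF \<kappa> W X Y U" and B: "piecewise_local GG \<kappa>' W X' Y' V"
    and match: "\<And>g. piecewise_field.complete FF \<kappa> g \<Longrightarrow> \<exists>g' \<tau>. piecewise_field.complete GG \<kappa>' g' \<and> strict_mono \<tau> \<and> surj \<tau> \<and>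
      (\<forall>t. g t \<in> U \<longleftrightarrow> g' (\<tau> t) \<in> V) \<and> (\<forall>t. Rel (g t) (g' (\<tau> t)))"
    and orbit: "orbit_in W (X, Y) U I \<phi>"
  shows "\<exists>J \<psi> \<tau>. orbit_in W (X', Y') V J \<psi> \<and> strict_mono \<tau> \<and> surj \<tau> \<and> \<tau> ` I = J \<and> (\<forall>t\<in>I. Rel (\<phi> t) (\<psi> (\<tau> t)))"
proof -
  interpret A: piecewise_local FF \<kappa> W X Y U by fact
  interpret B: piecewise_local GG \<kappa>' W X' Y' V by fact
  have traj: "trajectory W (X, Y) U I \<phi>"
    and max: "\<And>I' \<phi>'. trajectory W (X, Y) U I' \<phi>' \<Longrightarrow> I \<subseteq> I' \<Longrightarrow> \<forall>t\<in>I. \<phi>' t = \<phi> t \<Longrightarrow> I' = I"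
    using orbit unfolding orbit_in_def by blast+
  have I: "is_interval I" "I \<noteq> {}" "\<phi> ` I \<subseteq> U" using traj by (simp_all add: trajectory_def)
  obtain t0 where t0: "t0 \<in> I" using I(2) by blast
  obtain g where g: "A.complete g" "\<And>t. t \<in> I \<Longrightarrow> \<phi> t = g t"
    using A.weak_trajectory_complete[OF A.trajectory_weak_trajectory[OF traj] t0] by blast
  obtain g' \<tau> where g': "B.complete g'" and \<tau>: "strict_mono \<tau>" "surj \<tau>"
    and UV: "\<And>t. g t \<in> U \<longleftrightarrow> g' (\<tau> t) \<in> V" and Rel: "\<And>t. Rel (g t) (g' (\<tau> t))"
    using match[OF g(1)] by blast
  note inv = strict_mono_surj_inv[OF \<tau>]
  have J: "is_interval (\<tau> ` I)" "\<tau> ` I \<noteq> {}"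
    using is_interval_strict_mono_image[OF \<tau> I(1)] I(2) by auto
  have gU: "g t \<in> U" if "t \<in> I" for t using I(3) g(2)[OF that] that by (metis image_subset_iff)
  have "g' ` (\<tau> ` I) \<subseteq> V" using UV gU by blast
  then have traj': "trajectory W (X', Y') V (\<tau> ` I) g'" by (rule B.complete_trajectory[OF g' J])
  have "J' = \<tau> ` I" if tr: "trajectory W (X', Y') V J' \<psi>'" and sub: "\<tau> ` I \<subseteq> J'" and ext: "\<forall>u\<in>\<tau> ` I. \<psi>' u = g' u"
    for J' \<psi>'
  proof -
    have J': "is_interval J'" "\<psi>' ` J' \<subseteq> V" using tr by (simp_all add: trajectory_def)
    have "\<tau> t0 \<in> J'" using sub t0 by blast
    obtain k where k: "B.complete k" "\<And>u. u \<in> J' \<Longrightarrow> \<psi>' u = k u"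
      using B.weak_trajectory_complete[OF B.trajectory_weak_trajectory[OF tr] \<open>\<tau> t0 \<in> J'\<close>] by blast
    have "k (\<tau> t0) = g' (\<tau> t0)" using k(2)[OF \<open>\<tau> t0 \<in> J'\<close>] ext t0 by simp
    then have kg: "k = g'" by (rule B.complete_unique[OF k(1) g'])
    \<comment> \<open>An extension on the image side is pulled back by the inverse change of time
      and contradicts the maximality of \<open>I\<close> unless it is trivial.\<close>
    define I' where "I' = inv \<tau> ` J'"
    have I': "is_interval I'" unfolding I'_def by (rule is_interval_strict_mono_image[OF inv(1,2) J'(1)])
    have II': "I \<subseteq> I'"
    proof
      fix t assume "t \<in> I"
      then have "inv \<tau> (\<tau> t) \<in> I'" unfolding I'_def using sub by blast
      then show "t \<in> I'" by (simp add: inv(4))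
    qed
    have "g ` I' \<subseteq> U"
    proof
      fix p assume "p \<in> g ` I'"
      then obtain u where u: "u \<in> J'" "p = g (inv \<tau> u)" by (auto simp: I'_def)
      have "g' u \<in> V" using J'(2) k(2)[OF u(1)] u(1) kg by (metis image_subset_iff)
      then show "p \<in> U" using UV[of "inv \<tau> u"] u(2) by (simp add: inv(3))
    qed
    then have "trajectory W (X, Y) U I' g" using A.complete_trajectory[OF g(1) I'] II' I(2) by blast
    then have "I' = I" using max II' g(2) by metis
    then have "\<tau> ` (inv \<tau> ` J') = \<tau> ` I" by (simp add: I'_def)
    then show ?thesis by (simp add: image_image inv(3))
  qed
  then have "orbit_in W (X', Y') V (\<tau> ` I) g'" unfolding orbit_in_def using traj' by blast
  then show ?thesis using \<tau> Rel g(2) by (intro exI[of _ "\<tau> ` I"] exI[of _ g'] exI[of _ \<tau>]) auto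
qed

lemma (in piecewise_field) complete_shift:
  assumes "complete g"
  shows "complete (\<lambda>t. g (t + c))"
proof -
  from assms consider "g = (\<lambda>t. 0)"
    | s p where "\<bar>s\<bar> = 1" "\<And>t. sgn (flow (FF s) t p $ 2) = s" "g = (\<lambda>t. flow (FF s) t p)"
    | x t0 where "x \<noteq> 0" "g = mixed x t0"
    unfolding complete_def by blast
  then show ?thesis
  proof cases
    case 1
    then show ?thesis by (simp add: complete_def)
  next
    case 2
    interpret L: lipschitz_field "FF s" by (rule field[OF 2(1)])
    have eq: "flow (FF s) (t + c) p = flow (FF s) t (flow (FF s) c p)" for t by (simp add: L.flow_flow)
    have "\<forall>t. sgn (flow (FF s) t (flow (FF s) c p) $ 2) = s" using 2(2) by (simp add: L.flow_flow)
    then show ?thesis unfolding complete_def 2(3) eq using 2(1) by blast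
  next
    case 3
    have "mixed x t0 (t + c) = mixed x (t0 - c) t" for t
      by (simp add: mixed_def algebra_simps)
    then have "(\<lambda>t. g (t + c)) = mixed x (t0 - c)" by (simp add: 3(2))
    then show ?thesis unfolding complete_def using 3(1) by blast
  qed
qed

text \<open>
  If \<open>s' = -1\<close> the two half planes are interchanged.
\<close>

locale glued_equiv = A: piecewise_field FF \<kappa> + B: piecewise_field GG \<kappa>' for FF \<kappa> GG \<kappa>' +
  fixes s' e :: real
  assumes s': "\<bar>s'\<bar> = 1" and e_def: "e = s' * \<kappa> * \<kappa>'"
    and halves: "\<bar>s\<bar> = 1 \<Longrightarrow> half_equiv s (FF s) (s * s') (GG (s * s')) e"
begin

lemma abs_1_cases: "\<bar>s\<bar> = 1 \<longleftrightarrow> s = 1 \<or> s = -1" for s :: real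
  by linarith

lemma ee: "e * e = 1" "e * (e * x) = x" and e_abs: "\<bar>e\<bar> = 1"
proof -
  show "\<bar>e\<bar> = 1" using s' A.\<kappa> B.\<kappa> by (simp add: e_def abs_mult)
  then show "e * e = 1" by (auto simp: abs_1_cases)
  then show "e * (e * x) = x" by (simp flip: mult.assoc)
qed

text \<open>A curve in one open half plane is mapped by a single half-plane equivalence. For a curve
  with a crossing, the changes of time \<alpha> after and \<beta> before the crossing both fix 0, so
  they join to an increasing bijection, and the image curve crosses at time 0.\<close>

lemma matched_curve:
  assumes g: "A.complete g"
    and half: "\<And>s p. \<bar>s\<bar> = 1 \<Longrightarrow> p \<in> half s \<Longrightarrow> orbit_onto H s (FF s) (s * s') (GG (s * s')) p"
    and ax: "\<And>x. H (pt x 0) = pt (e * x) 0" and inj: "inj H"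
  shows "\<exists>g' \<tau>. B.complete g' \<and> strict_mono \<tau> \<and> surj \<tau> \<and> (\<forall>t. H (g t) = g' (\<tau> t))"
proof -
  from g consider "g = (\<lambda>t. 0)"
    | s p where "\<bar>s\<bar> = 1" "\<And>t. sgn (flow (FF s) t p $ 2) = s" "g = (\<lambda>t. flow (FF s) t p)"
    | x t0 where "x \<noteq> 0" "g = A.mixed x t0"
    unfolding A.complete_def by blast
  then show ?thesis
  proof cases
    case 1
    have "H 0 = 0" using ax[of 0] by simp
    then show ?thesis using 1 by (intro exI[of _ "\<lambda>t. 0"] exI[of _ "\<lambda>t. t"]) (auto simp: B.complete_def strict_mono_def)
  next
    case 2
    interpret L: lipschitz_field "FF s" by (rule A.field[OF 2(1)])
    have ss: "\<bar>s * s'\<bar> = 1" using 2(1) s' by (simp add: abs_mult)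
    have in_half: "flow (FF s) t p \<in> half s" for t
    proof -
      have "s * flow (FF s) t p $ 2 = \<bar>flow (FF s) t p $ 2\<bar>"
        by (subst 2(2)[of t, symmetric]) (simp add: abs_sgn mult.commute)
      then show ?thesis by (simp add: half_def)
    qed
    have p: "p \<in> half s" using in_half[of 0] by simp
    obtain \<alpha> where \<alpha>: "strict_mono \<alpha>" "surj \<alpha>"
      and h1: "\<And>t. flow (FF s) t p \<in> half s \<longleftrightarrow> flow (GG (s * s')) (\<alpha> t) (H p) \<in> half (s * s')"
      and h2: "\<And>t. flow (FF s) t p \<in> half s \<Longrightarrow> H (flow (FF s) t p) = flow (GG (s * s')) (\<alpha> t) (H p)"
      using half[OF 2(1) p] unfolding orbit_onto_def by blast
    have "sgn (flow (GG (s * s')) u (H p) $ 2) = s * s'" for u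
    proof -
      obtain t where t: "u = \<alpha> t" using \<alpha>(2) by (meson surjD)
      let ?q = "flow (GG (s * s')) u (H p)"
      have "?q \<in> half (s * s')" using h1[of t] in_half[of t] by (simp add: t)
      then have nn: "s * s' * ?q $ 2 \<ge> 0" by (simp add: half_def)
      have Hq: "H (flow (FF s) t p) = ?q" using h2[OF in_half] by (simp add: t)
      \<comment> \<open>By \<open>ax\<close> every axis point is the image of an axis point; by
        injectivity an image on the axis would put the original curve on the axis too.\<close>
      have "?q $ 2 \<noteq> 0"
      proof
        assume "?q $ 2 = 0"
        then have "?q = pt (?q $ 1) 0" by (simp add: pt_eq_iff)
        also have "\<dots> = H (pt (e * ?q $ 1) 0)" by (simp add: ax ee)
        finally have "flow (FF s) t p = pt (e * ?q $ 1) 0" using Hq inj by (metis injD)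
        then have "flow (FF s) t p $ 2 = 0" by simp
        then show False using 2(1) 2(2)[of t] by simp
      qed
      then show ?thesis using nn ss unfolding abs_1_cases[of "s * s'"] by (auto simp: sgn_if)
    qed
    then have "B.complete (\<lambda>t. flow (GG (s * s')) t (H p))" unfolding B.complete_def using ss by blast
    then show ?thesis
      using \<alpha> h2[OF in_half] unfolding 2(3) by blast
  next
    case 3
    define \<sigma> where "\<sigma> = sgn (\<kappa> * x)"
    have \<sigma>: "\<bar>\<sigma>\<bar> = 1" "\<bar>- \<sigma>\<bar> = 1" using A.abs_sgn_\<kappa>[OF 3(1)] by (simp_all add: \<sigma>_def)
    have ex: "e * x \<noteq> 0" using 3(1) e_abs by auto
    have p: "pt x 0 \<in> half s" for s by (simp add: half_def)
    obtain \<alpha> where \<alpha>: "strict_mono \<alpha>" "surj \<alpha>" "\<alpha> 0 = 0"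
      and \<alpha>h: "\<And>t. flow (FF \<sigma>) t (pt x 0) \<in> half \<sigma> \<Longrightarrow> H (flow (FF \<sigma>) t (pt x 0)) = flow (GG (\<sigma> * s')) (\<alpha> t) (pt (e * x) 0)"
      using half[OF \<sigma>(1) p] unfolding orbit_onto_def ax by blast
    obtain \<beta> where \<beta>: "strict_mono \<beta>" "surj \<beta>" "\<beta> 0 = 0"
      and \<beta>h: "\<And>t. flow (FF (- \<sigma>)) t (pt x 0) \<in> half (- \<sigma>) \<Longrightarrow>
        H (flow (FF (- \<sigma>)) t (pt x 0)) = flow (GG (- \<sigma> * s')) (\<beta> t) (pt (e * x) 0)"
      using half[OF \<sigma>(2) p] unfolding orbit_onto_def ax by blast
    have \<alpha>0: "\<alpha> t \<ge> 0 \<longleftrightarrow> t \<ge> 0" and \<beta>0: "\<beta> t < 0 \<longleftrightarrow> t < 0" for t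
      using strict_mono_less_eq[OF \<alpha>(1), of 0 t] strict_mono_less[OF \<beta>(1), of t 0] \<alpha>(3) \<beta>(3) by simp_all
    define \<tau> where "\<tau> = (\<lambda>t. if t0 \<le> t then \<alpha> (t - t0) else \<beta> (t - t0))"
    have "strict_mono \<tau>"
    proof (rule strict_monoI)
      fix a b :: real assume ab: "a < b"
      consider "t0 \<le> a" | "a < t0" "t0 \<le> b" | "b < t0" by linarith
      then show "\<tau> a < \<tau> b"
      proof cases
        case 1
        then show ?thesis using ab strict_monoD[OF \<alpha>(1), of "a - t0" "b - t0"] by (simp add: \<tau>_def)
      next
        case 2
        then show ?thesis using \<alpha>0[of "b - t0"] \<beta>0[of "a - t0"] by (simp add: \<tau>_def)
      next
        case 3
        then show ?thesis using ab strict_monoD[OF \<beta>(1), of "a - t0" "b - t0"] by (simp add: \<tau>_def)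
      qed
    qed
    moreover have "surj \<tau>"
    proof (rule surjI[where g = \<tau> and f = "\<lambda>u. t0 + (if u \<ge> 0 then inv \<alpha> u else inv \<beta> u)"])
      fix u
      have "\<alpha> (inv \<alpha> u) = u" "\<beta> (inv \<beta> u) = u" using \<alpha>(2) \<beta>(2) by (simp_all add: surj_f_inv_f)
      then show "\<tau> (t0 + (if u \<ge> 0 then inv \<alpha> u else inv \<beta> u)) = u"
        using \<alpha>0[of "inv \<alpha> u"] \<beta>0[of "inv \<beta> u"] by (auto simp: \<tau>_def)
    qed
    moreover have "H (g t) = B.mixed (e * x) 0 (\<tau> t)" for t
    proof -
      \<comment> \<open>This is where the value of \<open>e\<close> comes from: beyond its crossing
        point \<open>(e * x, 0)\<close> the image curve has to enter the half plane that is matched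
        with the one entered by the original, that is, \<open>\<sigma> * s'\<close>.\<close>
      have "\<kappa>' * (e * x) = s' * (\<kappa> * x) * (\<kappa>' * \<kappa>')" by (simp add: e_def mult_ac)
      moreover have "\<kappa>' * \<kappa>' = 1" using B.\<kappa> by (auto simp: abs_1_cases)
      ultimately have "\<kappa>' * (e * x) = s' * (\<kappa> * x)" by (simp only: mult_1_right)
      then have "sgn (\<kappa>' * (e * x)) = sgn s' * \<sigma>" by (simp only: sgn_mult \<sigma>_def)
      moreover have "sgn s' = s'" using s' by (auto simp: abs_1_cases)
      ultimately have k: "sgn (\<kappa>' * (e * x)) = \<sigma> * s'" by (simp add: mult.commute)
      have side: "A.mixed x t0 t \<in> half (if t0 \<le> t then \<sigma> else - \<sigma>)"
      proof (cases "t = t0")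
        case True
        then show ?thesis using A.mixed_self[OF 3(1), of t0] p by simp
      next
        case False
        let ?y = "A.mixed x t0 t $ 2"
        have "sgn ?y = (if t0 \<le> t then \<sigma> else - \<sigma>)" using A.mixed_sgn[OF 3(1) False] by (simp add: \<sigma>_def)
        moreover have "sgn ?y * ?y \<ge> 0" by (simp add: sgn_if)
        ultimately show ?thesis unfolding half_def mem_Collect_eq by simp
      qed
      show ?thesis
      proof (cases "t0 \<le> t")
        case True
        have m: "A.mixed x t0 t = flow (FF \<sigma>) (t - t0) (pt x 0)" using True by (simp add: A.mixed_def \<sigma>_def)
        have "0 \<le> \<tau> t" using \<alpha>0[of "t - t0"] True by (simp add: \<tau>_def)
        then have "B.mixed (e * x) 0 (\<tau> t) = flow (GG (\<sigma> * s')) (\<alpha> (t - t0)) (pt (e * x) 0)"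
          using True k by (simp add: B.mixed_def \<tau>_def)
        then show ?thesis using \<alpha>h[of "t - t0"] side True m by (simp add: 3(2))
      next
        case False
        have m: "A.mixed x t0 t = flow (FF (- \<sigma>)) (t - t0) (pt x 0)" using False by (simp add: A.mixed_def \<sigma>_def)
        have "\<tau> t < 0" using \<beta>0[of "t - t0"] False by (simp add: \<tau>_def)
        then have "B.mixed (e * x) 0 (\<tau> t) = flow (GG (- \<sigma> * s')) (\<beta> (t - t0)) (pt (e * x) 0)"
          using False k by (simp add: B.mixed_def \<tau>_def)
        then show ?thesis using \<beta>h[of "t - t0"] side False m by (simp add: 3(2))
      qed
    qed
    moreover have "B.complete (B.mixed (e * x) 0)" unfolding B.complete_def using ex by blast
    ultimately show ?thesis by blast
  qed
qed

text \<open>Both half-plane homeomorphisms act on the axis as multiplication by \<open>e\<close>,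
  and so do their inverses because \<open>e * e = 1\<close>. Hence they agree on the common closed
  boundary, and the glued map and the glued inverse are continuous.\<close>

lemma glued_homeomorphism:
  obtains H H' where "homeomorphism UNIV UNIV H H'" "\<And>x. H (pt x 0) = pt (e * x) 0" "\<And>p. H p $ 2 = 0 \<longleftrightarrow> p $ 2 = 0"
    "\<And>g. A.complete g \<Longrightarrow> \<exists>g' \<tau>. B.complete g' \<and> strict_mono \<tau> \<and> surj \<tau> \<and> (\<forall>t. H (g t) = g' (\<tau> t))"
proof -
  have one: "\<bar>1 :: real\<bar> = 1" "\<bar>-1 :: real\<bar> = 1" by simp_all
  define P where "P = (\<lambda>s H H'. homeomorphism (half s) (half (s * s')) H H' \<and> (\<forall>x. H (pt x 0) = pt (e * x) 0) \<and>
        (\<forall>p\<in>half s. orbit_onto H s (FF s) (s * s') (GG (s * s')) p))"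
  have ex: "\<exists>H H'. P s H H'" if "\<bar>s\<bar> = 1" for s
    using halves[OF that] unfolding half_equiv_def P_def .
  obtain K1 K1' K2 K2' where P: "P 1 K1 K1'" "P (-1) K2 K2'" using ex[OF one(1)] ex[OF one(2)] by blast
  define K where "K = (\<lambda>s :: real. if s = 1 then K1 else K2)"
  define K' where "K' = (\<lambda>s :: real. if s = 1 then K1' else K2')"
  have KP: "P s (K s) (K' s)" if "\<bar>s\<bar> = 1" for s
    using that P unfolding abs_1_cases by (auto simp: K_def K'_def)
  have K: "homeomorphism (half s) (half (s * s')) (K s) (K' s)" if "\<bar>s\<bar> = 1" for s
    using KP[OF that] by (simp only: P_def)
  have Kx: "K s (pt x 0) = pt (e * x) 0" if "\<bar>s\<bar> = 1" for s x
    using KP[OF that] unfolding P_def by blast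
  have K\<alpha>: "orbit_onto (K s) s (FF s) (s * s') (GG (s * s')) p"
    if "\<bar>s\<bar> = 1" "p \<in> half s" for s p
    using KP[OF that(1)] that(2) unfolding P_def by blast
  have K'x: "K' s (pt x 0) = pt (e * x) 0" if "\<bar>s\<bar> = 1" for s x
    using homeomorphism_apply1[OF K[OF that], of "pt (e * x) 0"] Kx[OF that, of "e * x"] by (simp add: half_def ee)
  define H where "H = (\<lambda>p. if p $ 2 \<ge> 0 then K 1 p else K (-1) p)"
  define H' where "H' = (\<lambda>q. if s' * q $ 2 \<ge> 0 then K' 1 q else K' (-1) q)"
  have axis_pt: "p = pt (p $ 1) 0" if "p $ 2 = 0" for p :: "real^2" using that by (simp add: pt_eq_iff)
  have H: "H p = K s p" if s: "\<bar>s\<bar> = 1" and p: "p \<in> half s" for s p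
  proof (cases "p $ 2 = 0")
    case True
    have "K 1 p = K s p" by (subst (1 2) axis_pt[OF True]) (simp only: Kx[OF s] Kx[OF one(1)])
    then show ?thesis using True by (simp add: H_def)
  next
    case False
    then show ?thesis using s p unfolding abs_1_cases by (elim disjE) (simp_all add: H_def half_def)
  qed
  have H': "H' q = K' s q" if s: "\<bar>s\<bar> = 1" and q: "q \<in> half (s * s')" for s q
  proof (cases "q $ 2 = 0")
    case True
    have "K' 1 q = K' s q" by (subst (1 2) axis_pt[OF True]) (simp only: K'x[OF s] K'x[OF one(1)])
    then show ?thesis using True by (simp add: H'_def)
  next
    case False
    have "s' * q $ 2 \<noteq> 0" using False s' by auto
    then show ?thesis using s q unfolding abs_1_cases by (elim disjE) (simp_all add: H'_def half_def)
  qed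
  have cl: "closed (half s)" for s unfolding half_def by (intro closed_Collect_le continuous_intros)
  have cov: "half s \<union> half (- s) = UNIV" for s by (auto simp: half_def)
  have "continuous_on (half 1 \<union> half (-1)) H"
  proof (rule continuous_on_closed_Un[OF cl cl])
    show "continuous_on (half 1) H"
      by (rule continuous_on_eq[OF homeomorphism_cont1[OF K[OF one(1)]]], rule H[OF one(1), symmetric], assumption)
    show "continuous_on (half (-1)) H"
      by (rule continuous_on_eq[OF homeomorphism_cont1[OF K[OF one(2)]]], rule H[OF one(2), symmetric], assumption)
  qed
  then have cH: "continuous_on UNIV H" unfolding cov .
  have "continuous_on (half (1 * s') \<union> half (-1 * s')) H'"
  proof (rule continuous_on_closed_Un[OF cl cl])
    show "continuous_on (half (1 * s')) H'"
      by (rule continuous_on_eq[OF homeomorphism_cont2[OF K[OF one(1)]]], rule H'[OF one(1), symmetric], assumption)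
    show "continuous_on (half (-1 * s')) H'"
      by (rule continuous_on_eq[OF homeomorphism_cont2[OF K[OF one(2)]]], rule H'[OF one(2), symmetric], assumption)
  qed
  then have cH': "continuous_on UNIV H'" using cov[of s'] by simp
  have HH: "H' (H p) = p \<and> (H p $ 2 = 0 \<longleftrightarrow> p $ 2 = 0)" for p
  proof -
    obtain s where s: "\<bar>s\<bar> = 1" "p \<in> half s" using cov[of 1] one by blast
    have Kp: "K s p \<in> half (s * s')" using K[OF s(1)] s(2) by (auto simp: homeomorphism_def)
    have 1: "H' (H p) = p"
      using H[OF s] H'[OF s(1) Kp] homeomorphism_apply1[OF K[OF s(1)] s(2)] by simp
    have "H p $ 2 = 0" if "p $ 2 = 0"
    proof -
      define x where "x = p $ 1"
      have "p = pt x 0" using that by (simp add: pt_eq_iff x_def)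
      then have "H p = pt (e * x) 0" using Kx[OF s(1), of x] H[OF s] by simp
      then show ?thesis by simp
    qed
    moreover have "p $ 2 = 0" if "H p $ 2 = 0"
    proof -
      define x where "x = H p $ 1"
      have q: "H p = pt x 0" using that by (simp add: pt_eq_iff x_def)
      have "K' s (H p) = p" using 1 H'[OF s(1) Kp] H[OF s] by simp
      then have "p = pt (e * x) 0" using K'x[OF s(1), of x] unfolding q by simp
      then show ?thesis by simp
    qed
    ultimately show ?thesis using 1 by blast
  qed
  have H'H: "H (H' q) = q" for q
  proof -
    obtain s where s: "\<bar>s\<bar> = 1" "q \<in> half (s * s')" 
    proof -
      have "q \<in> half (1 * s') \<or> q \<in> half (-1 * s')" using cov[of s'] by auto
      then show thesis using that one by blast
    qed
    have Kq: "K' s q \<in> half s" using K[OF s(1)] s(2) by (auto simp: homeomorphism_def)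
    show ?thesis using H'[OF s] H[OF s(1) Kq] homeomorphism_apply2[OF K[OF s(1)] s(2)] by simp
  qed
  have hom: "homeomorphism UNIV UNIV H H'"
    by (rule homeomorphismI[OF cH cH']) (simp_all add: HH H'H)
  have Hx: "H (pt x 0) = pt (e * x) 0" for x using Kx[OF one(1), of x] by (simp add: H_def)
  have "inj H" using HH by (metis injI)
  have "\<exists>g' \<tau>. B.complete g' \<and> strict_mono \<tau> \<and> surj \<tau> \<and> (\<forall>t. H (g t) = g' (\<tau> t))" if "A.complete g" for g
  proof (rule matched_curve[OF that _ Hx \<open>inj H\<close>])
    fix s p assume s: "\<bar>s\<bar> = 1" and p: "p \<in> half s"
    show "orbit_onto H s (FF s) (s * s') (GG (s * s')) p"
    proof -
      have Hp: "H p = K s p" by (rule H[OF s p])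
      obtain \<alpha> where \<alpha>: "strict_mono \<alpha>" "surj \<alpha>" "\<alpha> 0 = 0"
        "\<forall>t. flow (FF s) t p \<in> half s \<longleftrightarrow> flow (GG (s * s')) (\<alpha> t) (K s p) \<in> half (s * s')"
        "\<forall>t. flow (FF s) t p \<in> half s \<longrightarrow> K s (flow (FF s) t p) = flow (GG (s * s')) (\<alpha> t) (K s p)"
        using K\<alpha>[OF s p] unfolding orbit_onto_def by blast
      have "\<forall>t. flow (FF s) t p \<in> half s \<longrightarrow> H (flow (FF s) t p) = flow (GG (s * s')) (\<alpha> t) (K s p)"
      proof (intro allI impI)
        fix t assume t: "flow (FF s) t p \<in> half s"
        show "H (flow (FF s) t p) = flow (GG (s * s')) (\<alpha> t) (K s p)"
          using \<alpha>(5) t H[OF s t] by simp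
      qed
      then show ?thesis unfolding orbit_onto_def Hp using \<alpha>(1-4) by blast
    qed
  qed
  then show ?thesis using that[OF hom Hx] HH by blast
qed

lemma local_equivalence:
  assumes W: "open W" "0 \<in> W" and eq0: "X 0 = 0" "Y 0 = 0" "X' 0 = 0" "Y' 0 = 0"
    and d: "d > 0" "\<And>p. norm p \<le> d \<Longrightarrow> X p = FF 1 p" "\<And>p. norm p \<le> d \<Longrightarrow> Y p = FF (-1) p"
    and d': "d' > 0" "\<And>p. norm p \<le> d' \<Longrightarrow> X' p = GG 1 p" "\<And>p. norm p \<le> d' \<Longrightarrow> Y' p = GG (-1) p"
  shows "locally_Sigma_equivalent W (X, Y) (X', Y')"
proof -
  obtain H H' where hom: "homeomorphism UNIV UNIV H H'" and Hx: "\<And>x. H (pt x 0) = pt (e * x) 0"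
    and H2: "\<And>p. H p $ 2 = 0 \<longleftrightarrow> p $ 2 = 0"
    and fwd: "\<And>g. A.complete g \<Longrightarrow> \<exists>g' \<tau>. B.complete g' \<and> strict_mono \<tau> \<and> surj \<tau> \<and> (\<forall>t. H (g t) = g' (\<tau> t))"
    using glued_homeomorphism by blast
  have H'H: "H' (H p) = p" and HH': "H (H' q) = q" for p q using hom by (auto simp: homeomorphism_def)
  have cH: "continuous_on UNIV H" using hom by (simp add: homeomorphism_def)
  define S S' where "S = W \<inter> ball 0 d" and "S' = W \<inter> ball (0 :: real^2) d'"
  \<comment> \<open>Both neighbourhoods are cut to where the extended fields agree with the given
    ones, on either side of \<open>H\<close>. Then a curve is in \<open>U\<close> exactly when its
    image is in \<open>V\<close>.\<close>
  define U where "U = S \<inter> H -` S'"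
  define V where "V = H ` U"
  have oS: "open S" "open S'" using W(1) by (auto simp: S_def S'_def)
  have oU: "open U" unfolding U_def
    by (intro open_Int oS open_vimage cH)
  have UV: "p \<in> U \<longleftrightarrow> H p \<in> V" for p
    unfolding V_def using H'H by (metis image_iff)
  have V': "V = S' \<inter> H' -` S"
  proof (intro equalityI subsetI)
    fix q assume "q \<in> V"
    then show "q \<in> S' \<inter> H' -` S" by (auto simp: V_def U_def H'H)
  next
    fix q assume "q \<in> S' \<inter> H' -` S"
    then have "H' q \<in> U" by (simp add: U_def HH')
    then show "q \<in> V" using UV[of "H' q"] by (simp add: HH')
  qed
  have "continuous_on UNIV H'" using hom by (simp add: homeomorphism_def)
  then have oV: "open V" unfolding V' by (intro open_Int oS open_vimage)
  have H0: "H 0 = 0" using Hx[of 0] by simp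
  have U0: "0 \<in> U" using W(2) d(1) d'(1) H0 by (simp add: U_def S_def S'_def)
  have V0: "0 \<in> V" using U0 UV[of 0] H0 by simp
  have UW: "U \<subseteq> W" and VW: "V \<subseteq> W" unfolding V' by (auto simp: U_def S_def S'_def)
  have homUV: "homeomorphism U V H H'"
    using hom unfolding homeomorphism_def V_def by (auto simp: H'H HH' image_image intro: continuous_on_subset)
  have LA: "piecewise_local FF \<kappa> W X Y U"
  proof (intro piecewise_local.intro piecewise_local_axioms.intro A.piecewise_field_axioms W UW eq0)
    show "X p = FF 1 p" "Y p = FF (-1) p" if "p \<in> U" for p
      using that d(2,3)[of p] by (simp_all add: U_def S_def)
  qed
  have LB: "piecewise_local GG \<kappa>' W X' Y' V"
  proof (intro piecewise_local.intro piecewise_local_axioms.intro B.piecewise_field_axioms W VW eq0)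
    show "X' p = GG 1 p" "Y' p = GG (-1) p" if "p \<in> V" for p
      using that d'(2,3)[of p] by (simp_all add: V' S'_def)
  qed
  \<comment> \<open>The curve through the preimage of \<open>g' 0\<close> is mapped to a complete
    curve that passes through \<open>g' 0\<close>, though at time \<open>\<tau> 0\<close>. By
    uniqueness this is \<open>g'\<close> up to a shift of time.\<close>
  have bwd: "\<exists>g \<tau>. A.complete g \<and> strict_mono \<tau> \<and> surj \<tau> \<and> (\<forall>u. g' u = H (g (\<tau> u)))" if g': "B.complete g'" for g'
  proof -
    obtain g where g: "A.complete g" "g 0 = H' (g' 0)" using A.complete_exists by blast
    obtain k \<tau> where k: "B.complete k" and \<tau>: "strict_mono \<tau>" "surj \<tau>" and eq: "\<And>t. H (g t) = k (\<tau> t)"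
      using fwd[OF g(1)] by blast
    have k0: "k (\<tau> 0) = g' 0" using eq[of 0] g(2) by (simp add: HH')
    have shifted: "B.complete (\<lambda>t. k (t + \<tau> 0))" by (rule B.complete_shift[OF k])
    have "(\<lambda>t. k (t + \<tau> 0)) = g'"
      by (rule B.complete_unique[OF shifted g', where t = 0]) (simp add: k0)
    then have kg: "k (t + \<tau> 0) = g' t" for t by metis
    define \<rho> where "\<rho> = (\<lambda>u. inv \<tau> (u + \<tau> 0))"
    note inv = strict_mono_surj_inv[OF \<tau>]
    have "strict_mono \<rho>" unfolding \<rho>_def using inv(1) by (auto simp: strict_mono_def)
    moreover have "surj \<rho>"
    proof (rule surjI)
      show "\<rho> (\<tau> t - \<tau> 0) = t" for t by (simp add: \<rho>_def inv(4))
    qed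
    moreover have "g' u = H (g (\<rho> u))" for u
      using eq[of "\<rho> u"] kg[of u] by (simp add: \<rho>_def inv(3))
    ultimately show ?thesis using g(1) by blast
  qed
  have "\<exists>J \<psi>. orbit_in W (X', Y') V J \<psi> \<and> maps_orbit H I \<phi> J \<psi>" if "orbit_in W (X, Y) U I \<phi>" for I \<phi>
  proof -
    have "\<exists>J \<psi> \<tau>. orbit_in W (X', Y') V J \<psi> \<and> strict_mono \<tau> \<and> surj \<tau> \<and> \<tau> ` I = J \<and> (\<forall>t\<in>I. H (\<phi> t) = \<psi> (\<tau> t))"
    proof (rule orbit_transfer[OF LA LB _ that])
      fix g assume "A.complete g"
      from fwd[OF this] obtain g' \<tau> where 1: "B.complete g'" "strict_mono \<tau>" "surj \<tau>"
        and eq: "\<And>t. H (g t) = g' (\<tau> t)" by blast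
      have "g t \<in> U \<longleftrightarrow> g' (\<tau> t) \<in> V" for t using UV[of "g t"] by (simp add: eq)
      then show "\<exists>g' \<tau>. B.complete g' \<and> strict_mono \<tau> \<and> surj \<tau> \<and>
          (\<forall>t. g t \<in> U \<longleftrightarrow> g' (\<tau> t) \<in> V) \<and> (\<forall>t. H (g t) = g' (\<tau> t))"
        using 1 eq by blast
    qed
    then obtain J \<psi> \<tau> where o: "orbit_in W (X', Y') V J \<psi>" and m: "strict_mono \<tau>" "\<tau> ` I = J"
      and eq: "\<forall>t\<in>I. H (\<phi> t) = \<psi> (\<tau> t)" by blast
    have "strict_mono_on I \<tau>" using m(1) by (auto simp: strict_mono_on_def strict_mono_def)
    then have "maps_orbit H I \<phi> J \<psi>" unfolding maps_orbit_def using m(2) eq by blast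
    then show ?thesis using o by blast
  qed
  moreover have "\<exists>I \<phi>. orbit_in W (X, Y) U I \<phi> \<and> maps_orbit H I \<phi> J \<psi>" if "orbit_in W (X', Y') V J \<psi>" for J \<psi>
  proof -
    have "\<exists>I \<phi> \<tau>. orbit_in W (X, Y) U I \<phi> \<and> strict_mono \<tau> \<and> surj \<tau> \<and> \<tau> ` J = I \<and> (\<forall>u\<in>J. \<psi> u = H (\<phi> (\<tau> u)))"
    proof (rule orbit_transfer[OF LB LA _ that])
      fix g' assume "B.complete g'"
      from bwd[OF this] obtain g \<tau> where 1: "A.complete g" "strict_mono \<tau>" "surj \<tau>"
        and eq: "\<And>u. g' u = H (g (\<tau> u))" by blast
      have "g' u \<in> V \<longleftrightarrow> g (\<tau> u) \<in> U" for u using UV[of "g (\<tau> u)"] by (simp add: eq)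
      then show "\<exists>g \<tau>. A.complete g \<and> strict_mono \<tau> \<and> surj \<tau> \<and>
          (\<forall>u. g' u \<in> V \<longleftrightarrow> g (\<tau> u) \<in> U) \<and> (\<forall>u. g' u = H (g (\<tau> u)))"
        using 1 eq by blast
    qed
    then obtain I \<phi> \<tau> where o: "orbit_in W (X, Y) U I \<phi>" and m: "strict_mono \<tau>" "surj \<tau>" "\<tau> ` J = I"
      and eq: "\<forall>u\<in>J. \<psi> u = H (\<phi> (\<tau> u))" by blast
    note inv = strict_mono_surj_inv[OF m(1,2)]
    have "strict_mono_on I (inv \<tau>)" using inv(1) by (auto simp: strict_mono_on_def strict_mono_def)
    moreover have "inv \<tau> ` I = J" unfolding m(3)[symmetric] by (simp add: image_image inv(4))
    moreover have "\<forall>t\<in>I. H (\<phi> t) = \<psi> (inv \<tau> t)" unfolding m(3)[symmetric] using eq by (simp add: inv(4))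
    ultimately have "maps_orbit H I \<phi> J \<psi>" unfolding maps_orbit_def by blast
    then show ?thesis using o by blast
  qed
  moreover have "H ` (switching_line W \<inter> U) = switching_line W \<inter> V"
  proof (intro equalityI subsetI)
    fix q assume "q \<in> H ` (switching_line W \<inter> U)"
    then obtain p where p: "p \<in> U" "p $ 2 = 0" "q = H p" by (auto simp: switching_line_def)
    then have "q \<in> V" "q $ 2 = 0" using UV[of p] H2[of p] by simp_all
    then show "q \<in> switching_line W \<inter> V" using VW by (auto simp: switching_line_def)
  next
    fix q assume q: "q \<in> switching_line W \<inter> V"
    then obtain p where p: "p \<in> U" "q = H p" by (auto simp: V_def)
    then have "p $ 2 = 0" using q H2[of p] by (simp add: switching_line_def)
    then show "q \<in> H ` (switching_line W \<inter> U)" using p UW by (auto simp: switching_line_def)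
  qed
  ultimately show ?thesis
    unfolding locally_Sigma_equivalent_def using oU U0 UW oV V0 VW homUV by blast
qed

end

text \<open>A field that is a node in normal form after the half plane \<open>s\<close> has been
  made the upper one and time has been reversed if \<open>\<delta> = -1\<close>. With
  \<open>a = \<delta> * s * \<kappa>\<close> the factor \<open>\<delta> * a * sgn c\<close> of
  \<open>pull_axis_sign\<close> is \<kappa>.\<close>

definition half_node :: "real \<Rightarrow> real \<Rightarrow> real \<Rightarrow> (real^2 \<Rightarrow> real^2) \<Rightarrow> bool" where
  "half_node s \<delta> \<kappa> F \<longleftrightarrow>
     (\<exists>a b c N m. shear_data \<delta> a c \<and> sgn c = s \<and> a = \<delta> * s * \<kappa> \<and> node_normal N m \<and> F = pull \<delta> a b c N)"

lemma half_node_lipschitz_field: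
  assumes "half_node s \<delta> \<kappa> F"
  shows "lipschitz_field F"
proof -
  obtain a b c N m where S: "shear_data \<delta> a c" and N: "node_normal N m" and F: "F = pull \<delta> a b c N"
    using assms by (auto simp: half_node_def)
  show ?thesis unfolding F
    by (rule shear_data.pull_lipschitz_field[OF S node_normal.axioms(1)[OF N]])
qed

lemma half_node_axis:
  assumes "half_node s \<delta> \<kappa> F" and x: "x \<noteq> 0"
  shows "\<kappa> * x * F (pt x 0) $ 2 > 0" "t \<noteq> 0 \<Longrightarrow> \<kappa> * x * t * flow F t (pt x 0) $ 2 > 0"
proof -
  obtain a b c N m where S: "shear_data \<delta> a c" and s: "sgn c = s" and a: "a = \<delta> * s * \<kappa>"
    and N: "node_normal N m" and F: "F = pull \<delta> a b c N"
    using assms(1) by (auto simp: half_node_def)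
  interpret S: shear_data \<delta> a c by fact
  have ss: "s * s = 1" using S.c s by (auto simp: sgn_if)
  have "\<delta> * a * sgn c = (\<delta> * \<delta>) * (s * s) * \<kappa>" unfolding s a by (simp only: mult_ac)
  then have k: "\<delta> * a * sgn c = \<kappa>" by (simp add: ss S.\<delta>\<delta>)
  show "\<kappa> * x * F (pt x 0) $ 2 > 0" "t \<noteq> 0 \<Longrightarrow> \<kappa> * x * t * flow F t (pt x 0) $ 2 > 0"
    using pull_axis_sign[OF S N x] unfolding k F by blast+
qed

lemma half_node_half_equiv:
  assumes F: "half_node s \<delta> \<kappa> F" and G: "half_node r \<delta> \<kappa>' G"
  shows "half_equiv s F r G (s * r * \<kappa> * \<kappa>')"
proof -
  obtain a b c N m where S: "shear_data \<delta> a c" and s: "sgn c = s" and a: "a = \<delta> * s * \<kappa>"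
    and N: "node_normal N m" and F: "F = pull \<delta> a b c N"
    using F by (auto simp: half_node_def)
  obtain a' b' c' N' m' where S': "shear_data \<delta> a' c'" and r: "sgn c' = r" and a': "a' = \<delta> * r * \<kappa>'"
    and N': "node_normal N' m'" and G: "G = pull \<delta> a' b' c' N'"
    using G by (auto simp: half_node_def)
  have "a * a' = (\<delta> * \<delta>) * (s * r * \<kappa> * \<kappa>')" unfolding a a' by (simp only: mult_ac)
  then have aa: "a * a' = s * r * \<kappa> * \<kappa>'" by (simp add: shear_data.\<delta>\<delta>[OF S])
  show ?thesis
    using half_equiv_pull[OF node_normal.axioms(1)[OF N] node_normal.axioms(1)[OF N'] node_normal_half_equiv[OF N N'] S S']
    unfolding s r F G aa .
qed

lemma half_node_exists:
  fixes A :: "real^2^2"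
  assumes "C1_vfield W X" "open W" "0 \<in> W" "X 0 = 0" "A = jacobian X (at 0)"
    "det A > 0" "(A $ 1 $ 1 + A $ 2 $ 2)\<^sup>2 > 4 * det A" "A $ 2 $ 1 \<noteq> 0" "\<bar>s\<bar> = 1"
  shows "\<exists>F d. half_node s (- sgn (A $ 1 $ 1 + A $ 2 $ 2)) (sgn (A $ 2 $ 1)) F \<and> d > 0 \<and>
    (\<forall>p. norm p \<le> d \<longrightarrow> X p = F p)"
proof -
  define \<delta> a where "\<delta> = - sgn (A $ 1 $ 1 + A $ 2 $ 2)" and "a = \<delta> * s * sgn (A $ 2 $ 1)"
  show ?thesis
  proof (rule node_normal_form[OF assms \<delta>_def a_def])
    fix b c N m d
    assume *: "shear_data \<delta> a c" "sgn c = s" "node_normal N m"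
      and d: "d > 0" and near: "\<And>p. norm p \<le> d \<Longrightarrow> X p = pull \<delta> a b c N p"
    have "half_node s \<delta> (sgn (A $ 2 $ 1)) (pull \<delta> a b c N)"
      unfolding half_node_def using * a_def by blast
    then show ?thesis unfolding \<delta>_def[symmetric] using d near by blast
  qed
qed

text \<open>The fields of the two half planes must share \<kappa>, the direction in which they cross
  the line, but one of them may attract and the other repel: \<delta> and \<open>\<delta>'\<close>
  are independent.\<close>

lemma half_nodes_pw_field:
  assumes "\<bar>\<kappa>\<bar> = 1" "half_node 1 \<delta> \<kappa> F" "half_node (-1) \<delta>' \<kappa> G"
  shows "piecewise_field (\<lambda>s. if s = 1 then F else G) \<kappa>"
proof (rule piecewise_field.intro)
  fix s :: real assume s: "\<bar>s\<bar> = 1"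
  show "lipschitz_field (if s = 1 then F else G)"
    using half_node_lipschitz_field assms(2,3) by simp
  fix x :: real assume x: "x \<noteq> 0"
  show "\<kappa> * x * (if s = 1 then F else G) (pt x 0) $ 2 > 0"
    using half_node_axis(1)[OF assms(2) x] half_node_axis(1)[OF assms(3) x] by simp
  fix t :: real assume t: "t \<noteq> 0"
  show "\<kappa> * x * t * flow (if s = 1 then F else G) t (pt x 0) $ 2 > 0"
    using half_node_axis(2)[OF assms(2) x t] half_node_axis(2)[OF assms(3) x t] by simp
qed (rule assms(1))

section \<open>Eigenvalue conditions and the model nodes\<close>

lemma eigenvalues_sum_prod:
  fixes A :: "real^2^2"
  assumes "eigenvalues A l1 l2"
  shows "l1 + l2 = of_real (A $ 1 $ 1 + A $ 2 $ 2)" "l1 * l2 = of_real (det A)"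
proof -
  have ch: "(z - A $ 1 $ 1) * (z - A $ 2 $ 2) - A $ 1 $ 2 * A $ 2 $ 1 = (z - l1) * (z - l2)" for z :: complex
    using assms unfolding eigenvalues_def by (simp add: det_2 mat_def)
  have 0: "l1 * l2 = of_real (A $ 1 $ 1) * of_real (A $ 2 $ 2) - of_real (A $ 1 $ 2) * of_real (A $ 2 $ 1)"
    using ch[of 0] by simp
  then show "l1 * l2 = of_real (det A)" by (simp add: det_2)
  show "l1 + l2 = of_real (A $ 1 $ 1 + A $ 2 $ 2)"
    using ch[of 1] 0 by (simp add: algebra_simps)
qed

text \<open>\<open>Omega_nn\<close> and \<open>Omega1\<close> each assert their own pair of
  eigenvalues. The real pair gives the sign of the determinant and a discriminant that is a square,
  the distinct pair a discriminant different from 0.\<close>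

lemma node_matrix:
  fixes A :: "real^2^2"
  assumes l: "eigenvalues A l1 l2" "l1 \<in> \<real>" "l2 \<in> \<real>" "Re (l1 * l2) > 0"
    and m: "eigenvalues A m1 m2" "m1 \<noteq> m2"
  shows "det A > 0" "(A $ 1 $ 1 + A $ 2 $ 2)\<^sup>2 > 4 * det A"
proof -
  show "det A > 0" using l(4) unfolding eigenvalues_sum_prod(2)[OF l(1)] by simp
  obtain a b where ab: "l1 = of_real a" "l2 = of_real b" using l(2,3) by (auto elim!: Reals_cases)
  have t: "A $ 1 $ 1 + A $ 2 $ 2 = a + b" and d: "det A = a * b"
    using eigenvalues_sum_prod[OF l(1)] unfolding ab
    by (metis of_real_add of_real_eq_iff, metis of_real_mult of_real_eq_iff)
  have "(A $ 1 $ 1 + A $ 2 $ 2)\<^sup>2 - 4 * det A = (a - b)\<^sup>2"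
    unfolding t d by (simp add: power2_eq_square algebra_simps)
  moreover have "(A $ 1 $ 1 + A $ 2 $ 2)\<^sup>2 - 4 * det A \<noteq> 0"
  proof
    assume 0: "(A $ 1 $ 1 + A $ 2 $ 2)\<^sup>2 - 4 * det A = 0"
    have "(m1 - m2)\<^sup>2 = (m1 + m2)\<^sup>2 - 4 * (m1 * m2)" by (simp add: power2_eq_square algebra_simps)
    also have "\<dots> = of_real ((A $ 1 $ 1 + A $ 2 $ 2)\<^sup>2 - 4 * det A)"
      unfolding eigenvalues_sum_prod[OF m(1)] by simp
    finally show False using m(2) unfolding 0 by simp
  qed
  moreover have "(a - b)\<^sup>2 \<ge> 0" by simp
  ultimately show "(A $ 1 $ 1 + A $ 2 $ 2)\<^sup>2 > 4 * det A" by linarith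
qed

lemma node_field_bounded_linear: "bounded_linear (node_field g)"
  unfolding linear_conv_bounded_linear[symmetric]
  by (rule linearI) (auto simp: node_field_def vec_eq_iff forall_2 algebra_simps)

lemma jacobian_node_field: "jacobian (node_field g) (at p) = (\<chi> i j. if i = j then 2 * g else 1)"
proof -
  have "frechet_derivative (node_field g) (at p) = node_field g"
    using frechet_derivative_at[OF bounded_linear_imp_has_derivative[OF node_field_bounded_linear]] by simp
  then show ?thesis
    by (simp add: jacobian_def matrix_def vec_eq_iff forall_2 node_field_def axis_def)
qed

lemma node_field_C1: "C1_vfield W (node_field g)"
  unfolding C1_vfield_def jacobian_node_field
  using bounded_linear_imp_differentiable[OF node_field_bounded_linear] by auto

lemma node_field_0: "node_field g 0 = 0"
  by (simp add: node_field_def)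

text \<open>The eigenvectors are \<open>(1, 1)\<close> and \<open>(1, -1)\<close>. For
  \<open>\<bar>g\<bar> = 1\<close> the product of the eigenvalues is 3 and their sum
  \<open>4 * g\<close> has the sign of \<open>g\<close>.\<close>

lemma node_field_eigenvalues:
  "eigenvalues (jacobian (node_field g) (at 0)) (of_real (2 * g + 1)) (of_real (2 * g - 1))"
  unfolding eigenvalues_def jacobian_node_field by (simp add: det_2 mat_def algebra_simps)

lemma node_field_Omega_nn:
  assumes "\<bar>g\<bar> = 1" "\<bar>h\<bar> = 1"
  shows "(node_field g, node_field h) \<in> Omega_nn W"
proof -
  have sq: "g * g = 1" "h * h = 1" using assms by (auto simp: abs_if split: if_splits)
  have det: "det (jacobian (node_field g) (at 0)) = 3" "det (jacobian (node_field h) (at 0)) = 3"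
    unfolding jacobian_node_field using sq by (simp_all add: det_2)
  have O0: "(node_field g, node_field h) \<in> Omega0 W"
    unfolding Omega0_def Omega_def
    using det by (simp add: node_field_C1 node_field_0) (simp add: jacobian_node_field)
  have O1: "(node_field g, node_field h) \<in> Omega1 W"
    unfolding Omega1_def using O0 node_field_eigenvalues[of g] node_field_eigenvalues[of h]
    by (auto simp: ell_def intro!: exI)
  have re: "Re (of_real (2 * g + 1) * of_real (2 * g - 1)) > 0" "Re (of_real (2 * h + 1) * of_real (2 * h - 1)) > 0"
    using sq by (simp_all add: algebra_simps)
  show ?thesis
    unfolding Omega_nn_def mem_Collect_eq case_prod_conv
    using O1 node_field_eigenvalues[of g] node_field_eigenvalues[of h] re Reals_of_real by blast
qed

text \<open>The sign of the trace tells attraction from repulsion. A half plane can be matched with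
  one of the model whose node has the same sign, so \<open>s'\<close> records whether
  \<open>X\<close> corresponds to \<open>g\<close> or to \<open>h\<close>.\<close>

lemma nodes_equivalent:
  fixes X Y :: vfield and g h s' :: real
  defines "A \<equiv> jacobian X (at 0)" and "B \<equiv> jacobian Y (at 0)"
  assumes W: "open W" "0 \<in> W" and C1: "C1_vfield W X" "C1_vfield W Y" and eq: "X 0 = 0" "Y 0 = 0"
    and A: "det A > 0" "(A $ 1 $ 1 + A $ 2 $ 2)\<^sup>2 > 4 * det A"
    and B: "det B > 0" "(B $ 1 $ 1 + B $ 2 $ 2)\<^sup>2 > 4 * det B"
    and AB: "A $ 2 $ 1 * B $ 2 $ 1 > 0"
    and g: "\<bar>g\<bar> = 1" "\<bar>h\<bar> = 1" and s': "\<bar>s'\<bar> = 1"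
    and signs: "sgn (A $ 1 $ 1 + A $ 2 $ 2) = (if s' = 1 then g else h)"
      "sgn (B $ 1 $ 1 + B $ 2 $ 2) = (if s' = 1 then h else g)"
  shows "locally_Sigma_equivalent W (X, Y) (node_field g, node_field h)"
proof -
  define \<kappa> where "\<kappa> = sgn (A $ 2 $ 1)"
  have A21: "A $ 2 $ 1 \<noteq> 0" and B21: "B $ 2 $ 1 \<noteq> 0" using AB by auto
  have \<kappa>: "\<bar>\<kappa>\<bar> = 1" using A21 by (simp add: \<kappa>_def abs_sgn_eq)
  have \<kappa>B: "sgn (B $ 2 $ 1) = \<kappa>" using AB by (auto simp: \<kappa>_def sgn_if zero_less_mult_iff)
  have one: "\<bar>1 :: real\<bar> = 1" "\<bar>-1 :: real\<bar> = 1" by simp_all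
  obtain F1 d1 where F1: "half_node 1 (- sgn (A $ 1 $ 1 + A $ 2 $ 2)) \<kappa> F1" and d1: "d1 > 0" "\<And>p. norm p \<le> d1 \<Longrightarrow> X p = F1 p"
    using half_node_exists[OF C1(1) W eq(1) A_def[THEN meta_eq_to_obj_eq] A A21 one(1)] unfolding \<kappa>_def by blast
  obtain F2 d2 where F2: "half_node (-1) (- sgn (B $ 1 $ 1 + B $ 2 $ 2)) \<kappa> F2" and d2: "d2 > 0" "\<And>p. norm p \<le> d2 \<Longrightarrow> Y p = F2 p"
    using half_node_exists[OF C1(2) W eq(2) B_def[THEN meta_eq_to_obj_eq] B B21 one(2)] unfolding \<kappa>B by blast
  have node: "\<exists>G d. half_node s (- k) 1 G \<and> d > 0 \<and> (\<forall>p. norm p \<le> d \<longrightarrow> node_field k p = G p)"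
    if s: "\<bar>s\<bar> = 1" and k: "\<bar>k\<bar> = 1" for s k :: real
  proof -
    let ?J = "jacobian (node_field k) (at 0)"
    have kk: "k * k = 1" using k by (auto simp: abs_if split: if_splits)
    have J: "?J $ 1 $ 1 = 2 * k" "?J $ 2 $ 2 = 2 * k" "?J $ 1 $ 2 = 1" "?J $ 2 $ 1 = 1" by (simp_all add: jacobian_node_field)
    have det: "det ?J = 3" unfolding det_2 J using kk by simp
    have tr: "(?J $ 1 $ 1 + ?J $ 2 $ 2)\<^sup>2 > 4 * det ?J" unfolding det unfolding J using kk by (simp add: power2_eq_square)
    have sg: "sgn (?J $ 1 $ 1 + ?J $ 2 $ 2) = k" "sgn (?J $ 2 $ 1) = 1"
      unfolding J using k by (auto simp: sgn_if abs_if split: if_splits)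
    have "det ?J > 0" "?J $ 2 $ 1 \<noteq> 0" by (simp_all add: det J)
    from half_node_exists[OF node_field_C1[of W k] W node_field_0 refl this(1) tr this(2) s]
    show ?thesis unfolding sg by blast
  qed
  obtain G1 e1 where G1: "half_node 1 (- g) 1 G1" and e1: "e1 > 0" "\<And>p. norm p \<le> e1 \<Longrightarrow> node_field g p = G1 p"
    using node[OF one(1) g(1)] by blast
  obtain G2 e2 where G2: "half_node (-1) (- h) 1 G2" and e2: "e2 > 0" "\<And>p. norm p \<le> e2 \<Longrightarrow> node_field h p = G2 p"
    using node[OF one(2) g(2)] by blast
  define FF where "FF = (\<lambda>s :: real. if s = 1 then F1 else F2)"
  define GG where "GG = (\<lambda>s :: real. if s = 1 then G1 else G2)"
  have PF: "piecewise_field FF \<kappa>" unfolding FF_def by (rule half_nodes_pw_field[OF \<kappa> F1 F2])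
  have PG: "piecewise_field GG 1" unfolding GG_def by (rule half_nodes_pw_field[OF _ G1 G2]) simp
  have s'_cases: "s' = 1 \<or> s' = -1" using s' by linarith
  \<comment> \<open>The half plane \<open>s\<close> goes to \<open>s * s'\<close>, so the factor
    \<open>s * (s * s') * \<kappa> * 1\<close> on the axis is \<open>s' * \<kappa>\<close> for both
    values of \<open>s\<close>.\<close>
  have halves: "half_equiv s (FF s) (s * s') (GG (s * s')) (s' * \<kappa> * 1)" if s: "\<bar>s\<bar> = 1" for s
  proof -
    have "s = 1 \<or> s = -1" using s by linarith
    then show ?thesis
      using s'_cases half_node_half_equiv[OF F1, of 1 1 G1] half_node_half_equiv[OF F1, of "-1" 1 G2]
        half_node_half_equiv[OF F2, of 1 1 G1] half_node_half_equiv[OF F2, of "-1" 1 G2] G1 G2 signs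
      by (elim disjE) (simp_all add: FF_def GG_def)
  qed
  interpret glued_equiv FF \<kappa> GG 1 s' "s' * \<kappa> * 1"
    using PF PG s' halves by (intro glued_equiv.intro glued_equiv_axioms.intro) simp_all
  show ?thesis
  proof (rule local_equivalence[where d = "min d1 d2" and d' = "min e1 e2"])
    show "X p = FF 1 p" "Y p = FF (-1) p" if "norm p \<le> min d1 d2" for p
      using that d1(2) d2(2) by (simp_all add: FF_def)
    show "node_field g p = GG 1 p" "node_field h p = GG (-1) p" if "norm p \<le> min e1 e2" for p
      using that e1(2) e2(2) by (simp_all add: GG_def)
  qed (use W eq d1(1) d2(1) e1(1) e2(1) node_field_0 in auto)
qed

theorem lemma3p5:
  fixes W :: "(real^2) set" and X Y :: vfield
    and lp1 lp2 lm1 lm2 :: complex and \<gamma> \<eta> :: real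
  assumes "open W" and "bounded W" and "0 \<in> W"
    and "(X, Y) \<in> Omega_nn W"
    and "eigenvalues (jacobian X (at 0)) lp1 lp2"
    and "eigenvalues (jacobian Y (at 0)) lm1 lm2"
    and "Re (lp1 + lp2) * Re (lm1 + lm2) > 0 \<Longrightarrow>
           \<gamma> = sgn (Re (lp1 + lp2)) \<and> \<eta> = sgn (Re (lp1 + lp2))"
    and "Re (lp1 + lp2) * Re (lm1 + lm2) < 0 \<Longrightarrow> \<gamma> = 1 \<and> \<eta> = - 1"
  shows "(node_field \<gamma>, node_field \<eta>) \<in> Omega_nn W \<and>
         locally_Sigma_equivalent W (X, Y) (node_field \<gamma>, node_field \<eta>)"
proof -
  let ?A = "jacobian X (at 0)" and ?B = "jacobian Y (at 0)"
  define a where "a = ?A $ 1 $ 1 + ?A $ 2 $ 2"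
  define b where "b = ?B $ 1 $ 1 + ?B $ 2 $ 2"
  obtain l1 l2 m1 m2 where l: "eigenvalues ?A l1 l2" "l1 \<in> \<real>" "l2 \<in> \<real>" "Re (l1 * l2) > 0"
    and m: "eigenvalues ?B m1 m2" "m1 \<in> \<real>" "m2 \<in> \<real>" "Re (m1 * m2) > 0"
    using assms(4) unfolding Omega_nn_def by blast
  have O1: "(X, Y) \<in> Omega1 W" using assms(4) unfolding Omega_nn_def by blast
  then obtain k1 k2 n1 n2 where k: "eigenvalues ?A k1 k2" "k1 \<noteq> k2" and n: "eigenvalues ?B n1 n2" "n1 \<noteq> n2"
    unfolding Omega1_def by blast
  have O0: "(X, Y) \<in> Omega0 W" using O1 unfolding Omega1_def by blast
  note A = node_matrix[OF l k] and B = node_matrix[OF m n]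
  have C1: "C1_vfield W X" "C1_vfield W Y" and eq: "X 0 = 0" "Y 0 = 0" and AB: "?A $ 2 $ 1 * ?B $ 2 $ 1 > 0"
    using O0 unfolding Omega0_def Omega_def by blast+
  have ra: "Re (lp1 + lp2) = a" and rb: "Re (lm1 + lm2) = b"
    unfolding eigenvalues_sum_prod(1)[OF assms(5)] eigenvalues_sum_prod(1)[OF assms(6)] by (simp_all add: a_def b_def)
  have a0: "a \<noteq> 0" and b0: "b \<noteq> 0" using A B by (auto simp: a_def b_def)
  have cases: "(a * b > 0 \<and> \<gamma> = sgn a \<and> \<eta> = sgn a) \<or> (a * b < 0 \<and> \<gamma> = 1 \<and> \<eta> = -1)"
    using assms(7,8) a0 b0 unfolding ra rb by (metis linorder_neqE_linordered_idom mult_eq_0_iff)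
  have g: "\<bar>\<gamma>\<bar> = 1" "\<bar>\<eta>\<bar> = 1" using cases a0 by (auto simp: abs_sgn_eq)
  \<comment> \<open>The half planes are interchanged only if \<open>a < 0 < b\<close>: then \<gamma>
    is 1, while \<open>X\<close> attracts. In all other cases \<gamma> is the sign of
    \<open>a\<close>.\<close>
  define s' where "s' = (if \<gamma> = sgn a then 1 else -1 :: real)"
  have signs: "sgn a = (if s' = 1 then \<gamma> else \<eta>)" "sgn b = (if s' = 1 then \<eta> else \<gamma>)"
    using cases a0 b0 by (auto simp: s'_def sgn_if zero_less_mult_iff mult_less_0_iff split: if_splits)
  have "\<bar>s'\<bar> = 1" by (simp add: s'_def)
  from nodes_equivalent[OF assms(1,3) C1 eq A B AB g this signs[unfolded a_def b_def]]
  show ?thesis using node_field_Omega_nn[OF g] by blast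
qed

end
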